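(* For any integers $p,q\ge2$, there is an injective homomorphism $F(p)\to F(q)$ which is a quasi-isometric embedding with respect to the word metrics.
   Context: For $r\ge2$, $F(r)$ is the group of piecewise-linear orientation-preserving homeomorphisms of $[0,1]$ with breakpoints in $\mathbb{Z}[1/r]$ and slopes integer powers of $r$, with presentation $\langle x_0,x_1,\dots\mid x_i^{-1}x_jx_i=x_{j+r-1}\ (i<j)\rangle$; it is generated by $x_0,\dots,x_{r-1}$ and its word metric is taken with respect to these generators. A map $f$ between metric spaces is a quasi-isometric embedding if there are constants $C\ge1$, $K\ge0$ with $\frac1C d(a,b)-K\le d(f(a),f(b))\le C d(a,b)+K$ for all $a,b$. *)

theory Defs
  imports "HOL-Analysis.Analysis" "HOL-Algebra.Group"
begin

definition Zinv :: "nat \<Rightarrow> real set" where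
  "Zinv r = {x. \<exists>a::int. \<exists>n::nat. x = of_int a / real r ^ n}"

text \<open>F(r): orientation-preserving PL homeomorphisms of [0,1] with breakpoints in Z[1/r]
  and slopes integer powers of r.  Elements are represented as functions real => real
  that are the identity outside [0,1] (so that equality of elements is equality of functions).\<close>
definition PLF :: "nat \<Rightarrow> (real \<Rightarrow> real) set" where
  "PLF r = {f. (\<forall>t. t \<notin> {0..1} \<longrightarrow> f t = t)
              \<and> f ` {0..1} = {0..1}
              \<and> continuous_on {0..1} f
              \<and> strict_mono_on {0..1} f
              \<and> (\<exists>b :: nat \<Rightarrow> real. \<exists>n::nat. b 0 = 0 \<and> b n = 1
                   \<and> (\<forall>i<n. b i < b (Suc i) \<and> b i \<in> Zinv r)
                   \<and> (\<forall>i<n. \<exists>k::int. \<exists>c::real. \<forall>t\<in>{b i..b (Suc i)}.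
                          f t = real r powi k * t + c))}"

definition Fgrp :: "nat \<Rightarrow> (real \<Rightarrow> real) monoid" where
  "Fgrp r = \<lparr>carrier = PLF r, mult = (\<lambda>f g. f \<circ> g), one = id\<rparr>"

text \<open>Generators x_0, ..., x_{r-2}: x_j has tree pair (root caret with caret at last leaf,
  root caret with caret at leaf j).\<close>
definition ygen :: "nat \<Rightarrow> nat \<Rightarrow> real \<Rightarrow> real" where
  "ygen r j t = (let R = real r; J = real j in
     if t < 0 \<or> t > 1 then t
     else if t \<le> J / R then t
     else if t \<le> (R - 1) / R then J / R + (t - J / R) / R
     else if t \<le> (R - 1) / R + (J + 1) / R^2
       then J / R + (R - 1 - J) / R^2 + (t - (R - 1) / R)
     else (J + 1) / R + R * (t - ((R - 1) / R + (J + 1) / R^2)))"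

definition zgen :: "nat \<Rightarrow> real \<Rightarrow> real" where
  "zgen r t = (let R = real r in
     if t < 0 \<or> t > 1 then t
     else if t \<le> (R - 1) / R then t
     else (R - 1) / R + ygen r 0 (R * t - (R - 1)) / R)"

definition xgen :: "nat \<Rightarrow> nat \<Rightarrow> real \<Rightarrow> real" where
  "xgen r i = (if i + 1 < r then ygen r i else if i + 1 = r then zgen r else id)"

definition Fgens :: "nat \<Rightarrow> (real \<Rightarrow> real) set" where
  "Fgens r = xgen r ` {..<r}"

definition word_length :: "('a, 'b) monoid_scheme \<Rightarrow> 'a set \<Rightarrow> 'a \<Rightarrow> nat" where
  "word_length G S g = (LEAST n. \<exists>ws. length ws = n \<and> set ws \<subseteq> S \<union> m_inv G ` S
                          \<and> foldr (\<lambda>x y. x \<otimes>\<^bsub>G\<^esub> y) ws \<one>\<^bsub>G\<^esub> = g)"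

definition word_dist :: "('a, 'b) monoid_scheme \<Rightarrow> 'a set \<Rightarrow> 'a \<Rightarrow> 'a \<Rightarrow> real" where
  "word_dist G S a b = real (word_length G S (inv\<^bsub>G\<^esub> a \<otimes>\<^bsub>G\<^esub> b))"

definition qi_embedding ::
  "'a set \<Rightarrow> ('a \<Rightarrow> 'a \<Rightarrow> real) \<Rightarrow> ('b \<Rightarrow> 'b \<Rightarrow> real) \<Rightarrow> ('a \<Rightarrow> 'b) \<Rightarrow> bool" where
  "qi_embedding A d d' f = (\<exists>C K. C \<ge> 1 \<and> K \<ge> 0 \<and>
      (\<forall>a\<in>A. \<forall>b\<in>A. d a b / C - K \<le> d' (f a) (f b) \<and> d' (f a) (f b) \<le> C * d a b + K))"

end

theory Submission
  imports Defs "HOL-Library.Sublist"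
begin

text \<open>For \<open>f \<in> F(r)\<close> call a standard \<open>r\<close>-adic interval bad if \<open>f\<close> does not map it affinely onto a standard
  interval.  The number of bad intervals (the number of carets of the reduced tree pair of \<open>f\<close>) is
  subadditive under composition, hence at most linear in the word length.  Conversely a tree with
  \<open>n\<close> carets is a product of at most \<open>n\<close> of the infinitely many generators \<open>x\<^sub>j\<close>, which the relations
  \<open>x\<^sub>j \<circ> x\<^sub>i = x\<^sub>i \<circ> x\<^sub>j\<^sub>+\<^sub>r\<^sub>-\<^sub>1\<close> (for \<open>i < j\<close>) sort into increasing order; conjugating by powers of \<open>x\<^sub>0\<close>, the
  sorted product telescopes to a word of length at most \<open>3 * n\<close> in \<open>x\<^sub>0, \<dots>, x\<^sub>r\<^sub>-\<^sub>1\<close>.  So word length and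
  number of bad intervals are equivalent.

  The embedding replaces every \<open>p\<close>-ary caret by a right vine of \<open>p - 1\<close> carets of arity \<open>q\<close>.  The
  unused leaves form one gap for every interior point of \<open>\<int>[1/p]\<close>; the gaps are dense, and the
  image \<open>g\<close> of \<open>f\<close> is the unique element that carries the gap at \<open>t\<close> affinely to the gap at \<open>f t\<close>.  This
  characterisation is multiplicative in \<open>f\<close>, so existence need only be checked on generators.  The
  embedding cannot decrease the number of bad intervals, which is the lower bound on distances;
  the upper bound holds for every homomorphism between finitely generated groups.\<close>

section \<open>Standard intervals\<close>

text \<open>Counting bad intervals avoids choosing a tree pair: the count belongs to the function
  itself, and subadditivity needs no common refinement. In the same way the embedding is not defined
  on tree pairs, where independence of the chosen pair and multiplicativity would have to be checked
  by refining.

  Gaps are labelled by words: every point of Z[1/p] strictly between 0 and 1 is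
  \<open>pt p (w @ [j]) 1\<close> for exactly one \<open>w\<close> and one \<open>j < p - 1\<close>.
  This is why a gap is encoded as a closed middle segment of a vine node and not as a union of
  leaves.

  The lower bound rests on an injection: \<open>code p q\<close> sends the bad words of
  \<open>f\<close> to bad words of its image. The resulting estimates have additive constant 0, so
  an element with trivial image has word length 0, and injectivity of the homomorphism comes for
  free.\<close>

primrec pt :: "nat \<Rightarrow> nat list \<Rightarrow> real \<Rightarrow> real" where
  "pt r [] t = t"
| "pt r (a # w) t = (real a + pt r w t) / real r"

abbreviation wds :: "nat \<Rightarrow> nat list set" where
  "wds r \<equiv> lists {..<r}"

lemma pt_append: "pt r (u @ v) t = pt r u (pt r v t)"
  by (induction u) auto

lemma pt_affine: "pt r w t = pt r w 0 + t / real r ^ length w"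
  by (induction w) (auto simp: add_divide_distrib)

lemma pt_diff: "pt r w t - pt r w s = (t - s) / real r ^ length w"
  using pt_affine[of r w t] pt_affine[of r w s] by (simp add: diff_divide_distrib)

lemma pt_mono:
  assumes "r \<ge> 2" "s \<le> t" shows "pt r w s \<le> pt r w t"
proof -
  have "(t - s) / real r ^ length w \<ge> 0" using assms by simp
  then show ?thesis using pt_diff[of r w t s] by linarith
qed

lemma pt_strict_mono:
  assumes "r \<ge> 2" "s < t" shows "pt r w s < pt r w t"
proof -
  have "(t - s) / real r ^ length w > 0" using assms by simp
  then show ?thesis using pt_diff[of r w t s] by linarith
qed

lemma pt_Cons_bounds:
  assumes "r \<ge> 2" "a < r" "0 \<le> x" "x \<le> 1"
  shows "0 \<le> (real a + x) / real r" "(real a + x) / real r \<le> 1"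
proof -
  have "real a + 1 \<le> real r" using assms by linarith
  then show "(real a + x) / real r \<le> 1" using assms by (simp add: divide_le_eq)
qed (use assms in simp)

lemma pt_bounds:
  assumes "r \<ge> 2" "w \<in> wds r" "0 \<le> t" "t \<le> 1"
  shows "0 \<le> pt r w t \<and> pt r w t \<le> 1"
  using assms(2)
proof (induction w)
  case (Cons a w)
  then show ?case using pt_Cons_bounds[OF assms(1), of a "pt r w t"] by auto
qed (use assms in auto)

lemma pt_in: "r \<ge> 2 \<Longrightarrow> w \<in> wds r \<Longrightarrow> t \<in> {0..1} \<Longrightarrow> pt r w t \<in> {0..1}"
  using pt_bounds[of r w t] by auto

lemma pt_less_1:
  assumes "r \<ge> 2" "w \<in> wds r" "0 \<le> t" "t < 1" shows "pt r w t < 1"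
  using pt_strict_mono[OF assms(1,4), of w] pt_bounds[OF assms(1,2), of 1] by auto

lemma pt_eq_iff:
  assumes "r \<ge> 2" "w \<in> wds r" "v \<in> wds r" "length w = length v" "pt r w 0 = pt r v 0"
  shows "w = v"
  using assms(4,2,3,5)
proof (induction w v rule: list_induct2)
  case (Cons a w b v)
  have r: "real r > 0" using assms(1) by simp
  have "0 \<le> pt r w 0" "pt r w 0 < 1" "0 \<le> pt r v 0" "pt r v 0 < 1"
    using Cons.prems pt_less_1[OF assms(1)] pt_bounds[OF assms(1)] by auto
  moreover have eq: "real a + pt r w 0 = real b + pt r v 0" using Cons.prems r by simp
  ultimately have "a = b" by linarith
  then show ?case using eq Cons by auto
qed auto

lemma pt_fun_inj:
  assumes "r \<ge> 2" "w \<in> wds r" "v \<in> wds r" "\<And>t. t \<in> {0..1} \<Longrightarrow> pt r w t = pt r v t"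
  shows "w = v"
proof -
  have "1 / real r ^ length w = 1 / real r ^ length v"
    using assms(4)[of 0] assms(4)[of 1] pt_affine[of r w 1] pt_affine[of r v 1] by auto
  then have "real r ^ length w = real r ^ length v" by (simp add: field_simps)
  then have "length w = length v" using assms(1)
    by (metis One_nat_def Suc_le_lessD numeral_2_eq_2 of_nat_1 of_nat_less_iff power_inject_exp)
  then show ?thesis using pt_eq_iff assms by auto
qed

lemma pt_snoc_1: "r \<ge> 2 \<Longrightarrow> pt r (w @ [j]) 1 = pt r (w @ [Suc j]) 0"
  by (simp add: pt_append add.commute)

lemma pt_replicate_1: "r \<ge> 2 \<Longrightarrow> pt r (replicate n (r - 1)) 1 = 1"
  by (induction n) (auto simp: of_nat_diff)

lemma pt_pos:
  assumes "r \<ge> 2" "w \<in> wds r" "i \<ge> 1" shows "pt r (w @ [i]) 0 > 0"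
proof -
  have "0 < real i / real r" using assms by simp
  then show ?thesis using pt_bounds[OF assms(1,2), of 0] pt_strict_mono[OF assms(1), of 0
    "real i / real r" w]
    by (simp add: pt_append)
qed

text \<open>What remains after the leading digit lies strictly between 0 and 1, so that digit is the
  integer part of \<open>r\<close> times the value. Different lengths are excluded in the same way,
  because the remainder of the longer word is positive.\<close>

lemma pt_nonzero_last_digit_unique:
  assumes "r \<ge> 2" "w @ [i] \<in> wds r" "v @ [k] \<in> wds r" "i \<ge> 1" "k \<ge> 1"
    "pt r (w @ [i]) 0 = pt r (v @ [k]) 0"
  shows "w = v \<and> i = k"
  using assms(2,3,6)
proof (induction w arbitrary: v)
  case Nil
  have r: "real r > 0" using assms(1) by simp
  show ?case
  proof (cases v)
    case (Cons b v')
    have "0 < pt r (v' @ [k]) 0" "pt r (v' @ [k]) 0 < 1"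
      using pt_pos[OF assms(1), of v' k] pt_less_1[OF assms(1), of
        "v' @ [k]" 0] Nil.prems Cons assms(5) by auto
    moreover have "real i = real b + pt r (v' @ [k]) 0" using Nil.prems(3) Cons r by simp
    ultimately have "b < i" "i < b + 1" by linarith+
    then show ?thesis by simp
  qed (use Nil r in auto)
next
  case (Cons a w)
  have r: "real r > 0" using assms(1) by simp
  have w: "0 < pt r (w @ [i]) 0" "pt r (w @ [i]) 0 < 1"
    using pt_pos[OF assms(1), of w i] pt_less_1[OF assms(1), of "w @ [i]" 0] Cons.prems assms(4)
      by auto
  show ?case
  proof (cases v)
    case Nil
    then have "real k = real a + pt r (w @ [i]) 0" using Cons.prems(3) r by simp
    then have "a < k" "k < a + 1" using w by linarith+
    then show ?thesis by simp
  next
    case (Cons b v')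
    have "0 < pt r (v' @ [k]) 0" "pt r (v' @ [k]) 0 < 1"
      using pt_pos[OF assms(1), of v' k] pt_less_1[OF assms(1), of
        "v' @ [k]" 0] Cons.prems Cons assms(5) by auto
    moreover have eq: "real a + pt r (w @ [i]) 0 = real b + pt r (v' @ [k]) 0"
      using Cons.prems(3) Cons r by simp
    ultimately have "a = b" using w by linarith
    then show ?thesis using Cons.IH[of v'] Cons.prems Cons eq by auto
  qed
qed

text \<open>The right end of child \<open>j\<close> is the left end of its next sibling, whose
  address ends in the nonzero digit \<open>Suc j\<close>. These addresses label the interior points
  of Z[1/r] from here on.\<close>

lemma pt_right_end_unique:
  assumes "r \<ge> 2" "w \<in> wds r" "v \<in> wds r" "j < r - 1" "k < r - 1"
    "pt r (w @ [j]) 1 = pt r (v @ [k]) 1"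
  shows "w = v \<and> j = k"
  using pt_nonzero_last_digit_unique[of r w "Suc j" v "Suc k"] assms pt_snoc_1[OF assms(1)] by auto

lemma pt_nat:
  assumes "r \<ge> 2" "w \<in> wds r"
  shows "\<exists>a < r ^ length w. pt r w 0 = real a / real r ^ length w"
  using assms(2)
proof (induction w)
  case (Cons b w)
  then obtain a where a: "a < r ^ length w" "pt r w 0 = real a / real r ^ length w" by auto
  have "b * r ^ length w + a < (b + 1) * r ^ length w" using a by simp
  also have "\<dots> \<le> r * r ^ length w" using Cons by (intro mult_right_mono) auto
  finally have "b * r ^ length w + a < r ^ length (b # w)" by simp
  moreover have "pt r (b # w) 0 = real (b * r ^ length w + a) / real r ^ length (b # w)"
    using a assms(1) by (simp add: field_simps)
  ultimately show ?case by blast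
qed auto

lemma pt_surj:
  assumes "r \<ge> 2" "a < r ^ n"
  shows "\<exists>w \<in> wds r. length w = n \<and> pt r w 0 = real a / real r ^ n"
  using assms(2)
proof (induction n arbitrary: a)
  case (Suc n)
  let ?b = "a div r ^ n" and ?c = "a mod r ^ n"
  have pos: "r ^ n > 0" using assms(1) by simp
  obtain w where w: "w \<in> wds r" "length w = n" "pt r w 0 = real ?c / real r ^ n"
    using Suc.IH[of ?c] pos by auto
  have b: "?b < r" using Suc.prems by (simp add: less_mult_imp_div_less)
  have "real a = real (?b * r ^ n + ?c)" by (simp only: div_mult_mod_eq)
  also have "\<dots> = real ?b * real r ^ n + real ?c" by (simp only: of_nat_add of_nat_mult of_nat_power)
  finally have "real a = real ?b * real r ^ n + real ?c" .
  then have "pt r (?b # w) 0 = real a / real r ^ Suc n"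
    using w assms(1) by (simp add: field_simps)
  then show ?case using w b by (intro bexI[of _ "?b # w"]) auto
qed auto

section \<open>Good and bad intervals of a function\<close>

definition maps :: "nat \<Rightarrow> (real \<Rightarrow> real) \<Rightarrow> nat list \<Rightarrow> nat list \<Rightarrow> bool" where
  "maps r f w v \<longleftrightarrow> (\<forall>t\<in>{0..1}. f (pt r w t) = pt r v t)"

lemma mapsD: "maps r f w v \<Longrightarrow> 0 \<le> t \<Longrightarrow> t \<le> 1 \<Longrightarrow> f (pt r w t) = pt r v t"
  by (auto simp: maps_def)

lemma maps_append:
  "r \<ge> 2 \<Longrightarrow> x \<in> wds r \<Longrightarrow> maps r f w v \<Longrightarrow> maps r f (w @ x) (v @ x)"
  unfolding maps_def using pt_in[of r x] by (auto simp: pt_append)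

lemma maps_comp: "maps r f v u \<Longrightarrow> maps r g w v \<Longrightarrow> maps r (f \<circ> g) w u"
  by (auto simp: maps_def)

lemma maps_id [simp]: "maps r id w w"
  by (auto simp: maps_def)

definition bad :: "nat \<Rightarrow> (real \<Rightarrow> real) \<Rightarrow> nat list set" where
  "bad r f = {w \<in> wds r. \<not> (\<exists>v \<in> wds r. maps r f w v)}"

text \<open>A word that is bad for \<open>f \<circ> g\<close> but good for \<open>g\<close> is sent
  by \<open>g\<close> to a word bad for \<open>f\<close>. Since \<open>g\<close> is injective, that
  image determines the word, so such words are at most as many as \<open>bad r f\<close>.\<close>

lemma bad_comp:
  assumes "r \<ge> 2" "inj_on g {0..1}" "finite (bad r f)" "finite (bad r g)"
  shows "finite (bad r (f \<circ> g)) \<and> card (bad r (f \<circ> g)) \<le> card (bad r f) + card (bad r g)"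
proof -
  define D where "D = {w \<in> wds r. \<exists>v \<in> bad r f. maps r g w v}"
  define h where "h w = (SOME v. v \<in> bad r f \<and> maps r g w v)" for w
  have h: "h w \<in> bad r f" "maps r g w (h w)" if "w \<in> D" for w
  proof -
    have "\<exists>v. v \<in> bad r f \<and> maps r g w v" using that unfolding D_def by blast
    then have "h w \<in> bad r f \<and> maps r g w (h w)" unfolding h_def by (rule someI_ex)
    then show "h w \<in> bad r f" "maps r g w (h w)" by auto
  qed
  have inj: "inj_on h D"
  proof (rule inj_onI)
    fix w w' assume *: "w \<in> D" "w' \<in> D" "h w = h w'"
    have ww: "w \<in> wds r" "w' \<in> wds r" using * D_def by auto
    have "pt r w t = pt r w' t" if "t \<in> {0..1}" for t
    proof -
      have "g (pt r w t) = g (pt r w' t)" using h(2)[OF *(1)] h(2)[OF *(2)] *(3) that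
        by (auto simp: maps_def)
      then show ?thesis using assms(2) pt_in[OF assms(1)] ww that by (meson inj_onD)
    qed
    then show "w = w'" using pt_fun_inj[OF assms(1)] ww by blast
  qed
  have hD: "h ` D \<subseteq> bad r f" using h by auto
  have finD: "finite D" using inj hD assms(3) finite_imageD finite_subset by blast
  have cD: "card D \<le> card (bad r f)" using inj hD assms(3) card_inj_on_le by blast
  have sub: "bad r (f \<circ> g) \<subseteq> D \<union> bad r g"
  proof
    fix w assume w: "w \<in> bad r (f \<circ> g)"
    show "w \<in> D \<union> bad r g"
    proof (cases "w \<in> bad r g")
      case False
      then obtain v where v: "v \<in> wds r" "maps r g w v" using w by (auto simp: bad_def)
      have "v \<in> bad r f" using w v maps_comp[of r f v _ g w] by (auto simp: bad_def)
      then show ?thesis using v w by (auto simp: D_def bad_def)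
    qed auto
  qed
  have "card (bad r (f \<circ> g)) \<le> card (D \<union> bad r g)"
    using sub finD assms(4) by (intro card_mono) auto
  also have "\<dots> \<le> card D + card (bad r g)" by (rule card_Un_le)
  finally show ?thesis using cD sub finD assms(4) finite_subset by fastforce
qed

section \<open>Subdivisions and trees\<close>

text \<open>A subdivision described only by matching end points. Unlike \<open>tree\<close>, this
  notion is carried along by a map at once (\<open>maps_chain\<close>), and
  \<open>chain_imp_tree\<close> recovers the tree afterwards.\<close>

primrec chain :: "nat \<Rightarrow> real \<Rightarrow> nat list list \<Rightarrow> real \<Rightarrow> bool" where
  "chain r a [] b \<longleftrightarrow> a = b"
| "chain r a (w # ws) b \<longleftrightarrow> pt r w 0 = a \<and> chain r (pt r w 1) ws b"

lemma chain_append: "chain r a (xs @ ys) b \<longleftrightarrow> (\<exists>c. chain r a xs c \<and> chain r c ys b)"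
  by (induction xs arbitrary: a) auto

text \<open>In \<open>tree r ws C\<close> the list \<open>ws\<close> consists of the leaves from left to right and \<open>C\<close> of the interior
  nodes of a finite \<open>r\<close>-ary tree.\<close>

inductive tree :: "nat \<Rightarrow> nat list list \<Rightarrow> nat list set \<Rightarrow> bool" for r where
  root: "tree r [[]] {}"
| caret: "tree r (xs @ w # ys) C \<Longrightarrow>
    tree r (xs @ map (\<lambda>m. w @ [m]) [0..<r] @ ys) (insert w C)"

lemma tree_finite: "tree r ws C \<Longrightarrow> finite C"
  by (induction rule: tree.induct) auto

lemma tree_wds: "tree r ws C \<Longrightarrow> set ws \<subseteq> wds r \<and> C \<subseteq> wds r"
  by (induction rule: tree.induct) auto

text \<open>Serves one purpose: a leaf about to be expanded is not yet an interior node, so each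
  caret raises the cardinality of \<open>C\<close> by exactly one.\<close>

lemma tree_prefix_free:
  "tree r ws C \<Longrightarrow> sorted_wrt (\<lambda>x y. \<not> prefix x y \<and> \<not> prefix y x) ws
     \<and> (\<forall>w\<in>set ws. \<forall>c\<in>C. \<not> prefix w c)"
proof (induction rule: tree.induct)
  case (caret xs w ys C)
  have pre: "sorted_wrt (\<lambda>x y. \<not> prefix x y \<and> \<not> prefix y x) (map (\<lambda>m. w @ [m]) [0..<r])"
    by (auto simp: sorted_wrt_map sorted_wrt_iff_nth_less)
  have app: "prefix w x" if "prefix (w @ [m]) x" for x m using that append_prefixD by blast
  have app2: "prefix x w \<or> prefix w x" if "prefix x (w @ [m])" for x m
    using that by (auto simp: prefix_snoc)
  show ?case using caret.IH pre app app2
    by (auto simp: sorted_wrt_append)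
qed auto

lemma tree_length: assumes "r \<ge> 2" "tree r ws C" shows "length ws = (r - 1) * card C + 1"
  using assms(2)
proof (induction rule: tree.induct)
  case (caret xs w ys C)
  have "w \<notin> C" using tree_prefix_free[OF caret.hyps(1)] by auto
  then have "card (insert w C) = Suc (card C)" using tree_finite[OF caret.hyps(1)] by simp
  moreover obtain s where "r = Suc s" using assms(1) by (cases r) auto
  ultimately show ?case using caret by simp
qed auto

lemma caret_chain:
  assumes "r \<ge> 2" "k \<le> r"
  shows "chain r (pt r w 0) (map (\<lambda>m. w @ [m]) [0..<k]) (pt r w (real k / real r))"
  using assms(2)
proof (induction k)
  case (Suc k)
  then show ?case by (simp add: chain_append pt_append add.commute)
qed auto

lemma chain_unique: "chain r a xs b \<Longrightarrow> chain r a xs c \<Longrightarrow> b = c"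
  by (induction xs arbitrary: a) auto

lemma tree_chain:
  assumes "r \<ge> 2" "tree r ws C" shows "chain r 0 ws 1"
  using assms(2)
proof (induction rule: tree.induct)
  case (caret xs w ys C)
  then show ?case using caret_chain[OF assms(1), of r w] assms(1) by (auto simp: chain_append)
qed auto

lemma leading_digit:
  fixes s :: real
  assumes "r \<ge> 2" "s \<in> {0..1}"
  shows "\<exists>m<r. \<exists>t\<in>{0..1}. s = (real m + t) / real r"
proof (cases "s = 1")
  case True
  then show ?thesis using assms
    by (intro exI[of _ "r - 1"] conjI bexI[of _ 1]) (auto simp: of_nat_diff)
next
  case False
  let ?m = "nat \<lfloor>s * real r\<rfloor>"
  have s: "0 \<le> s * real r" "s * real r < real r" using assms False by auto
  then have "?m < r" by (simp add: floor_less_iff nat_less_iff)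
  moreover have "real ?m = of_int \<lfloor>s * real r\<rfloor>" using s by (simp add: of_nat_nat)
  then have "s * real r - real ?m \<in> {0..1}" by simp linarith
  ultimately show ?thesis using assms
    by (intro exI[of _ ?m] conjI bexI[of _ "s * real r - real ?m"]) auto
qed

lemma tree_covers_points:
  assumes "r \<ge> 2" "tree r ws C" "t \<in> {0..1}"
  shows "\<exists>w \<in> set ws. \<exists>s \<in> {0..1}. t = pt r w s"
  using assms(2)
proof (induction rule: tree.induct)
  case (caret xs x ys C)
  then obtain w s where ws: "w \<in> set (xs @ x # ys)" "s \<in> {0..1}" "t = pt r w s"
    by blast
  show ?case
  proof (cases "w = x")
    case True
    then obtain m t' where m: "m < r" "t' \<in> {0..1}" "s = (real m + t') / real r"
      using leading_digit[OF assms(1) ws(2)] by blast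
    then have "t = pt r (x @ [m]) t'" using True ws by (simp add: pt_append)
    moreover have "x @ [m] \<in> set (xs @ map (\<lambda>m. x @ [m]) [0..<r] @ ys)" using m by auto
    ultimately show ?thesis using m(2) by blast
  next
    case False
    then have "w \<in> set (xs @ map (\<lambda>m. x @ [m]) [0..<r] @ ys)" using ws(1) by auto
    then show ?thesis using ws(2,3) by blast
  qed
qed (use assms(3) in auto)

text \<open>Among the trees whose interior nodes lie in \<open>B\<close> take one with the most
  carets; a leaf in \<open>B\<close> could still be expanded.\<close>

lemma tree_exists:
  assumes "finite B"
  shows "\<exists>ws C. tree r ws C \<and> C \<subseteq> B \<and> set ws \<inter> B = {}"
proof -
  define Q where "Q n \<longleftrightarrow> (\<exists>ws C. tree r ws C \<and> C \<subseteq> B \<and> card C = n)" for n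
  have Q0: "Q 0" using tree.root by (fastforce simp: Q_def)
  have bd: "n \<le> card B" if "Q n" for n using that assms card_mono by (auto simp: Q_def)
  define N where "N = (GREATEST n. Q n)"
  have QN: "Q N" unfolding N_def using Q0 bd by (rule GreatestI_nat) auto
  have nQ: "\<not> Q (Suc N)" using Greatest_le_nat[of Q "Suc N" "card B"] bd N_def by auto
  obtain ws C where t: "tree r ws C" "C \<subseteq> B" "card C = N" using QN Q_def by auto
  have "w \<notin> B" if w: "w \<in> set ws" for w
  proof
    assume "w \<in> B"
    obtain xs ys where e: "ws = xs @ w # ys" using w split_list by metis
    have "w \<notin> C" using tree_prefix_free[OF t(1)] w by auto
    then have "card (insert w C) = Suc N" using tree_finite[OF t(1)] t(3) by simp
    then have "Q (Suc N)" unfolding Q_def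
      using tree.caret[of r xs w ys C] t \<open>w \<in> B\<close> e by blast
    then show False using nQ by simp
  qed
  then show ?thesis using t by blast
qed

text \<open>Stripping trailing digits \<open>r - 1\<close> does not move the right end. The strict
  bound on \<open>length y\<close> is what contradicts maximal depth in
  \<open>chain_imp_tree\<close>.\<close>

lemma right_end_cases:
  assumes "r \<ge> 2" "x \<in> wds r"
  shows "pt r x 1 = 1 \<or> (\<exists>y j. y \<in> wds r \<and> j < r - 1 \<and> length y < length x \<and> pt r x 1
    = pt r (y @ [j]) 1)"
  using assms(2)
proof (induction x rule: rev_induct)
  case (snoc a x)
  show ?case
  proof (cases "a < r - 1")
    case True
    then show ?thesis using snoc by (intro disjI2 exI[of _ x] exI[of _ a]) auto
  next
    case False
    then have "a = r - 1" using snoc by auto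
    then have "pt r (x @ [a]) 1 = pt r x 1" using assms(1) by (simp add: pt_append of_nat_diff)
    moreover have "x \<in> wds r" using snoc.prems by simp
    ultimately show ?thesis using snoc.IH by (metis length_append_singleton less_SucI)
  qed
qed auto

lemma left_end_cases:
  assumes "r \<ge> 2" "x \<in> wds r"
  shows "pt r x 0 = 0 \<or> (\<exists>y i n. y @ [i] \<in> wds r \<and> i \<ge> 1 \<and> x = y @ [i] @ replicate n 0 \<and> pt r x 0
    = pt r (y @ [i]) 0)"
  using assms(2)
proof (induction x rule: rev_induct)
  case (snoc a x)
  show ?case
  proof (cases "a = 0")
    case False
    then show ?thesis using snoc by (intro disjI2 exI[of _ x] exI[of _ a] exI[of _ 0]) auto
  next
    case True
    then have e: "pt r (x @ [a]) 0 = pt r x 0" by (simp add: pt_append)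
    have "x \<in> wds r" using snoc.prems by auto
    from snoc.IH[OF this] show ?thesis
    proof (elim disjE exE conjE)
      fix y i n assume "y @ [i] \<in> wds r" "1 \<le> i" "x = y @ [i] @ replicate n 0"
        "pt r x 0 = pt r (y @ [i]) 0"
      then show ?thesis using e True
        by (intro disjI2 exI[of _ y] exI[of _ i] exI[of _
          "Suc n"]) (auto simp: replicate_append_same)
    qed (use e in auto)
  qed
qed auto

text \<open>A deepest interval of the subdivision that comes first is the leftmost child of a node
  all of whose children occur consecutively, so that a caret can be removed.\<close>

lemma chain_imp_tree:
  assumes "r \<ge> 2" "chain r 0 vs 1" "set vs \<subseteq> wds r"
  shows "\<exists>C. tree r vs C"
  using assms(2,3)
proof (induction vs rule: length_induct)
  case (1 vs)
  have ne: "vs \<noteq> []" using 1 by auto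
  define d where "d = Max (length ` set vs)"
  have dmax: "length v \<le> d" if "v \<in> set vs" for v using that by (simp add: d_def)
  have "\<exists>v \<in> set vs. length v = d"
  proof -
    have "d \<in> length ` set vs" unfolding d_def using ne by (intro Max_in) auto
    then show ?thesis by auto
  qed
  then obtain xs v ys where vs: "vs = xs @ v # ys" and lv: "length v = d" and lx:
    "\<forall>x\<in>set xs. length x \<noteq> d"
    using split_list_first_prop[of vs "\<lambda>v. length v = d"] by blast
  have lx': "length x < d" if "x \<in> set xs" for x using that lx dmax[of x] vs by fastforce
  obtain c where c: "chain r 0 xs c" "pt r v 0 = c" "chain r (pt r v 1) ys 1"
    using 1 vs by (auto simp: chain_append)
  show ?case
  proof (cases "d = 0")
    case True
    then have "xs = []" using lx' by (cases xs) auto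
    moreover have "v = []" using lv True by simp
    moreover have "ys = []"
    proof (cases ys)
      case (Cons y ys')
      then have "y = []" using dmax[of y] vs True by auto
      then show ?thesis using c Cons \<open>v = []\<close> by auto
    qed
    ultimately show ?thesis using vs tree.root by auto
  next
    case False
    then obtain u m where v: "v = u @ [m]" using lv by (cases v rule: rev_cases) auto
    have uw: "u \<in> wds r" "m < r" using 1 vs v by auto
    have lu: "d = Suc (length u)" using lv v by simp
    \<comment> \<open>Otherwise the left end of \<open>v\<close> is an interior point with address
      \<open>u @ [m]\<close>. The interval before \<open>v\<close> ends there, which forces it to be
      longer than \<open>u\<close>, hence of length at least \<open>d\<close>; but all earlier
      intervals are shorter than \<open>d\<close>.\<close>
    have "m = 0"
    proof (rule ccontr)
      assume m: "m \<noteq> 0"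
      show False
      proof (cases xs rule: rev_cases)
        case Nil
        then show False using c pt_pos[OF assms(1) uw(1), of m] m v by auto
      next
        case (snoc xs' x)
        then have cx: "pt r x 1 = pt r (u @ [m]) 0" using c v by (auto simp: chain_append)
        have xw: "x \<in> wds r" using 1 vs snoc by auto
        have "pt r (u @ [m]) 0 < 1" using pt_less_1[OF assms(1), of "u @ [m]" 0] uw by auto
        then obtain y j where y: "y \<in> wds r" "j < r - 1" "length y < length x"
          "pt r x 1 = pt r (y @ [j]) 1"
          using right_end_cases[OF assms(1) xw] cx by auto
        have "y = u" using pt_nonzero_last_digit_unique[OF assms(1), of y "Suc j" u m] y uw m cx
            pt_snoc_1[OF assms(1), of y j] by auto
        then show False using y(3) lx'[of x] snoc lu by simp
      qed
    qed
    \<comment> \<open>Induction along the siblings: the interval that starts at the left end of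
      \<open>u @ [k]\<close> is \<open>u @ [k]\<close> followed by zeros, and maximality of
      \<open>d\<close> leaves no room for a zero.\<close>
    have run: "\<exists>zs. v # ys = map (\<lambda>m. u @ [m]) [0..<k] @ zs" if "1 \<le> k" "k \<le> r" for k
      using that
    proof (induction k rule: dec_induct)
      case base
      then show ?case using v \<open>m = 0\<close> by auto
    next
      case (step k)
      then obtain zs where zs: "v # ys = map (\<lambda>m. u @ [m]) [0..<k] @ zs" by auto
      have "chain r (pt r u 0) (v # ys) 1" using c v \<open>m = 0\<close> by (simp add: pt_append)
      then obtain e where e: "chain r (pt r u 0) (map (\<lambda>m. u @ [m]) [0..<k]) e" "chain r e zs 1"
        unfolding zs chain_append by blast
      have "e = pt r u (real k / real r)"
        using caret_chain[OF assms(1), of k u] e(1) step chain_unique by auto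
      then have ek: "e = pt r (u @ [k]) 0" by (simp add: pt_append)
      have ekw: "u @ [k] \<in> wds r" using uw step by auto
      have "e \<noteq> 1" using pt_less_1[OF assms(1) ekw, of 0] ek by auto
      then obtain z zs' where z: "zs = z # zs'" using e by (cases zs) auto
      have zv: "z \<in> set vs" using z zs vs by (metis in_set_conv_decomp Un_iff set_append)
      then have zw: "z \<in> wds r" using 1 by auto
      have pz: "pt r z 0 = pt r (u @ [k]) 0" using e z ek by auto
      have "pt r z 0 \<noteq> 0" using pt_pos[OF assms(1) uw(1), of k] step pz by auto
      then obtain y i n where y: "y @ [i] \<in> wds r" "i \<ge> 1" "z = y @ [i] @ replicate n 0"
        "pt r z 0 = pt r (y @ [i]) 0"
        using left_end_cases[OF assms(1) zw] by blast
      have "y = u \<and> i = k" using pt_nonzero_last_digit_unique[OF assms(1) y(1) ekw y(2)] step y(4)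
        pz by auto
      moreover have "length z \<le> d" using dmax zv by auto
      ultimately have "z = u @ [k]" using y(3) lu by auto
      then show ?case using zs z by auto
    qed
    then obtain zs where zs: "v # ys = map (\<lambda>m. u @ [m]) [0..<r] @ zs" using assms(1)
      by (meson le_refl one_le_numeral order_trans)
    have "chain r (pt r u 0) (v # ys) 1" using c v \<open>m = 0\<close> by (simp add: pt_append)
    then obtain e where e: "chain r (pt r u 0) (map (\<lambda>m. u @ [m]) [0..<r]) e" "chain r e zs 1"
      unfolding zs chain_append by blast
    have "e = pt r u 1" using caret_chain[OF assms(1), of r u] e(1) chain_unique assms(1)
      by fastforce
    then have "chain r 0 (xs @ u # zs) 1" using e c v \<open>m = 0\<close> by (auto simp: chain_append pt_append)
    moreover have "length (xs @ u # zs) < length vs"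
      using arg_cong[OF zs, of length] vs assms(1) by simp
    moreover have "set (xs @ u # zs) \<subseteq> wds r"
    proof -
      have "set zs \<subseteq> set (v # ys)" unfolding zs by auto
      also have "\<dots> \<subseteq> wds r" using "1.prems"(2) unfolding vs by auto
      finally show ?thesis using "1.prems"(2) uw(1) unfolding vs by auto
    qed
    ultimately obtain C where "tree r (xs @ u # zs) C" using 1 by blast
    then show ?thesis using tree.caret vs zs by metis
  qed
qed

lemma maps_chain:
  assumes "chain r a ws b" "list_all2 (maps r f) ws vs" shows "chain r (f a) vs (f b)"
  using assms(2,1)
proof (induction arbitrary: a rule: list_all2_induct)
  case (Cons w ws v vs)
  have "f (pt r w 0) = pt r v 0" "f (pt r w 1) = pt r v 1" using Cons.hyps mapsD by auto
  then show ?case using Cons.prems Cons.IH[of "pt r w 1"] by auto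
qed auto

section \<open>The group $F(r)$ in terms of tree pairs\<close>

lemma maps_affine:
  assumes "r \<ge> 2" "maps r f w v" "t \<in> {pt r w 0..pt r w 1}"
  shows "f t = real r powi (int (length w) - int (length v)) * (t - pt r w 0) + pt r v 0"
proof -
  define s where "s = (t - pt r w 0) * real r ^ length w"
  have r: "real r \<noteq> 0" using assms(1) by simp
  have t: "t = pt r w s" unfolding pt_affine[of r w s] using r by (simp add: s_def)
  have "s \<in> {0..1}"
  proof -
    have "(t - pt r w 0) * real r ^ length w \<le> (pt r w 1 - pt r w 0) * real r ^ length w"
      using assms by (intro mult_right_mono) auto
    also have "\<dots> = 1" using r by (simp add: pt_diff)
    finally show ?thesis using assms by (simp add: s_def)
  qed
  then have "f t = pt r v s" using assms(2) t by (simp add: maps_def)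
  also have "\<dots> = s / real r ^ length v + pt r v 0" using pt_affine[of r v s] by simp
  also have "s / real r ^ length v = real r powi (int (length w) - int (length v)) * (t - pt r w 0)"
    using r by (simp add: s_def power_int_diff field_simps)
  finally show ?thesis .
qed

text \<open>The breakpoint clause of \<open>PLF\<close> with free end points, so that it can be
  built up along a chain.\<close>

definition pieces :: "nat \<Rightarrow> (real \<Rightarrow> real) \<Rightarrow> real \<Rightarrow> real \<Rightarrow> bool" where
  "pieces r f a e \<longleftrightarrow> (\<exists>b :: nat \<Rightarrow> real. \<exists>n::nat. b 0 = a \<and> b n = e
     \<and> (\<forall>i<n. b i < b (Suc i) \<and> b i \<in> Zinv r)
     \<and> (\<forall>i<n. \<exists>k::int. \<exists>c::real. \<forall>t\<in>{b i..b (Suc i)}. f t = real r powi k * t + c))"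

lemma pieces_Cons:
  assumes "pieces r f d e" "a < d" "a \<in> Zinv r" "\<And>t. t \<in> {a..d} \<Longrightarrow> f t = real r powi k * t + c"
  shows "pieces r f a e"
proof -
  obtain b n where b: "b 0 = d" "b n = e" "\<forall>i<n. b i < b (Suc i) \<and> b i \<in> Zinv r"
    "\<forall>i<n. \<exists>k::int. \<exists>c::real. \<forall>t\<in>{b i..b (Suc i)}. f t = real r powi k * t + c"
    using assms(1) by (auto simp: pieces_def)
  define b' where "b' = case_nat a b"
  have b': "b' 0 = a" "\<And>i. b' (Suc i) = b i" by (auto simp: b'_def)
  show ?thesis unfolding pieces_def
  proof (intro exI[of _ b'] exI[of _ "Suc n"] conjI allI impI)
    fix i assume i: "i < Suc n"
    show "b' i < b' (Suc i)" using i b assms(2) by (cases i) (auto simp: b')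
    show "b' i \<in> Zinv r" using i b assms(3) by (cases i) (auto simp: b')
    show "\<exists>k::int. \<exists>c::real. \<forall>t\<in>{b' i..b' (Suc i)}. f t = real r powi k * t + c"
      using i b assms(4) by (cases i) (auto simp: b')
  qed (use b b' in auto)
qed

lemma pt_Zinv: "r \<ge> 2 \<Longrightarrow> w \<in> wds r \<Longrightarrow> pt r w 0 \<in> Zinv r"
  using pt_nat[of r w] unfolding Zinv_def by (metis (mono_tags) mem_Collect_eq of_int_of_nat_eq)

lemma strict_mono_on_join:
  fixes f :: "real \<Rightarrow> real"
  assumes "strict_mono_on {a..d} f" "strict_mono_on {d..e} f" "a \<le> d" "d \<le> e"
  shows "strict_mono_on {a..e} f"
proof (rule strict_mono_onI)
  fix s t assume st: "s \<in> {a..e}" "t \<in> {a..e}" "s < t"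
  consider "t \<le> d" | "s \<ge> d" | "s < d" "d < t" by linarith
  then show "f s < f t"
  proof cases
    case 3
    then have "f s < f d" "f d < f t"
      using strict_mono_onD[OF assms(1), of s d] strict_mono_onD[OF assms(2), of d t] st assms(3,4)
        by auto
    then show ?thesis by simp
  qed (use strict_mono_onD[OF assms(1), of s t] strict_mono_onD[OF assms(2), of s t] st in auto)
qed

lemma maps_chain_homeo:
  assumes "r \<ge> 2" "list_all2 (maps r f) ws vs" "set ws \<subseteq> wds r" "chain r a ws e"
  shows "a \<le> e \<and> strict_mono_on {a..e} f \<and> continuous_on {a..e} f \<and> pieces r f a e"
  using assms(2-4)
proof (induction arbitrary: a rule: list_all2_induct)
  case Nil
  then show ?case by (auto simp: strict_mono_on_def pieces_def intro: exI[of _ "\<lambda>_. e"])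
next
  case (Cons w ws v vs)
  define d where "d = pt r w 1"
  have a: "pt r w 0 = a" using Cons.prems by simp
  have ad: "a < d" using pt_strict_mono[OF assms(1), of 0 1 w] a d_def by simp
  have IH: "d \<le> e" "strict_mono_on {d..e} f" "continuous_on {d..e} f" "pieces r f d e"
    using Cons.IH[of d] Cons.prems by (auto simp: d_def)
  define K where "K = int (length w) - int (length v)"
  define c where "c = pt r v 0 - real r powi K * a"
  have aff: "f t = real r powi K * t + c" if "t \<in> {a..d}" for t
    using maps_affine[OF assms(1) Cons.hyps(1), of t] that a d_def
    by (simp add: K_def c_def algebra_simps)
  have Kpos: "real r powi K > 0" using assms(1) by simp
  have m: "strict_mono_on {a..d} f"
    by (rule strict_mono_onI) (use aff Kpos in auto)
  have "continuous_on {a..d} (\<lambda>t. real r powi K * t + c)" by (intro continuous_intros)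
  then have co: "continuous_on {a..d} f" using aff by (metis (no_types, lifting) continuous_on_cong)
  have un: "{a..e} = {a..d} \<union> {d..e}" using ad IH(1) by auto
  have "continuous_on {a..e} f" unfolding un
    using co IH(3) by (intro continuous_on_closed_Un) auto
  moreover have "pieces r f a e"
    using pieces_Cons[OF IH(4) ad _ aff] pt_Zinv[OF assms(1), of w] a Cons.prems by auto
  ultimately show ?case using strict_mono_on_join[OF m IH(2)] ad IH(1) by auto
qed

text \<open>The pieces are affine with positive slope on closed intervals that share end points, so
  \<open>f\<close> is increasing and continuous; the fixed end points and the intermediate value
  theorem give surjectivity.\<close>

lemma PLF_I:
  assumes "r \<ge> 2" "\<And>t. t \<notin> {0..1} \<Longrightarrow> f t = t" "f 0 = 0" "f 1 = 1"
    "tree r ws C" "\<And>w. w \<in> set ws \<Longrightarrow> \<exists>v. maps r f w v"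
  shows "f \<in> PLF r"
proof -
  obtain g where g: "\<And>w. w \<in> set ws \<Longrightarrow> maps r f w (g w)" using assms(6) by metis
  have la: "list_all2 (maps r f) ws (map g ws)" using g by (simp add: list_all2_conv_all_nth)
  have h: "strict_mono_on {0..1} f" "continuous_on {0..1} f" "pieces r f 0 1"
    using maps_chain_homeo[OF assms(1) la _ tree_chain[OF assms(1,5)]] tree_wds[OF assms(5)] by auto
  have "f ` {0..1} = {0..1}"
  proof (intro equalityI subsetI)
    fix y assume "y \<in> f ` {0..1}"
    then obtain t where "t \<in> {0..1}" "y = f t" by auto
    then show "y \<in> {0..1}" using strict_mono_on_leD[OF h(1), of 0 t] strict_mono_on_leD[OF h(1), of
      t 1] assms(3,4) by auto
  next
    fix y :: real assume "y \<in> {0..1}"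
    then show "y \<in> f ` {0..1}" using IVT'[of f 0 y 1] h(2) assms(3,4) by auto
  qed
  then show ?thesis using h assms(2) by (simp add: PLF_def pieces_def)
qed

text \<open>Phrased as an eventuality so that the denominators of finitely many points can be
  cleared by one common power.\<close>

lemma Zinv_eventually:
  assumes "r \<ge> 2" "x \<in> Zinv r" shows "\<forall>\<^sub>F n in sequentially. x * real r ^ n \<in> \<int>"
proof -
  obtain a m where x: "x = of_int a / real r ^ m" using assms(2) by (auto simp: Zinv_def)
  have "x * real r ^ n \<in> \<int>" if "n \<ge> m" for n
  proof -
    have "x * real r ^ n = of_int a * real r ^ (n - m)"
      using assms(1) that by (simp add: x power_diff)
    then show ?thesis by simp
  qed
  then show ?thesis by (rule eventually_sequentiallyI)
qed

lemma Zinv_I: "r \<ge> 2 \<Longrightarrow> x * real r ^ n \<in> \<int> \<Longrightarrow> x \<in> Zinv r"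
  unfolding Zinv_def Ints_def by (auto simp: field_simps)

lemma Zinv_add:
  assumes "r \<ge> 2" "x \<in> Zinv r" "y \<in> Zinv r" shows "x + y \<in> Zinv r"
proof -
  have "\<forall>\<^sub>F n in sequentially. (x + y) * real r ^ n \<in> \<int>"
    using Zinv_eventually[OF assms(1,2)] Zinv_eventually[OF assms(1,3)]
    by eventually_elim (auto simp: distrib_right)
  then show ?thesis using Zinv_I[OF assms(1)] eventually_sequentially by (metis order_refl)
qed

lemma Zinv_uminus: "x \<in> Zinv r \<Longrightarrow> - x \<in> Zinv r"
  unfolding Zinv_def by clarsimp (metis minus_divide_left of_int_minus)

lemma Zinv_scale:
  assumes "r \<ge> 2" "x \<in> Zinv r" shows "real r powi k * x \<in> Zinv r"
proof -
  obtain a m where x: "x = of_int a / real r ^ m" using assms(2) by (auto simp: Zinv_def)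
  have r: "real r \<noteq> 0" using assms(1) by simp
  show ?thesis
  proof (cases "k \<ge> 0")
    case True
    then have "real r powi k * x = of_int (a * int r ^ nat k) / real r ^ m"
      by (simp add: x power_int_def)
    then show ?thesis unfolding Zinv_def by blast
  next
    case False
    then have "real r powi k * x = of_int a / real r ^ (nat (-k) + m)"
      using r by (simp add: x power_int_def power_add field_simps)
    then show ?thesis unfolding Zinv_def by blast
  qed
qed

lemma partition_locate:
  fixes b :: "nat \<Rightarrow> real"
  assumes "b 0 \<le> x" "x < b n" shows "\<exists>i<n. b i \<le> x \<and> x < b (Suc i)"
  using assms(2)
proof (induction n)
  case (Suc n)
  then show ?case by (cases "x < b n") (auto simp: less_Suc_eq)
qed (use assms in auto)

text \<open>The substantial part is finiteness of \<open>bad r f\<close>: at a sufficient depth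
  \<open>L\<close> every standard interval lies in one affine piece, and its image runs between
  consecutive multiples of a power of 1/r. So only words shorter than \<open>L\<close> can be
  bad.\<close>

lemma PLF_D:
  assumes "r \<ge> 2" "f \<in> PLF r"
  shows "\<And>t. t \<notin> {0..1} \<Longrightarrow> f t = t" "f ` {0..1} = {0..1}" "continuous_on {0..1} f"
    "strict_mono_on {0..1} f" "f 0 = 0" "f 1 = 1" "finite (bad r f)" "inj_on f {0..1}"
proof -
  show out: "\<And>t. t \<notin> {0..1} \<Longrightarrow> f t = t" and im: "f ` {0..1} = {0..1}" and co:
    "continuous_on {0..1} f"
    and mo: "strict_mono_on {0..1} f" using assms(2) by (auto simp: PLF_def)
  show inj: "inj_on f {0..1}" using mo by (rule strict_mono_on_imp_inj_on)
  have mono: "f s \<le> f t" if "0 \<le> s" "s \<le> t" "t \<le> 1" for s t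
    using strict_mono_on_leD[OF mo, of s t] that by auto
  have bd: "0 \<le> f t \<and> f t \<le> 1" if "t \<in> {0..1}" for t using im that
    by (metis atLeastAtMost_iff imageI)
  show f0: "f 0 = 0"
  proof -
    have "0 \<in> f ` {0..1}" using im by simp
    then obtain x where "x \<in> {0..1}" "f x = 0" by auto
    then show ?thesis using mono[of 0 x] bd[of 0] by auto
  qed
  show f1: "f 1 = 1"
  proof -
    have "1 \<in> f ` {0..1}" using im by simp
    then obtain x where "x \<in> {0..1}" "f x = 1" by auto
    then show ?thesis using mono[of x 1] bd[of 1] by auto
  qed
  obtain b n where b: "b 0 = 0" "b n = 1" and bi: "\<And>i. i < n \<Longrightarrow> b i < b (Suc i) \<and> b i \<in> Zinv r"
    and "\<forall>i<n. \<exists>k::int. \<exists>c::real. \<forall>t\<in>{b i..b (Suc i)}. f t = real r powi k * t + c"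
    using assms(2) by (auto simp: PLF_def)
  then obtain k c where kc: "\<And>i t. i < n \<Longrightarrow> t \<in> {b i..b (Suc i)} \<Longrightarrow> f t = real r powi k i * t + c i"
    by metis
  have oneZ: "1 \<in> Zinv r" using Zinv_I[OF assms(1), of 1 0] by simp
  have bZ: "b i \<in> Zinv r" if "i \<le> n" for i using bi b(2) that oneZ by (cases "i = n") auto
  \<comment> \<open>Starting from \<open>f 0 = 0\<close>, values at breakpoints stay in Z[1/r] from
    piece to piece. This also forces the intercepts into Z[1/r], although the definition admits any
    real \<open>c\<close>.\<close>
  have step: "f (b i) \<in> Zinv r \<Longrightarrow> c i \<in> Zinv r \<and> f (b (Suc i)) \<in> Zinv r" if "i < n" for i
  proof -
    assume fi: "f (b i) \<in> Zinv r"
    have e: "f (b i) = real r powi k i * b i + c i"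
      "f (b (Suc i)) = real r powi k i * b (Suc i) + c i"
      using kc[OF that] bi[OF that] by auto
    then have "c i = f (b i) + - (real r powi k i * b i)" by simp
    then have ci: "c i \<in> Zinv r"
      using Zinv_add[OF assms(1) fi] Zinv_uminus Zinv_scale[OF assms(1) bZ[of i]] that by force
    then show ?thesis using e(2) Zinv_add[OF assms(1)] Zinv_scale[OF assms(1) bZ[of "Suc i"]] that
      by auto
  qed
  have fb: "f (b i) \<in> Zinv r" if "i \<le> n" for i using that
  proof (induction i)
    case 0
    show ?case using b f0 Zinv_I[OF assms(1), of 0 0] by simp
  qed (use step in auto)
  then have cZ: "c i \<in> Zinv r" if "i < n" for i using step[OF that] that by auto
  have ev1: "\<forall>\<^sub>F L in sequentially. \<forall>i\<in>{..n}. b i * real r ^ L \<in> \<int>"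
    using Zinv_eventually[OF assms(1)] bZ by (intro eventually_ball_finite) auto
  \<comment> \<open>An interval of depth \<open>L\<close> in piece \<open>i\<close> has an image of
    depth \<open>L - k i\<close>, so the intercept must have its denominator cleared at that depth.
    The condition \<open>int L \<ge> k i\<close> keeps the conversion by \<open>nat\<close>
    faithful.\<close>
  have ev2: "\<forall>\<^sub>F L in sequentially. \<forall>i\<in>{..<n}. int L \<ge> k i \<and> c i * real r ^ nat (int L - k i) \<in> \<int>"
  proof (intro eventually_ball_finite ballI)
    fix i assume "i \<in> {..<n}"
    then obtain N where N: "\<And>m. m \<ge> N \<Longrightarrow> c i * real r ^ m \<in> \<int>"
      using Zinv_eventually[OF assms(1) cZ[of i]] by (auto simp: eventually_sequentially)
    show "\<forall>\<^sub>F L in sequentially. int L \<ge> k i \<and> c i * real r ^ nat (int L - k i) \<in> \<int>"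
      by (rule eventually_sequentiallyI[of "nat (k i + int N)"]) (auto intro!: N)
  qed auto
  obtain L where L1: "\<And>i. i \<le> n \<Longrightarrow> b i * real r ^ L \<in> \<int>"
    and L2: "\<And>i. i < n \<Longrightarrow> int L \<ge> k i \<and> c i * real r ^ nat (int L - k i) \<in> \<int>"
    using eventually_happens[OF eventually_conj[OF ev1 ev2]] by auto
  have good: "\<exists>v \<in> wds r. maps r f w v" if w: "w \<in> wds r" "length w = L" for w
  proof -
    have r: "real r > 0" using assms(1) by simp
    obtain a where a: "a < r ^ L" "pt r w 0 = real a / real r ^ L"
      using pt_nat[OF assms(1) w(1)] w(2) by auto
    have "b 0 \<le> pt r w 0" "pt r w 0 < b n"
      using b pt_bounds[OF assms(1) w(1), of 0] pt_less_1[OF assms(1) w(1), of 0] by auto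
    then obtain i where i: "i < n" "b i \<le> pt r w 0" "pt r w 0 < b (Suc i)" using partition_locate
      by blast
    \<comment> \<open>Scaled by \<open>r ^ L\<close>, the left end of \<open>w\<close> and the next
      breakpoint are both integers. A strict inequality between them leaves a full unit, so all of
      \<open>w\<close> stays within piece \<open>i\<close>.\<close>
    have "real a < b (Suc i) * real r ^ L" using i(3) a r by (simp add: divide_less_eq)
    moreover obtain z where z: "b (Suc i) * real r ^ L = of_int z" using L1[of "Suc i"] i
      by (auto elim: Ints_cases)
    ultimately have "real_of_int (int a) < of_int z" by simp
    then have "int a + 1 \<le> z" by (simp only: of_int_less_iff)
    then have "real a + 1 \<le> of_int z" by linarith
    moreover have pw: "pt r w t = (real a + t) / real r ^ L" for t
      using a(2) w(2) pt_affine[of r w t] by (simp add: add_divide_distrib)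
    then have "pt r w 1 * real r ^ L = real a + 1" using r by simp
    ultimately have "pt r w 1 * real r ^ L \<le> b (Suc i) * real r ^ L" using z by simp
    then have top: "pt r w 1 \<le> b (Suc i)" using r by simp
    define M where "M = nat (int L - k i)"
    have kM: "real r powi k i / real r ^ L = 1 / real r ^ M"
    proof -
      have "k i = int L - int M" using L2[OF i(1)] by (simp add: M_def)
      then show ?thesis using r by (simp add: power_int_diff)
    qed
    obtain A where A: "real a + c i * real r ^ M = of_int A"
      using L2[OF i(1)] by (metis M_def Ints_add Ints_of_nat Ints_cases)
    have fp: "f (pt r w t) = of_int A / real r ^ M + t / real r ^ M" if t: "t \<in> {0..1}" for t
    proof -
      have "pt r w t \<in> {b i..b (Suc i)}"
        using i(2) top pt_mono[OF assms(1), of 0 t w] pt_mono[OF assms(1), of t 1 w] t by auto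
      then have "f (pt r w t) = real r powi k i * pt r w t + c i" using kc i by auto
      also have "\<dots> = (real a + t) * (real r powi k i / real r ^ L) + c i"
        by (simp add: pw)
      also have "\<dots> = (real a + t) / real r ^ M + c i" by (simp add: kM)
      also have "\<dots> = (real a + c i * real r ^ M + t) / real r ^ M" using r
        by (simp add: field_simps)
      also have "\<dots> = of_int A / real r ^ M + t / real r ^ M" by (simp add: A add_divide_distrib)
      finally show ?thesis .
    qed
    have "0 \<le> of_int A / real r ^ M" using fp[of 0] bd[OF pt_in[OF assms(1) w(1), of 0]] by simp
    moreover have "real r ^ M > 0" using r by simp
    ultimately have A0: "A \<ge> 0" by (auto simp: zero_le_divide_iff)
    have "(of_int A + 1) / real r ^ M \<le> 1" using fp[of 1] bd[OF pt_in[OF assms(1) w(1), of 1]]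
      by (simp add: add_divide_distrib)
    then have "of_int A + 1 \<le> real r ^ M" using r by (simp add: divide_le_eq)
    then have "real (nat A) < real (r ^ M)" using A0 by simp
    then have "nat A < r ^ M" by (simp only: of_nat_less_iff)
    then obtain v where v: "v \<in> wds r" "length v = M" "pt r v 0 = real (nat A) / real r ^ M"
      using pt_surj[OF assms(1)] by blast
    have "maps r f w v" unfolding maps_def
    proof
      fix t :: real assume "t \<in> {0..1}"
      then show "f (pt r w t) = pt r v t" using fp v A0 pt_affine[of r v t] by simp
    qed
    then show ?thesis using v by blast
  qed
  have "bad r f \<subseteq> {w. set w \<subseteq> {..<r} \<and> length w \<le> L}"
  proof
    fix w assume w: "w \<in> bad r f"
    then have ww: "w \<in> wds r" by (simp add: bad_def)
    have "length w < L"
    proof (rule ccontr)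
      assume "\<not> length w < L"
      then have "length (take L w) = L" by simp
      moreover have "take L w \<in> wds r" "drop L w \<in> wds r" using ww
        by (auto simp: lists_eq_set dest: in_set_takeD in_set_dropD)
      ultimately obtain v where "v \<in> wds r" "maps r f (take L w) v" using good by blast
      then have "v @ drop L w \<in> wds r" "maps r f w (v @ drop L w)"
        using maps_append[OF assms(1) \<open>drop L w \<in> wds r\<close>, of f "take L w" v] \<open>drop L w \<in> wds r\<close>
          by auto
      then show False using w by (auto simp: bad_def)
    qed
    then show "w \<in> {w. set w \<subseteq> {..<r} \<and> length w \<le> L}" using ww by (auto simp: lists_eq_set)
  qed
  then show "finite (bad r f)" using finite_lists_length_le[of "{..<r}" L] finite_subset by blast
qed

text \<open>Finiteness of the bad set stands for all analytic clauses: a tree grown until no leaf is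
  bad provides the affine pieces.\<close>

lemma PLF_iff:
  assumes "r \<ge> 2"
  shows "f \<in> PLF r \<longleftrightarrow> (\<forall>t. t \<notin> {0..1} \<longrightarrow> f t = t) \<and> f 0 = 0 \<and> f 1 = 1 \<and> finite (bad r f)"
proof
  assume R: "(\<forall>t. t \<notin> {0..1} \<longrightarrow> f t = t) \<and> f 0 = 0 \<and> f 1 = 1 \<and> finite (bad r f)"
  then obtain ws C where t: "tree r ws C" "set ws \<inter> bad r f = {}" using tree_exists by metis
  have "\<exists>v. maps r f w v" if "w \<in> set ws" for w
  proof -
    have "w \<in> wds r" "w \<notin> bad r f" using that t(2) tree_wds[OF t(1)] by blast+
    then show ?thesis by (auto simp: bad_def)
  qed
  then show "f \<in> PLF r" using PLF_I[OF assms _ _ _ t(1)] R by blast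
qed (use PLF_D[OF assms] in blast)

text \<open>The interior nodes of the domain tree are all bad, which bounds its carets. The images
  of its leaves form a chain from 0 to 1, hence a tree, and equal numbers of leaves give equal
  numbers of carets.\<close>

lemma PLF_tree_pair:
  assumes "r \<ge> 2" "f \<in> PLF r"
  shows "\<exists>ws C vs D. tree r ws C \<and> tree r vs D \<and> card C \<le> card (bad r f) \<and> card D = card C
    \<and> list_all2 (maps r f) ws vs"
proof -
  note f = PLF_D[OF assms]
  obtain ws C where t: "tree r ws C" "C \<subseteq> bad r f" "set ws \<inter> bad r f = {}" using tree_exists f(7)
    by metis
  have "\<exists>v. v \<in> wds r \<and> maps r f w v" if "w \<in> set ws" for w
  proof -
    have "w \<in> wds r" "w \<notin> bad r f" using that t(3) tree_wds[OF t(1)] by blast+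
    then show ?thesis by (auto simp: bad_def)
  qed
  then obtain g where g: "\<And>w. w \<in> set ws \<Longrightarrow> g w \<in> wds r \<and> maps r f w (g w)" by metis
  have la: "list_all2 (maps r f) ws (map g ws)" using g by (simp add: list_all2_conv_all_nth)
  have "chain r 0 (map g ws) 1" using maps_chain[OF tree_chain[OF assms(1) t(1)] la] f by simp
  moreover have "set (map g ws) \<subseteq> wds r" using g by auto
  ultimately obtain D where D: "tree r (map g ws) D" using chain_imp_tree[OF assms(1)] by blast
  have "(r - 1) * card D = (r - 1) * card C" 
    using tree_length[OF assms(1) D] tree_length[OF assms(1) t(1)] by auto
  then have "card D = card C" using assms(1) by simp
  then show ?thesis using t D la card_mono[OF f(7) t(2)] by blast
qed

section \<open>Group structure\<close>

lemma PLF_comp: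
  assumes "r \<ge> 2" "f \<in> PLF r" "g \<in> PLF r" shows "f \<circ> g \<in> PLF r"
  using PLF_D[OF assms(1,2)] PLF_D[OF assms(1,3)] bad_comp[OF assms(1), of g f]
  by (auto simp: PLF_iff[OF assms(1)])

lemma PLF_id:
  assumes "r \<ge> 2" shows "id \<in> PLF r"
proof -
  have "bad r id = {}" unfolding bad_def using maps_id by blast
  then show ?thesis using PLF_iff[OF assms] by simp
qed

lemma PLF_bij:
  assumes "r \<ge> 2" "f \<in> PLF r" shows "bij f"
proof -
  note f = PLF_D[OF assms]
  have "bij_betw f {0..1} {0..1}" using f by (simp add: bij_betw_def)
  moreover have "bij_betw f (- {0..1}) (- {0..1})"
    using f(1) by (simp add: bij_betw_def inj_on_def image_def)
  ultimately have "bij_betw f ({0..1} \<union> - {0..1}) ({0..1} \<union> - {0..1})"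
    by (rule bij_betw_combine) auto
  then show ?thesis by simp
qed

lemma PLF_inverse:
  assumes "r \<ge> 2" "f \<in> PLF r" shows "the_inv f \<in> PLF r"
proof -
  note f = PLF_D[OF assms] and bij = PLF_bij[OF assms]
  have inv: "the_inv f (f t) = t" for t using bij by (simp add: the_inv_f_f bij_is_inj)
  obtain ws C vs D where t: "tree r ws C" "tree r vs D" "list_all2 (maps r f) ws vs"
    using PLF_tree_pair[OF assms] by blast
  have "\<exists>w. maps r (the_inv f) v w" if v: "v \<in> set vs" for v
  proof -
    obtain i where "i < length vs" "v = vs ! i" using v by (metis in_set_conv_nth)
    then have "maps r f (ws ! i) v" using t(3) by (auto simp: list_all2_conv_all_nth)
    then have "maps r (the_inv f) v (ws ! i)" unfolding maps_def
    proof (intro ballI)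
      fix t :: real assume "\<forall>t\<in>{0..1}. f (pt r (ws ! i) t) = pt r v t" "t \<in> {0..1}"
      then have "pt r v t = f (pt r (ws ! i) t)" by simp
      then show "the_inv f (pt r v t) = pt r (ws ! i) t" by (simp only: inv)
    qed
    then show ?thesis by blast
  qed
  moreover have "the_inv f t = t" if "t \<notin> {0..1}" for t using inv[of t] f(1)[OF that] by simp
  moreover have "the_inv f 0 = 0" "the_inv f 1 = 1" using inv[of 0] inv[of 1] f(5,6) by auto
  ultimately show ?thesis using PLF_I[OF assms(1) _ _ _ t(2), of "the_inv f"] by blast
qed

lemma group_Fgrp:
  assumes "r \<ge> 2" shows "group (Fgrp r)"
proof (rule groupI)
  fix f assume "f \<in> carrier (Fgrp r)"
  then have f: "f \<in> PLF r" by (simp add: Fgrp_def)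
  have "the_inv f \<circ> f = id" using PLF_bij[OF assms f] by (auto simp: the_inv_f_f bij_is_inj)
  then show "\<exists>g\<in>carrier (Fgrp r). g \<otimes>\<^bsub>Fgrp r\<^esub> f = \<one>\<^bsub>Fgrp r\<^esub>"
    using PLF_inverse[OF assms f] by (auto simp: Fgrp_def)
qed (use PLF_comp[OF assms] PLF_id[OF assms] in \<open>auto simp: Fgrp_def comp_assoc\<close>)

lemma PLF_eqI:
  assumes "r \<ge> 2" "f \<in> PLF r" "g \<in> PLF r" "tree r ws C"
    "\<And>w. w \<in> set ws \<Longrightarrow> \<exists>v. maps r f w v \<and> maps r g w v"
  shows "f = g"
proof
  fix t
  show "f t = g t"
  proof (cases "t \<in> {0..1}")
    case True
    then obtain w s where w: "w \<in> set ws" "s \<in> {0..1}" "t = pt r w s"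
      using tree_covers_points[OF assms(1,4)] by blast
    then show ?thesis using assms(5)[of w] by (auto simp: maps_def)
  next
    case False
    then show ?thesis using PLF_D(1)[OF assms(1,2)] PLF_D(1)[OF assms(1,3)] by simp
  qed
qed

section \<open>Generators\<close>

lemma ygen_outside: "t \<notin> {0..1} \<Longrightarrow> ygen r j t = t"
  by (auto simp: ygen_def)

context
  fixes r j :: nat and R J :: real
  assumes r: "r \<ge> 2" and j: "j < r - 1" and R_def: "R = real r" and J_def: "J = real j"
begin

lemma ygen_facts: "R \<ge> 2" "J \<ge> 0" "J + 1 \<le> R - 1" "J / R \<le> (R - 1) / R"
    "(R - 1) / R + (J + 1) / R\<^sup>2 \<le> 1" "0 \<le> J / R" "(R - 1) / R \<le> 1" "0 \<le> (J + 1) / R\<^sup>2"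
proof -
  show R: "R \<ge> 2" "J \<ge> 0" "J + 1 \<le> R - 1" using r j by (auto simp: R_def J_def)
  then show "J / R \<le> (R - 1) / R" "0 \<le> J / R" "(R - 1) / R \<le> 1" "0 \<le> (J + 1) / R\<^sup>2"
    by (auto simp: divide_right_mono)
  have "(J + 1) / R\<^sup>2 \<le> R / R\<^sup>2" using R by (intro divide_right_mono) auto
  also have "\<dots> = 1 / R" using R by (simp add: power2_eq_square)
  finally show "(R - 1) / R + (J + 1) / R\<^sup>2 \<le> 1" using R by (simp add: diff_divide_distrib)
qed

text \<open>The definition decides each breakpoint in favour of the piece on its left. Here every
  formula is verified on its closed piece, since \<open>maps\<close> speaks about closed
  intervals.\<close>

lemma ygen_pieces:
  "0 \<le> t \<Longrightarrow> t \<le> J / R \<Longrightarrow> ygen r j t = t"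
  "J / R \<le> t \<Longrightarrow> t \<le> (R - 1) / R \<Longrightarrow> ygen r j t = J / R + (t - J / R) / R"
  "(R - 1) / R \<le> t \<Longrightarrow> t \<le> (R - 1) / R + (J + 1) / R\<^sup>2 \<Longrightarrow>
     ygen r j t = J / R + (R - 1 - J) / R\<^sup>2 + (t - (R - 1) / R)"
  "(R - 1) / R + (J + 1) / R\<^sup>2 \<le> t \<Longrightarrow> t \<le> 1 \<Longrightarrow>
     ygen r j t = (J + 1) / R + R * (t - ((R - 1) / R + (J + 1) / R\<^sup>2))"
proof -
  note f = ygen_facts
  note d = ygen_def[of r j t] Let_def R_def[symmetric] J_def[symmetric]
  show "ygen r j t = t" if "0 \<le> t" "t \<le> J / R" using that f by (simp add: d)
  show "ygen r j t = J / R + (t - J / R) / R" if t: "J / R \<le> t" "t \<le> (R - 1) / R"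
  proof -
    have n: "\<not> (t < 0 \<or> t > 1)" using t f by linarith
    show ?thesis
    proof (cases "t = J / R")
      case True
      then have "t \<le> J / R" by simp
      then have "ygen r j t = t" using n by (simp only: d if_False if_True)
      then show ?thesis using True by simp
    next
      case False
      then have "\<not> t \<le> J / R" using t by linarith
      then show ?thesis using n t(2) by (simp only: d if_False if_True)
    qed
  qed
  have e2: "((R - 1) / R - J / R) / R = (R - 1 - J) / R\<^sup>2"
    using f(1) by (simp add: field_simps power2_eq_square)
  have e0: "J / R < (R - 1) / R" using f(1-3) by (intro divide_strict_right_mono) auto
  show "ygen r j t = J / R + (R - 1 - J) / R\<^sup>2 + (t - (R - 1) / R)"
    if t: "(R - 1) / R \<le> t" "t \<le> (R - 1) / R + (J + 1) / R\<^sup>2"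
  proof (cases "t = (R - 1) / R")
    case True
    then have n: "t \<le> (R - 1) / R" "\<not> t \<le> J / R" "\<not> (t < 0 \<or> t > 1)" using f e0 by linarith+
    have "ygen r j t = J / R + (t - J / R) / R" using n by (simp only: d if_False if_True)
    then show ?thesis using True e2 by simp
  next
    case False
    then have "\<not> t \<le> (R - 1) / R" "\<not> t \<le> J / R" "\<not> (t < 0 \<or> t > 1)" using t f by linarith+
    then show ?thesis using t by (simp only: d if_False if_True)
  qed
  show "ygen r j t = (J + 1) / R + R * (t - ((R - 1) / R + (J + 1) / R\<^sup>2))"
    if t: "(R - 1) / R + (J + 1) / R\<^sup>2 \<le> t" "t \<le> 1"
  proof -
    have "0 < (J + 1) / R\<^sup>2" using f(1-3) by simp
    then have n: "\<not> t \<le> (R - 1) / R" "\<not> t \<le> J / R" "\<not> (t < 0 \<or> t > 1)" using t f by linarith+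
    show ?thesis
    proof (cases "t = (R - 1) / R + (J + 1) / R\<^sup>2")
      case True
      have "ygen r j t = J / R + (R - 1 - J) / R\<^sup>2 + (t - (R - 1) / R)"
        using n eq_refl[OF True] by (simp only: d if_False if_True)
      also have "\<dots> = J / R + ((R - 1 - J) + (J + 1)) / R\<^sup>2" by (simp only: True add_divide_distrib)
      also have "\<dots> = (J + 1) / R" using f(1) by (simp add: power2_eq_square add_divide_distrib)
      finally show ?thesis using True by simp
    next
      case False
      then have "\<not> t \<le> (R - 1) / R + (J + 1) / R\<^sup>2" using t by linarith
      then show ?thesis using n by (simp only: d if_False if_True)
    qed
  qed
qed

text \<open>The children of leaf \<open>j\<close> have two sources: those with index below
  \<open>r - 1 - j\<close> come from the root caret, the others from the caret at the last
  leaf.\<close>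

lemma ygen_maps:
  "l < j \<Longrightarrow> maps r (ygen r j) [l] [l]"
  "j + m < r - 1 \<Longrightarrow> maps r (ygen r j) [j + m] [j, m]"
  "k \<le> j \<Longrightarrow> maps r (ygen r j) [r - 1, k] [j, r - 1 - j + k]"
  "j < k \<Longrightarrow> k < r \<Longrightarrow> maps r (ygen r j) [r - 1, k] [k]"
proof -
  note f = ygen_facts
  have r1: "real (r - 1) = R - 1" using r by (simp add: R_def of_nat_diff)
  have R0: "R > 0" "R \<noteq> 0" using f(1) by auto
  show "maps r (ygen r j) [l] [l]" if "l < j"
    unfolding maps_def
  proof
    fix t :: real assume t: "t \<in> {0..1}"
    have "real l + 1 \<le> J" using that by (simp add: J_def)
    then have "(real l + t) / R \<le> J / R" "0 \<le> (real l + t) / R" using t R0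
      by (auto simp: divide_right_mono)
    then show "ygen r j (pt r [l] t) = pt r [l] t" using ygen_pieces(1) by (simp add: R_def)
  qed
  show "maps r (ygen r j) [j + m] [j, m]" if "j + m < r - 1"
    unfolding maps_def
  proof
    fix t :: real assume t: "t \<in> {0..1}"
    define x where "x = (J + real m + t) / R"
    have "J + real m + 1 \<le> R - 1" using that r1 by (simp add: J_def)
    then have "J / R \<le> x" "x \<le> (R - 1) / R" unfolding x_def using t R0
      by (auto intro!: divide_right_mono)
    then have "ygen r j x = J / R + (x - J / R) / R" by (rule ygen_pieces)
    also have "\<dots> = (J + (real m + t) / R) / R" using R0 by (simp add: x_def field_simps)
    finally show "ygen r j (pt r [j + m] t) = pt r [j, m] t" by (simp add: x_def R_def J_def)
  qed
  show "maps r (ygen r j) [r - 1, k] [j, r - 1 - j + k]" if "k \<le> j"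
    unfolding maps_def
  proof
    fix t :: real assume t: "t \<in> {0..1}"
    define x where "x = (R - 1 + (real k + t) / R) / R"
    have x: "x = (R - 1) / R + (real k + t) / R\<^sup>2"
      by (simp add: x_def add_divide_distrib power2_eq_square)
    have "real k + t \<le> J + 1" using that t by (simp add: J_def)
    then have "(R - 1) / R \<le> x" "x \<le> (R - 1) / R + (J + 1) / R\<^sup>2" unfolding x using t R0
      by (auto simp: divide_right_mono)
    then have "ygen r j x = J / R + (R - 1 - J) / R\<^sup>2 + (x - (R - 1) / R)" by (rule ygen_pieces)
    also have "\<dots> = (J + (R - 1 - J + real k + t) / R) / R" unfolding x using R0
      by (simp add: field_simps power2_eq_square)
    finally show "ygen r j (pt r [r - 1, k] t) = pt r [j, r - 1 - j + k] t"
      using r1 j by (simp add: x_def R_def[symmetric] J_def of_nat_diff)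
  qed
  show "maps r (ygen r j) [r - 1, k] [k]" if "j < k" "k < r"
    unfolding maps_def
  proof
    fix t :: real assume t: "t \<in> {0..1}"
    define x where "x = (R - 1 + (real k + t) / R) / R"
    have x: "x = (R - 1) / R + (real k + t) / R\<^sup>2"
      by (simp add: x_def add_divide_distrib power2_eq_square)
    have "J + 1 \<le> real k + t" using that t by (simp add: J_def)
    then have "(R - 1) / R + (J + 1) / R\<^sup>2 \<le> x" unfolding x using R0
      by (auto simp: divide_right_mono)
    moreover have "x \<le> 1" using pt_in[OF r, of "[r - 1, k]" t] t r1 that
      by (simp add: x_def R_def[symmetric])
    ultimately have "ygen r j x = (J + 1) / R + R * (x - ((R - 1) / R + (J + 1) / R\<^sup>2))"
      by (rule ygen_pieces)
    also have "\<dots> = (real k + t) / R" unfolding x using R0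
      by (simp add: field_simps power2_eq_square)
    finally show "ygen r j (pt r [r - 1, k] t) = pt r [k] t"
      using r1 by (simp add: x_def R_def[symmetric])
  qed
qed

end

text \<open>Conjugates \<open>f\<close> into the last standard interval; on generators this raises
  the index by \<open>r - 1\<close>.\<close>

definition lift :: "nat \<Rightarrow> (real \<Rightarrow> real) \<Rightarrow> real \<Rightarrow> real" where
  "lift r f t = (let R = real r in
     if t < 0 \<or> t > 1 then t
     else if t \<le> (R - 1) / R then t
     else (R - 1) / R + f (R * t - (R - 1)) / R)"

lemma maps_lift_last:
  assumes "r \<ge> 2" "maps r f w v" "w \<in> wds r" "f 0 = 0"
  shows "maps r (lift r f) ((r - 1) # w) ((r - 1) # v)"
  unfolding maps_def
proof
  fix t :: real assume t: "t \<in> {0..1}"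
  define R where "R = real r"
  define x where "x = pt r w t"
  have R: "R \<ge> 2" using assms by (simp add: R_def)
  have r1: "real (r - 1) = R - 1" using assms by (simp add: R_def of_nat_diff)
  have x: "0 \<le> x" "x \<le> 1" using pt_bounds[OF assms(1,3), of t] t by (auto simp: x_def)
  have fx: "f x = pt r v t" using assms(2) t by (auto simp: maps_def x_def)
  define y where "y = (R - 1 + x) / R"
  have y: "\<not> (y < 0 \<or> y > 1)" using R x by (simp add: y_def divide_le_eq not_less)
  have yR: "R * y - (R - 1) = x" using R by (simp add: y_def)
  have le: "y \<le> (R - 1) / R \<longleftrightarrow> x = 0" using R x by (auto simp: y_def divide_le_cancel)
  have "lift r f y = (R - 1 + f x) / R"
    using y yR le assms(4) by (auto simp: lift_def R_def[symmetric] Let_def add_divide_distrib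
      y_def)
  then show "lift r f (pt r ((r - 1) # w) t) = pt r ((r - 1) # v) t"
    using fx r1 by (simp add: y_def x_def R_def[symmetric])
qed

lemma maps_lift_other:
  assumes "r \<ge> 2" "w \<in> wds r" "a < r - 1"
  shows "maps r (lift r f) (a # w) (a # w)"
  unfolding maps_def
proof
  fix t :: real assume t: "t \<in> {0..1}"
  have x: "0 \<le> pt r w t" "pt r w t \<le> 1" using pt_bounds[OF assms(1,2), of t] t by auto
  have "real a + 1 \<le> real r - 1" using assms by linarith
  then have "pt r (a # w) t \<le> (real r - 1) / real r" using x by (auto intro!: divide_right_mono)
  moreover have "0 \<le> pt r (a # w) t \<and> pt r (a # w) t \<le> 1"
    using pt_bounds[OF assms(1), of "a # w" t] t assms by auto
  ultimately show "lift r f (pt r (a # w) t) = pt r (a # w) t"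
    by (simp add: lift_def Let_def del: pt.simps)
qed

text \<open>\<open>gen r j\<close> is the generator \<open>x\<^sub>j\<close> of the infinite presentation, and \<open>vleaf r l\<close> is the
  \<open>l\<close>-th leaf of the infinite right vine.\<close>

definition gen :: "nat \<Rightarrow> nat \<Rightarrow> real \<Rightarrow> real" where
  "gen r j = (lift r ^^ (j div (r - 1))) (ygen r (j mod (r - 1)))"

definition vleaf :: "nat \<Rightarrow> nat \<Rightarrow> nat list" where
  "vleaf r l = replicate (l div (r - 1)) (r - 1) @ [l mod (r - 1)]"

lemma gen_less: "j < r - 1 \<Longrightarrow> gen r j = ygen r j"
  by (simp add: gen_def)

lemma gen_add: "r \<ge> 2 \<Longrightarrow> gen r (j + (r - 1)) = lift r (gen r j)"
  by (cases r) (auto simp: gen_def)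

lemma vleaf_less: "l < r - 1 \<Longrightarrow> vleaf r l = [l]"
  by (simp add: vleaf_def)

lemma vleaf_add: "r \<ge> 2 \<Longrightarrow> vleaf r (l + (r - 1)) = (r - 1) # vleaf r l"
  by (cases r) (auto simp: vleaf_def)

lemma vleaf_eq: "m < r - 1 \<Longrightarrow> vleaf r ((r - 1) * k + m) = replicate k (r - 1) @ [m]"
  by (simp add: vleaf_def)

lemma vleaf_wds:
  assumes "r \<ge> 2" shows "vleaf r l \<in> wds r"
proof -
  have "l mod (r - 1) < r - 1" using assms by simp
  then have "l mod (r - 1) < r" by linarith
  then show ?thesis using assms by (auto simp: vleaf_def)
qed

lemma xgen_eq_gen:
  assumes "r \<ge> 2" "i < r" shows "xgen r i = gen r i"
proof (cases "i + 1 < r")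
  case True
  then show ?thesis by (simp add: xgen_def gen_less)
next
  case False
  then have i: "i = 0 + (r - 1)" using assms by simp
  have "gen r i = lift r (ygen r 0)" unfolding i gen_add[OF assms(1)] using assms
    by (simp add: gen_less)
  moreover have "zgen r = lift r (ygen r 0)" by (rule ext) (simp add: zgen_def lift_def)
  ultimately show ?thesis using i assms by (simp add: xgen_def)
qed

lemma add_induct:
  fixes c :: nat
  assumes "c > 0" "\<And>j. j < c \<Longrightarrow> P j" "\<And>j. P j \<Longrightarrow> P (j + c)"
  shows "P j"
proof (induction j rule: less_induct)
  case (less j)
  show ?case
  proof (cases "j < c")
    case False
    then have "P (j - c)" using assms(1) less by simp
    from assms(3)[OF this] show ?thesis using False by simp
  qed (use assms in auto)
qed

lemma gen_0_outside:
  assumes "r \<ge> 2" shows "gen r j 0 = 0 \<and> (\<forall>t. t \<notin> {0..1} \<longrightarrow> gen r j t = t)"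
proof (induction j rule: add_induct[of "r - 1"])
  case (2 j)
  then show ?case using ygen_outside[of _ r j] ygen_pieces(1)[OF assms 2 refl refl, of 0]
    by (simp add: gen_less)
next
  case (3 j)
  then show ?case unfolding gen_add[OF assms] using assms by (auto simp: lift_def Let_def)
qed (use assms in simp)

text \<open>On the infinite right vine the explicit formulas become one rule: a caret is attached at
  leaf \<open>j\<close>, and everything to the right moves by \<open>r - 1\<close>. For
  \<open>j < r - 1\<close> this is read off the formulas; beyond that, \<open>lift\<close> prepends
  the digit \<open>r - 1\<close> to the addresses. Computations with generators use only these
  rules.\<close>

lemma gen_maps:
  assumes r: "r \<ge> 2"
  shows "\<And>l. l < j \<Longrightarrow> maps r (gen r j) (vleaf r l) (vleaf r l)"
    and "\<And>m. m < r \<Longrightarrow> maps r (gen r j) (vleaf r (j + m)) (vleaf r j @ [m])"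
    and "\<And>l. l > j \<Longrightarrow> maps r (gen r j) (vleaf r (l + (r - 1))) (vleaf r l)"
    and "\<And>k. j < (r - 1) * k \<Longrightarrow> maps r (gen r j) (replicate (Suc k) (r - 1)) (replicate k (r - 1))"
proof -
  have "(\<forall>l<j. maps r (gen r j) (vleaf r l) (vleaf r l))
    \<and> (\<forall>m<r. maps r (gen r j) (vleaf r (j + m)) (vleaf r j @ [m]))
    \<and> (\<forall>l>j. maps r (gen r j) (vleaf r (l + (r - 1))) (vleaf r l))
    \<and> (\<forall>k. j < (r - 1) * k \<longrightarrow> maps r (gen r j) (replicate (Suc k) (r - 1)) (replicate k (r - 1)))"
  proof (induction j rule: add_induct[of "r - 1"])
    case (2 j)
    note Y = ygen_maps[OF r 2 refl refl]
    have last: "maps r (ygen r j) [r - 1, r - 1] [r - 1]" using Y(4)[of "r - 1"] 2 by simp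
    have lst: "maps r (ygen r j) ((r - 1) # (r - 1) # x) ((r - 1) # x)" if "x \<in> wds r" for x
      using maps_append[OF r that last] by simp
    have p2: "maps r (ygen r j) (vleaf r (j + m)) (vleaf r j @ [m])" if m: "m < r" for m
    proof (cases "j + m < r - 1")
      case True
      then show ?thesis using Y(2) 2 by (simp add: vleaf_less)
    next
      case False
      \<comment> \<open>The leaf lies in the second caret; its index there is at most
        \<open>j\<close> because \<open>m \<le> r - 1\<close>.\<close>
      define k where "k = j + m - (r - 1)"
      have k: "j + m = k + (r - 1)" "k \<le> j" "k < r - 1" using False m 2 by (auto simp: k_def)
      have "r - 1 - j + k = m" using k 2 by simp
      then have "maps r (ygen r j) [r - 1, k] [j, m]" using Y(3)[OF k(2)] by simp
      then show ?thesis using k 2 r by (simp only: k(1) vleaf_add vleaf_less) simp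
    qed
    have p3: "maps r (ygen r j) (vleaf r (l + (r - 1))) (vleaf r l)" if l: "l > j" for l
    proof (cases "l < r - 1")
      case True
      then show ?thesis unfolding vleaf_add[OF r] using Y(4)[of l] l by (simp add: vleaf_less)
    next
      case False
      then obtain l' where l': "l = l' + (r - 1)"
        by (metis add.commute le_add_diff_inverse not_less)
      show ?thesis unfolding l' vleaf_add[OF r] using lst[OF vleaf_wds[OF r, of l']] .
    qed
    have p4: "maps r (ygen r j) (replicate (Suc k) (r - 1)) (replicate k (r - 1))" if
      "j < (r - 1) * k" for k
    proof -
      obtain k' where "k = Suc k'" using \<open>j < (r - 1) * k\<close> by (cases k) auto
      then show ?thesis using lst[of "replicate k' (r - 1)"] r by (auto simp: in_lists_conv_set)
    qed
    show ?case using Y(1) p2 p3 p4 2 by (simp add: gen_less vleaf_less)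
  next
    case (3 j)
    have g: "gen r (j + (r - 1)) = lift r (gen r j)" using gen_add[OF r] .
    have z: "gen r j 0 = 0" using gen_0_outside[OF r] by simp
    have lst: "maps r (lift r (gen r j)) ((r - 1) # w) ((r - 1) # v)" if "maps r (gen r j) w v"
      "w \<in> wds r" for w v
      using maps_lift_last[OF r that z] .
    have p1: "maps r (lift r (gen r j)) (vleaf r l) (vleaf r l)" if l: "l < j + (r - 1)" for l
    proof (cases "l < r - 1")
      case True
      then show ?thesis using maps_lift_other[OF r, of "[]" l] by (simp add: vleaf_less)
    next
      case False
      then obtain l' where l': "l = l' + (r - 1)"
        by (metis add.commute le_add_diff_inverse not_less)
      show ?thesis unfolding l' vleaf_add[OF r] using 3 l lst vleaf_wds[OF r] l' by simp
    qed
    have p2: "maps r (lift r (gen r j)) (vleaf r (j + (r - 1) + m)) (vleaf r (j + (r - 1)) @ [m])"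
      if "m < r" for m
    proof -
      have e: "j + (r - 1) + m = (j + m) + (r - 1)" by simp
      show ?thesis unfolding e vleaf_add[OF r] using 3 that lst vleaf_wds[OF r] by simp
    qed
    have p3: "maps r (lift r (gen r j)) (vleaf r (l + (r - 1))) (vleaf r l)" if l:
      "l > j + (r - 1)" for l
    proof -
      define l' where "l' = l - (r - 1)"
      have l': "l = l' + (r - 1)" using l by (simp add: l'_def)
      then have "maps r (gen r j) (vleaf r l) (vleaf r l')" using 3 l by simp
      from lst[OF this vleaf_wds[OF r]] show ?thesis unfolding l' vleaf_add[OF r] .
    qed
    have p4: "maps r (lift r (gen r j)) (replicate (Suc k) (r - 1)) (replicate k (r - 1))" if k:
      "j + (r - 1) < (r - 1) * k" for k
    proof -
      obtain k' where k': "k = Suc k'" using k by (cases k) auto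
      then have "maps r (gen r j) (replicate (Suc k') (r - 1)) (replicate k' (r - 1))" using 3 k
        by simp
      from lst[OF this] show ?thesis using r k' by (auto simp: in_lists_conv_set)
    qed
    show ?case unfolding g using p1 p2 p3 p4 by blast
  qed (use r in simp)
  then show "\<And>l. l < j \<Longrightarrow> maps r (gen r j) (vleaf r l) (vleaf r l)"
    and "\<And>m. m < r \<Longrightarrow> maps r (gen r j) (vleaf r (j + m)) (vleaf r j @ [m])"
    and "\<And>l. l > j \<Longrightarrow> maps r (gen r j) (vleaf r (l + (r - 1))) (vleaf r l)"
    and "\<And>k. j < (r - 1) * k \<Longrightarrow> maps r (gen r j) (replicate (Suc k) (r - 1)) (replicate k (r - 1))"
    by blast+
qed

section \<open>Finite right vines and the relations\<close>

definition vine :: "nat \<Rightarrow> nat \<Rightarrow> nat list list" where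
  "vine r n = map (vleaf r) [0..<(r - 1) * n] @ [replicate n (r - 1)]"

lemma vine_Suc:
  assumes "r \<ge> 2"
  shows "vine r (Suc n)
    = map (vleaf r) [0..<(r - 1) * n] @ map (\<lambda>m. replicate n (r - 1) @ [m]) [0..<r]"
proof -
  have "[0..<r] = [0..<r - 1] @ [r - 1]" using assms by (cases r) auto
  moreover have "[0..<(r - 1) * Suc n] = [0..<(r - 1) * n] @ map (\<lambda>m. (r - 1) * n + m) [0..<r - 1]"
    by (rule nth_equalityI) (auto simp: nth_append)
  moreover have "map (vleaf r) (map (\<lambda>m. (r - 1) * n + m) [0..<r - 1])
    = map (\<lambda>m. replicate n (r - 1) @ [m]) [0..<r - 1]"
    using vleaf_eq[of _ r n] by simp
  ultimately show ?thesis by (simp add: vine_def replicate_append_same)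
qed

lemma vine_tree:
  assumes "r \<ge> 2" shows "\<exists>C. tree r (vine r n) C"
proof (induction n)
  case 0
  then show ?case using tree.root by (auto simp: vine_def)
next
  case (Suc n)
  then obtain C where "tree r (vine r n) C" by blast
  then have
    "tree r (map (vleaf r) [0..<(r - 1) * n] @ map (\<lambda>m. replicate n (r - 1) @ [m]) [0..<r] @ []) (insert (replicate n (r - 1)) C)"
    unfolding vine_def by (intro tree.caret) simp
  then show ?case by (auto simp: vine_Suc[OF assms])
qed

text \<open>The children of leaf \<open>i\<close> come from positions \<open>i\<close> to
  \<open>i + r - 1\<close>, so the shift by \<open>r - 1\<close> starts at \<open>i + r\<close>;
  hence \<open>l' > i\<close> is strict.\<close>

lemma leaf_cases:
  assumes "(r::nat) \<ge> 2"
  obtains "l < i" | m where "l = i + m" "m < r" | l' where "l = l' + (r - 1)" "l' > i"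
proof -
  consider "l < i" | "i \<le> l" "l < i + r" | "i + r \<le> l" by linarith
  then show ?thesis
  proof cases
    case 2 then show ?thesis using that(2)[of "l - i"] by simp
  next
    case 3 then show ?thesis using that(3)[of "l - (r - 1)"] assms by simp
  qed (use that in auto)
qed

lemma gen_good:
  assumes r: "r \<ge> 2" shows "\<exists>v. maps r (gen r j) (vleaf r l) v"
proof (rule leaf_cases[OF r, of l j])
  show ?thesis if "l < j" using gen_maps(1)[OF r that] by blast
  show ?thesis if "l = j + m" "m < r" for m unfolding that(1) using gen_maps(2)[OF r that(2)]
    by blast
  show ?thesis if "l = l' + (r - 1)" "l' > j" for l' unfolding that(1)
    using gen_maps(3)[OF r that(2)] by blast
qed

lemma gen_PLF:
  assumes r: "r \<ge> 2" shows "gen r j \<in> PLF r"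
proof -
  \<comment> \<open>The tail of the vine at depth \<open>k\<close> begins at leaf
    \<open>(r - 1) * k\<close>; depth \<open>j + 1\<close> is past leaf \<open>j\<close>.\<close>
  have "(r - 1) * Suc j \<ge> Suc j" using r by (cases "r - 1") auto
  then have t: "maps r (gen r j) (replicate (Suc (Suc j)) (r - 1)) (replicate (Suc j) (r - 1))"
    using gen_maps(4)[OF r, of j "Suc j"] by simp
  have one: "gen r j 1 = 1" using mapsD[OF t, of 1] pt_replicate_1[OF r]
    by (metis order_refl zero_le_one)
  obtain C where C: "tree r (vine r (Suc (Suc j))) C" using vine_tree[OF r] by blast
  have "\<exists>v. maps r (gen r j) w v" if "w \<in> set (vine r (Suc (Suc j)))" for w
    using that t gen_good[OF r] by (auto simp: vine_def)
  then show ?thesis using PLF_I[where f = "gen r j", OF r _ _ one C] gen_0_outside[OF r] by blast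
qed

text \<open>Both sides produce carets at leaves \<open>i\<close> and \<open>j\<close> of the vine.
  Once a caret sits at leaf \<open>i\<close>, the old leaf \<open>j\<close> has number
  \<open>j + (r - 1)\<close>.\<close>

lemma gen_commute:
  assumes r: "r \<ge> 2" and ij: "i < j"
  shows "gen r j \<circ> gen r i = gen r i \<circ> gen r (j + (r - 1))"
proof -
  note M = gen_maps[OF r]
  \<comment> \<open>Two generators shorten the tail by two, and the remaining depth
    \<open>j + 1\<close> still starts past leaf \<open>j\<close>.\<close>
  let ?n = "Suc (Suc (Suc j))"
  obtain C where C: "tree r (vine r ?n) C" using vine_tree[OF r] by blast
  have big: "j < (r - 1) * Suc j" using r by (cases "r - 1") auto
  have 1: "maps r (gen r i) (replicate ?n (r - 1)) (replicate (Suc (Suc j)) (r - 1))"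
    using M(4)[of i "Suc (Suc j)"] big ij by simp
  have 2: "maps r (gen r j) (replicate (Suc (Suc j)) (r - 1)) (replicate (Suc j) (r - 1))"
    using M(4)[of j "Suc j"] big by simp
  have 3: "maps r (gen r (j + (r - 1))) (replicate ?n (r - 1)) (replicate (Suc (Suc j)) (r - 1))"
    using M(4)[of "j + (r - 1)" "Suc (Suc j)"] big by simp
  have 4: "maps r (gen r i) (replicate (Suc (Suc j)) (r - 1)) (replicate (Suc j) (r - 1))"
    using M(4)[of i "Suc j"] big ij by simp
  have tail: "\<exists>v. maps r (gen r j \<circ> gen r i) (replicate ?n (r - 1)) v \<and>
      maps r (gen r i \<circ> gen r (j + (r - 1))) (replicate ?n (r - 1)) v"
    using maps_comp[OF 2 1] maps_comp[OF 4 3] by blast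
  have leaf: "\<exists>v. maps r (gen r j \<circ> gen r i) (vleaf r l) v \<and>
      maps r (gen r i \<circ> gen r (j + (r - 1))) (vleaf r l) v" for l
  proof -
    consider "l < i" | "i \<le> l" "l < i + r" | "i + r \<le> l" by linarith
    then show ?thesis
    proof cases
      case 1
      then have "l < j" "l < j + (r - 1)" using ij by auto
      then show ?thesis using maps_comp[OF M(1)[of l j] M(1)[of l i]]
          maps_comp[OF M(1)[of l i] M(1)[of l "j + (r - 1)"]] 1 by blast
    next
      case 2
      then obtain m where m: "l = i + m" "m < r" using nat_le_iff_add[of i l] by auto
      have "l < j + (r - 1)" using m ij by linarith
      then have "maps r (gen r (j + (r - 1))) (vleaf r l) (vleaf r l)" by (rule M(1))
      moreover have "maps r (gen r i) (vleaf r l) (vleaf r i @ [m])" unfolding m(1)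
        by (rule M(2)[OF m(2)])
      moreover have "maps r (gen r j) (vleaf r i @ [m]) (vleaf r i @ [m])"
        using maps_append[OF r _ M(1)[OF ij], of "[m]"] m by auto
      ultimately show ?thesis using maps_comp by blast
    next
      case 3
      define l' where "l' = l - (r - 1)"
      have l': "l = l' + (r - 1)" "l' > i" using 3 r by (auto simp: l'_def)
      have a: "maps r (gen r i) (vleaf r l) (vleaf r l')" using M(3) l' by simp
      consider "l' < j" | "j \<le> l'" "l' < j + r" | "j + r \<le> l'" by linarith
      then show ?thesis
      proof cases
        case 1
        have "maps r (gen r (j + (r - 1))) (vleaf r l) (vleaf r l)" using 1 l' by (intro M(1)) simp
        then show ?thesis using maps_comp[OF M(1)[OF 1] a] maps_comp[OF a] by blast
      next
        case 2
        then obtain m where m: "l' = j + m" "m < r" using nat_le_iff_add[of j l'] by auto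
        have "l = j + (r - 1) + m" using l' m by simp
        then have "maps r (gen r (j + (r - 1))) (vleaf r l) (vleaf r (j + (r - 1)) @ [m])"
          using M(2)[OF m(2)] by blast
        moreover have "maps r (gen r i) (vleaf r (j + (r - 1)) @ [m]) (vleaf r j @ [m])"
          using maps_append[OF r _ M(3)[OF ij], of "[m]"] m by auto
        moreover have "maps r (gen r j) (vleaf r l') (vleaf r j @ [m])" using M(2)[OF m(2)] m(1)
          by blast
        ultimately show ?thesis using maps_comp a by blast
      next
        case 3
        define k where "k = l' - (r - 1)"
        have k: "l' = k + (r - 1)" "k > j" using 3 r by (auto simp: k_def)
        have "maps r (gen r j) (vleaf r l') (vleaf r k)" using M(3)[OF k(2)] k(1) by simp
        moreover have "maps r (gen r (j + (r - 1))) (vleaf r l) (vleaf r l')"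
          unfolding l'(1) by (rule M(3)) (use k in simp)
        moreover have "maps r (gen r i) (vleaf r l') (vleaf r k)" using M(3)[of i k] k ij by simp
        ultimately show ?thesis using maps_comp a by blast
      qed
    qed
  qed
  show ?thesis
  proof (rule PLF_eqI[OF r _ _ C])
    show "gen r j \<circ> gen r i \<in> PLF r" "gen r i \<circ> gen r (j + (r - 1)) \<in> PLF r"
      using PLF_comp[OF r] gen_PLF[OF r] by auto
    fix w assume "w \<in> set (vine r ?n)"
    then show "\<exists>v. maps r (gen r j \<circ> gen r i) w v \<and> maps r (gen r i \<circ> gen r (j + (r - 1))) w v"
      unfolding vine_def using leaf tail by auto
  qed
qed

section \<open>Trees as sorted products of generators\<close>

definition gprod :: "nat \<Rightarrow> nat list \<Rightarrow> real \<Rightarrow> real" where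
  "gprod r js = foldr (\<lambda>j f. gen r j \<circ> f) js id"

lemma gprod_Nil [simp]: "gprod r [] = id"
  by (simp add: gprod_def)

lemma gprod_Cons [simp]: "gprod r (j # js) = gen r j \<circ> gprod r js"
  by (simp add: gprod_def)

lemma gprod_append: "gprod r (ks @ js) = gprod r ks \<circ> gprod r js"
  by (induction ks) auto

lemma gprod_PLF: "r \<ge> 2 \<Longrightarrow> gprod r js \<in> PLF r"
  by (induction js) (auto simp: PLF_id intro: PLF_comp gen_PLF)

text \<open>The letter \<open>l\<close> travels left past the larger letters of the sorted word,
  each of which rises by \<open>r - 1\<close>, until it meets a letter that is at most
  \<open>l\<close>. The last clause is kept for bounding the indices in
  \<open>tree_factor\<close>.\<close>

lemma gprod_insert:
  assumes "r \<ge> 2" "sorted js"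
  shows "\<exists>js'. sorted js' \<and> length js' = Suc (length js) \<and> gprod r js' = gprod r js \<circ> gen r l
    \<and> set js' \<subseteq> insert l (set js \<union> (\<lambda>j. j + (r - 1)) ` set js)"
  using assms(2)
proof (induction js rule: rev_induct)
  case Nil
  show ?case by (intro exI[of _ "[l]"]) simp
next
  case (snoc b as)
  show ?case
  proof (cases "b \<le> l")
    case True
    then show ?thesis using snoc.prems
      by (intro exI[of _ "(as @ [b]) @ [l]"]) (auto simp: sorted_append gprod_append)
  next
    case False
    then have bl: "l < b" by simp
    have sas: "sorted as" "\<forall>a\<in>set as. a \<le> b" using snoc.prems by (auto simp: sorted_append)
    obtain as' where as': "sorted as'" "length as' = Suc (length as)"
      "gprod r as' = gprod r as \<circ> gen r l"
      "set as' \<subseteq> insert l (set as \<union> (\<lambda>j. j + (r - 1)) ` set as)" using snoc.IH[OF sas(1)] by blast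
    have "gprod r (as' @ [b + (r - 1)]) = gprod r as \<circ> (gen r l \<circ> gen r (b + (r - 1)))"
      by (simp only: gprod_append as'(3) gprod_Cons gprod_Nil comp_assoc comp_id)
    also have "\<dots> = gprod r (as @ [b]) \<circ> gen r l"
      by (simp only: gen_commute[OF assms(1) bl, symmetric] gprod_append gprod_Cons gprod_Nil
        comp_assoc comp_id)
    finally have g: "gprod r (as' @ [b + (r - 1)]) = gprod r (as @ [b]) \<circ> gen r l" .
    have "a \<le> b + (r - 1)" if "a \<in> set as'" for a
      using subsetD[OF as'(4) that] sas(2) bl by fastforce
    then have "sorted (as' @ [b + (r - 1)])" using as'(1) by (simp add: sorted_append)
    then show ?thesis using as'(2,4) g by (intro exI[of _ "as' @ [b + (r - 1)]"]) auto
  qed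
qed

lemma list_all2_maps_comp:
  assumes "list_all2 (maps r f) vs us" "list_all2 (maps r g) ws vs"
  shows "list_all2 (maps r (f \<circ> g)) ws us"
proof (rule list_all2_all_nthI)
  fix n assume "n < length ws"
  then have "maps r g (ws ! n) (vs ! n)" "maps r f (vs ! n) (us ! n)"
    using assms by (auto simp: list_all2_conv_all_nth)
  then show "maps r (f \<circ> g) (ws ! n) (us ! n)" using maps_comp by blast
qed (use list_all2_lengthD[OF assms(1)] list_all2_lengthD[OF assms(2)] in simp)

lemma map_add_upt_interval: "map (\<lambda>a. a + c) [i..<j] = [i + c..<j + c]" for c :: nat
  by (induction j) auto

lemma list_all2_maps_caret:
  assumes "r \<ge> 2" "maps r f w v"
  shows "list_all2 (maps r f) (map (\<lambda>m. w @ [m]) [0..<r]) (map (\<lambda>m. v @ [m]) [0..<r])"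
  using assms by (auto simp: list_all2_conv_all_nth intro!: maps_append)

lemma gen_maps_vine:
  assumes r: "r \<ge> 2" and l: "l < (r - 1) * n"
  shows "list_all2 (maps r (gen r l)) (vine r (Suc n))
    (map (vleaf r) [0..<l] @ map (\<lambda>m. vleaf r l @ [m]) [0..<r] @ map (vleaf r) [Suc l..<(r - 1) * n]
      @ [replicate n (r - 1)])"
proof -
  have len: "(r - 1) * Suc n = l + r + ((r - 1) * n - Suc l)" using r l by (cases r) auto
  have "map (\<lambda>m. l + m) [0..<r] = [l..<l + r]"
    using map_add_upt_interval[of l 0 r] by (simp add: add.commute)
  moreover have "map (\<lambda>a. a + (r - 1)) [Suc l..<(r - 1) * n] = [l + r..<(r - 1) * Suc n]"
    unfolding map_add_upt_interval using r by (simp add: add.commute)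
  moreover have "[0..<(r - 1) * Suc n] = [0..<l] @ [l..<l + r] @ [l + r..<(r - 1) * Suc n]"
    unfolding len using upt_add_eq_append[of 0 "l + r"
      "(r - 1) * n - Suc l"] upt_add_eq_append[of 0 l r] by simp
  ultimately have "[0..<(r - 1) * Suc n]
    = [0..<l] @ map (\<lambda>m. l + m) [0..<r] @ map (\<lambda>a. a + (r - 1)) [Suc l..<(r - 1) * n]"
    by simp
  then have v: "vine r (Suc n) = map (vleaf r) [0..<l] @ map (\<lambda>m. vleaf r (l + m)) [0..<r]
      @ map (\<lambda>a. vleaf r (a + (r - 1))) [Suc l..<(r - 1) * n] @ [replicate (Suc n) (r - 1)]"
    by (simp add: vine_def comp_def)
  have 1: "list_all2 (maps r (gen r l)) (map (vleaf r) [0..<l]) (map (vleaf r) [0..<l])"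
    using gen_maps(1)[OF r] by (simp add: list_all2_conv_all_nth)
  have 2: "list_all2 (maps r (gen r l)) (map (\<lambda>m. vleaf r (l + m)) [0..<r]) (map (\<lambda>m. vleaf r l @ [m]) [0..<r])"
    using gen_maps(2)[OF r] by (simp add: list_all2_conv_all_nth)
  have 3: "list_all2 (maps r (gen r l)) (map (\<lambda>a. vleaf r (a + (r - 1))) [Suc l..<(r - 1) * n]) (map (vleaf r) [Suc l..<(r - 1) * n])"
    unfolding list_all2_map1 list_all2_map2 list_all2_same using gen_maps(3)[OF r] by simp
  have 4: "list_all2 (maps r (gen r l)) [replicate (Suc n) (r - 1)] [replicate n (r - 1)]"
    using gen_maps(4)[OF r l] by simp
  show ?thesis unfolding v using 1 2 3 4 by (intro list_all2_appendI)
qed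

text \<open>A caret at the last leaf is already supplied by the longer vine and costs no letter; a
  caret at any other leaf \<open>l\<close> costs one letter \<open>l\<close> on the right. The bound
  on the indices limits the power of \<open>x_0\<close> spent in telescoping.\<close>

lemma tree_factor:
  assumes r: "r \<ge> 2" and "tree r ws C"
  shows "\<exists>js. sorted js \<and> length js \<le> card C \<and> (\<forall>j\<in>set js. j \<le> (r - 1) * card C)
    \<and> list_all2 (maps r (gprod r js)) (vine r (card C)) ws"
  using assms(2)
proof (induction rule: tree.induct)
  case root
  show ?case by (intro exI[of _ "[]"]) (auto simp: vine_def maps_def)
next
  case (caret xs w ys C)
  define n where "n = card C"
  define l where "l = length xs"
  have "w \<notin> C" using tree_prefix_free[OF caret.hyps] by auto
  then have cn: "card (insert w C) = Suc n" using tree_finite[OF caret.hyps] by (simp add: n_def)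
  have len: "length (xs @ w # ys) = (r - 1) * n + 1" using tree_length[OF r caret.hyps]
    by (simp add: n_def)
  obtain js where js: "sorted js" "length js \<le> n" "\<forall>j\<in>set js. j \<le> (r - 1) * n"
    "list_all2 (maps r (gprod r js)) (vine r n) (xs @ w # ys)" using caret.IH by (auto simp: n_def)
  show ?case
  proof (cases "ys = []")
    case True
    then have "length (map (vleaf r) [0..<(r - 1) * n]) = length xs" using len by simp
    then have a: "list_all2 (maps r (gprod r js)) (map (vleaf r) [0..<(r - 1) * n]) xs"
      and b: "maps r (gprod r js) (replicate n (r - 1)) w"
      using js(4) True by (auto simp: vine_def list_all2_append)
    have "list_all2 (maps r (gprod r js)) (vine r (Suc n)) (xs @ map (\<lambda>m. w @ [m]) [0..<r] @ ys)"
      unfolding vine_Suc[OF r] True append_Nil2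
      using a list_all2_maps_caret[OF r b] by (rule list_all2_appendI)
    moreover have "\<forall>j\<in>set js. j \<le> (r - 1) * Suc n" using js(3) by auto
    ultimately show ?thesis unfolding cn using js(1,2) by (intro exI[of _ js]) auto
  next
    case False
    then have l: "l < (r - 1) * n" using len by (cases ys) (auto simp: l_def)
    have "[0..<(r - 1) * n] = [0..<l] @ l # [Suc l..<(r - 1) * n]"
      using upt_add_eq_append[of 0 l "(r - 1) * n - l"] upt_conv_Cons[OF l] l by simp
    then have v:
      "vine r n
        = map (vleaf r) [0..<l] @ vleaf r l # (map (vleaf r) [Suc l..<(r - 1) * n] @ [replicate n (r
          - 1)])"
      by (simp add: vine_def)
    have "length (map (vleaf r) [0..<l]) = length xs" by (simp add: l_def)
    then have a: "list_all2 (maps r (gprod r js)) (map (vleaf r) [0..<l]) xs"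
      and b: "maps r (gprod r js) (vleaf r l) w"
      and c: "list_all2 (maps r (gprod r js)) (map (vleaf r) [Suc l..<(r - 1) * n] @ [replicate n (r - 1)]) ys"
      using js(4) unfolding v by (auto simp: list_all2_append)
    have "list_all2 (maps r (gprod r js))
       (map (vleaf r) [0..<l] @ map (\<lambda>m. vleaf r l @ [m]) [0..<r] @ map (vleaf r) [Suc l..<(r - 1) *
         n] @ [replicate n (r - 1)])
       (xs @ map (\<lambda>m. w @ [m]) [0..<r] @ ys)"
      using a list_all2_maps_caret[OF r b] c by (intro list_all2_appendI)
    from list_all2_maps_comp[OF this gen_maps_vine[OF r l]]
    have m: "list_all2 (maps r (gprod r js \<circ> gen r l)) (vine r (Suc n)) (xs @ map (\<lambda>m. w @ [m]) [0..<r] @ ys)" .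
    obtain js' where js': "sorted js'" "length js' = Suc (length js)"
      "gprod r js' = gprod r js \<circ> gen r l"
      "set js' \<subseteq> insert l (set js \<union> (\<lambda>j. j + (r - 1)) ` set js)" using gprod_insert[OF r js(1)]
        by blast
    have "j \<le> (r - 1) * Suc n" if "j \<in> set js'" for j
      using subsetD[OF js'(4) that] js(3) l by auto
    moreover have
      "list_all2 (maps r (gprod r js')) (vine r (Suc n)) (xs @ map (\<lambda>m. w @ [m]) [0..<r] @ ys)"
      unfolding js'(3) by (rule m)
    moreover have "length js' \<le> Suc n" using js'(2) js(2) by simp
    ultimately show ?thesis unfolding cn using js'(1) by blast
  qed
qed

section \<open>Word length and bad intervals\<close>

text \<open>Length at most \<open>n\<close>, so that bounds can be added and weakened without
  knowing the minimum.\<close>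

definition word_of :: "('a, 'b) monoid_scheme \<Rightarrow> 'a set \<Rightarrow> nat \<Rightarrow> 'a \<Rightarrow> bool" where
  "word_of G S n g \<longleftrightarrow> (\<exists>ws. length ws \<le> n \<and> set ws \<subseteq> S \<union> m_inv G ` S
     \<and> foldr (\<lambda>x y. x \<otimes>\<^bsub>G\<^esub> y) ws \<one>\<^bsub>G\<^esub> = g)"

lemma word_length_le:
  assumes "word_of G S n g" shows "word_length G S g \<le> n"
proof -
  obtain ws where ws: "length ws \<le> n" "set ws \<subseteq> S \<union> m_inv G ` S"
    "foldr (\<lambda>x y. x \<otimes>\<^bsub>G\<^esub> y) ws \<one>\<^bsub>G\<^esub> = g"
    using assms by (auto simp: word_of_def)
  have "word_length G S g \<le> length ws" unfolding word_length_def
    by (rule Least_le) (use ws in blast)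
  then show ?thesis using ws by simp
qed

lemma word_length_attained:
  assumes "word_of G S n g"
  shows "\<exists>ws. length ws = word_length G S g \<and> set ws \<subseteq> S \<union> m_inv G ` S
    \<and> foldr (\<lambda>x y. x \<otimes>\<^bsub>G\<^esub> y) ws \<one>\<^bsub>G\<^esub> = g"
proof -
  have "\<exists>n ws. length ws = n \<and> set ws \<subseteq> S \<union> m_inv G ` S \<and> foldr (\<lambda>x y. x \<otimes>\<^bsub>G\<^esub> y) ws \<one>\<^bsub>G\<^esub> = g"
    using assms by (auto simp: word_of_def)
  then show ?thesis unfolding word_length_def by (rule LeastI_ex)
qed

lemma word_of_mono: "word_of G S n g \<Longrightarrow> n \<le> m \<Longrightarrow> word_of G S m g"
  unfolding word_of_def using order_trans by blast

lemma word_of_one: "word_of G S n \<one>\<^bsub>G\<^esub>"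
  unfolding word_of_def by (intro exI[of _ "[]"]) simp

context group
begin

lemma letters_carrier: "S \<subseteq> carrier G \<Longrightarrow> S \<union> m_inv G ` S \<subseteq> carrier G"
  by auto

lemma foldr_closed: "set ws \<subseteq> carrier G \<Longrightarrow> foldr (\<lambda>x y. x \<otimes> y) ws \<one> \<in> carrier G"
  by (induction ws) auto

lemma foldr_append_mult:
  "set ws \<subseteq> carrier G \<Longrightarrow> set vs \<subseteq> carrier G \<Longrightarrow>
     foldr (\<lambda>x y. x \<otimes> y) (ws @ vs) \<one> = foldr (\<lambda>x y. x \<otimes> y) ws \<one> \<otimes> foldr (\<lambda>x y. x \<otimes> y) vs \<one>"
  by (induction ws) (auto simp: foldr_closed m_assoc simp del: foldr_append)

lemma foldr_inv:
  "set ws \<subseteq> carrier G \<Longrightarrow>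
     foldr (\<lambda>x y. x \<otimes> y) (rev (map (m_inv G) ws)) \<one> = inv (foldr (\<lambda>x y. x \<otimes> y) ws \<one>)"
proof (induction ws)
  case (Cons a ws)
  have "set (rev (map (m_inv G) ws)) \<subseteq> carrier G" using Cons.prems by auto
  then have "foldr (\<lambda>x y. x \<otimes> y) (rev (map (m_inv G) ws) @ [inv a]) \<one>
    = inv (foldr (\<lambda>x y. x \<otimes> y) ws \<one>) \<otimes> inv a"
    using Cons by (subst foldr_append_mult) auto
  then show ?case using Cons.prems foldr_closed by (simp add: inv_mult_group del: foldr_append)
qed auto

lemma word_of_mult:
  assumes "S \<subseteq> carrier G" "word_of G S n g" "word_of G S m h"
  shows "word_of G S (n + m) (g \<otimes> h)"
proof -
  obtain ws vs where w: "length ws \<le> n" "set ws \<subseteq> S \<union> m_inv G ` S" "foldr (\<lambda>x y. x \<otimes> y) ws \<one> = g"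
    "length vs \<le> m" "set vs \<subseteq> S \<union> m_inv G ` S" "foldr (\<lambda>x y. x \<otimes> y) vs \<one> = h"
    using assms(2,3) by (auto simp: word_of_def)
  have "foldr (\<lambda>x y. x \<otimes> y) (ws @ vs) \<one> = g \<otimes> h"
    using foldr_append_mult w letters_carrier[OF assms(1)] by (metis subset_trans)
  then show ?thesis unfolding word_of_def using w
    by (intro exI[of _ "ws @ vs"]) (auto simp del: foldr_append)
qed

lemma word_of_inv:
  assumes "S \<subseteq> carrier G" "word_of G S n g" shows "word_of G S n (inv g)"
proof -
  obtain ws where w: "length ws \<le> n" "set ws \<subseteq> S \<union> m_inv G ` S" "foldr (\<lambda>x y. x \<otimes> y) ws \<one> = g"
    using assms(2) by (auto simp: word_of_def)
  have wc: "set ws \<subseteq> carrier G" using w(2) letters_carrier[OF assms(1)] by blast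
  have "inv x \<in> S \<union> m_inv G ` S" if "x \<in> S \<union> m_inv G ` S" for x
    using that assms(1) by auto
  then have "set (rev (map (m_inv G) ws)) \<subseteq> S \<union> m_inv G ` S" using w(2) unfolding set_rev set_map
    by blast
  then show ?thesis unfolding word_of_def using foldr_inv[OF wc] w
    by (intro exI[of _ "rev (map (m_inv G) ws)"]) auto
qed

lemma word_of_gen:
  assumes "S \<subseteq> carrier G" "x \<in> S" shows "word_of G S 1 x"
  unfolding word_of_def using assms by (intro exI[of _ "[x]"]) auto

end

section \<open>Word length in F(r) against the number of bad intervals\<close>

lemma Fgrp_simps [simp]:
  "carrier (Fgrp r) = PLF r" "f \<otimes>\<^bsub>Fgrp r\<^esub> g = f \<circ> g" "\<one>\<^bsub>Fgrp r\<^esub> = id"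
  by (auto simp: Fgrp_def)

lemma Fgens_eq: "r \<ge> 2 \<Longrightarrow> Fgens r = gen r ` {..<r}"
  unfolding Fgens_def using xgen_eq_gen by (intro image_cong) auto

lemma Fgens_carrier: "r \<ge> 2 \<Longrightarrow> Fgens r \<subseteq> PLF r"
  using gen_PLF by (auto simp: Fgens_eq)

text \<open>Conjugation by \<open>x_0\<close> lowers an index by \<open>r - 1\<close> as long as the
  result is positive.\<close>

lemma gen_0_shift:
  assumes r: "r \<ge> 2" and i: "i \<ge> 1"
  shows "(gen r 0 ^^ k) \<circ> gen r (i + (r - 1) * k) = gen r i \<circ> (gen r 0 ^^ k)"
proof (induction k)
  case (Suc k)
  have e: "i + (r - 1) * Suc k = (i + (r - 1) * k) + (r - 1)" by simp
  have "(gen r 0 ^^ Suc k) \<circ> gen r (i + (r - 1) * Suc k)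
      = (gen r 0 ^^ k) \<circ> (gen r 0 \<circ> gen r ((i + (r - 1) * k) + (r - 1)))"
    unfolding e funpow_Suc_right by (simp only: comp_assoc)
  also have "\<dots> = ((gen r 0 ^^ k) \<circ> gen r (i + (r - 1) * k)) \<circ> gen r 0"
    using gen_commute[OF r, of 0 "i + (r - 1) * k"] i by (simp add: comp_assoc)
  also have "\<dots> = gen r i \<circ> (gen r 0 ^^ Suc k)"
    unfolding Suc.IH funpow_Suc_right by (simp only: comp_assoc)
  finally show ?case .
qed auto

text \<open>The sorted word is read from the left with a moving exponent \<open>k\<close>. A first
  letter within reach turns into one of the finitely many generators when it passes the power of
  \<open>x_0\<close>; otherwise \<open>k\<close> grows by one at the cost of one inverse of
  \<open>x_0\<close>. As the word is sorted, \<open>k\<close> never goes back, so these inverses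
  number \<open>K - k\<close> in total.\<close>

lemma gprod_telescope:
  assumes r: "r \<ge> 2" and "sorted js" "\<forall>j\<in>set js. j \<le> (r - 1) * K"
    "k = 0 \<or> (\<forall>j\<in>set js. j > (r - 1) * k)" "k \<le> K"
  shows "\<exists>h. word_of (Fgrp r) (Fgens r) (length js + (K - k)) h \<and> h \<in> PLF r
    \<and> (gen r 0 ^^ k) \<circ> gprod r js = h \<circ> (gen r 0 ^^ K)"
  using assms(2-5)
proof (induction "length js + (K - k)" arbitrary: js k)
  case 0
  have "length js = 0" and k: "k = K" using "0.hyps" "0.prems"(4) by linarith+
  then have js: "js = []" by simp
  show ?case unfolding js k
  proof (intro exI[of _ id] conjI)
    show "word_of (Fgrp r) (Fgens r) (length [] + (K - K)) id"
      using word_of_one[of "Fgrp r" "Fgens r"] unfolding Fgrp_simps .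
  qed (simp_all only: gprod_Nil o_id id_o PLF_id[OF r])
next
  case (Suc N)
  interpret group "Fgrp r" using group_Fgrp[OF r] .
  note S = Fgens_carrier[OF r]
  have up: "\<exists>h. word_of (Fgrp r) (Fgens r) (length js + (K - k)) h \<and> h \<in> PLF r
      \<and> (gen r 0 ^^ k) \<circ> gprod r js = h \<circ> (gen r 0 ^^ K)"
    if k: "k < K" and js: "\<forall>j\<in>set js. j > (r - 1) * Suc k"
  proof -
    have N: "N = length js + (K - Suc k)" using Suc.hyps(2) k by simp
    obtain h where h: "word_of (Fgrp r) (Fgens r) (length js + (K - Suc k)) h" "h \<in> PLF r"
      "(gen r 0 ^^ Suc k) \<circ> gprod r js = h \<circ> (gen r 0 ^^ K)"
      using Suc.hyps(1)[OF N Suc.prems(1,2) disjI2[OF js] Suc_leI[OF k]] by blast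
    have g0: "gen r 0 \<in> Fgens r" using r by (auto simp: Fgens_eq)
    let ?s = "inv\<^bsub>Fgrp r\<^esub> (gen r 0)"
    have s: "?s \<in> PLF r" "?s \<circ> gen r 0 = id" using inv_closed l_inv g0 S
      by (simp_all add: subset_iff)
    have "word_of (Fgrp r) (Fgens r) (1 + (length js + (K - Suc k))) (?s \<circ> h)"
      using word_of_mult[OF _ word_of_inv[OF _ word_of_gen[OF _ g0]] h(1)] S by simp
    moreover have "1 + (length js + (K - Suc k)) = length js + (K - k)" using k by simp
    moreover have "?s \<circ> h \<in> PLF r" using PLF_comp[OF r s(1) h(2)] .
    moreover have "(gen r 0 ^^ k) \<circ> gprod r js = (?s \<circ> h) \<circ> (gen r 0 ^^ K)"
    proof -
      have "(?s \<circ> h) \<circ> (gen r 0 ^^ K) = ?s \<circ> ((gen r 0 ^^ Suc k) \<circ> gprod r js)" using h(3)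
        by (simp only: comp_assoc)
      also have "\<dots> = (?s \<circ> gen r 0) \<circ> ((gen r 0 ^^ k) \<circ> gprod r js)"
        by (simp only: funpow.simps comp_assoc)
      finally show ?thesis using s(2) by simp
    qed
    ultimately show ?thesis by metis
  qed
  show ?case
  proof (cases js)
    case Nil
    then have "k < K" using Suc.hyps(2) Suc.prems(4) by simp
    then show ?thesis using up Nil by simp
  next
    case (Cons j js')
    show ?thesis
    proof (cases "j \<le> (r - 1) * Suc k")
      case False
      then have "\<forall>i\<in>set js. i > (r - 1) * Suc k" using Suc.prems(1) Cons by auto
      moreover have "k < K"
      proof (rule ccontr)
        assume "\<not> k < K"
        then have "(r - 1) * K \<le> (r - 1) * Suc k" by (intro mult_le_mono) auto
        moreover have "j \<le> (r - 1) * K" using Suc.prems(2) Cons by simp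
        ultimately show False using False by simp
      qed
      ultimately show ?thesis using up by blast
    next
      case True
      \<comment> \<open>Within reach means \<open>i \<le> r - 1\<close>. Index 0 can occur only for
        \<open>k = 0\<close>, where there is no power of \<open>x_0\<close> to pass.\<close>
      define i where "i = j - (r - 1) * k"
      have ir: "i < r" using True r by (auto simp: i_def)
      have sh: "(gen r 0 ^^ k) \<circ> gen r j = gen r i \<circ> (gen r 0 ^^ k)"
      proof (cases "k = 0")
        case False
        then have "j > (r - 1) * k" using Suc.prems(3) Cons by auto
        then have "j = i + (r - 1) * k" "i \<ge> 1" by (auto simp: i_def)
        then show ?thesis using gen_0_shift[OF r] by metis
      qed (simp add: i_def)
      have N': "N = length js' + (K - k)" and s': "sorted js'" and b': "\<forall>j\<in>set js'. j \<le> (r - 1) * K"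
        and c': "k = 0 \<or> (\<forall>j\<in>set js'. j > (r - 1) * k)"
        using Suc.hyps(2) Suc.prems Cons by auto
      obtain h where h: "word_of (Fgrp r) (Fgens r) (length js' + (K - k)) h" "h \<in> PLF r"
        "(gen r 0 ^^ k) \<circ> gprod r js' = h \<circ> (gen r 0 ^^ K)"
        using Suc.hyps(1)[OF N' s' b' c' Suc.prems(4)] by blast
      have gi: "gen r i \<in> Fgens r" using r ir by (auto simp: Fgens_eq)
      have "word_of (Fgrp r) (Fgens r) (1 + (length js' + (K - k))) (gen r i \<circ> h)"
        using word_of_mult[OF _ word_of_gen[OF _ gi] h(1)] S by simp
      moreover have "gen r i \<circ> h \<in> PLF r" using PLF_comp[OF r gen_PLF[OF r] h(2)] .
      moreover have "(gen r 0 ^^ k) \<circ> gprod r js = (gen r i \<circ> h) \<circ> (gen r 0 ^^ K)"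
      proof -
        have "(gen r 0 ^^ k) \<circ> gprod r js = ((gen r 0 ^^ k) \<circ> gen r j) \<circ> gprod r js'"
          by (simp add: Cons comp_assoc)
        also have "\<dots> = gen r i \<circ> ((gen r 0 ^^ k) \<circ> gprod r js')" by (simp only: sh comp_assoc)
        also have "\<dots> = (gen r i \<circ> h) \<circ> (gen r 0 ^^ K)" by (simp only: h(3) comp_assoc)
        finally show ?thesis .
      qed
      ultimately show ?thesis using Cons by auto
    qed
  qed
qed

text \<open>The factor 3 counts the letters, the inverses of \<open>x_0\<close> spent on the way,
  and the final power of \<open>x_0\<close>, each at most \<open>n\<close>.\<close>

lemma word_of_gprod:
  assumes r: "r \<ge> 2" and "sorted js" "\<forall>j\<in>set js. j \<le> (r - 1) * n" "length js \<le> n"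
  shows "word_of (Fgrp r) (Fgens r) (3 * n) (gprod r js)"
proof -
  interpret group "Fgrp r" using group_Fgrp[OF r] .
  note S = Fgens_carrier[OF r]
  obtain h where h: "word_of (Fgrp r) (Fgens r) (length js + n) h" "gprod r js = h \<circ> (gen r 0 ^^ n)"
    using gprod_telescope[OF r assms(2,3), of 0] by auto
  have g0: "gen r 0 \<in> Fgens r" using r by (auto simp: Fgens_eq)
  have "word_of (Fgrp r) (Fgens r) n (gen r 0 ^^ n)"
  proof (induction n)
    case 0
    show ?case using word_of_one[of "Fgrp r"] by (simp add: id_def)
  next
    case (Suc n)
    then have "word_of (Fgrp r) (Fgens r) (1 + n) (gen r 0 \<circ> gen r 0 ^^ n)"
      using word_of_mult[OF _ word_of_gen[OF _ g0] Suc] S by simp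
    then show ?case by (simp only: funpow.simps plus_1_eq_Suc)
  qed
  then have "word_of (Fgrp r) (Fgens r) (length js + n + n) (gprod r js)"
    using word_of_mult[OF _ h(1)] S h(2) by simp
  then show ?thesis using word_of_mono assms(4) by fastforce
qed

text \<open>Both trees of a pair are reached from the same vine, so \<open>f\<close> is a quotient
  of two sorted products; this doubles the factor 3.\<close>

lemma word_of_bad:
  assumes r: "r \<ge> 2" and f: "f \<in> PLF r"
  shows "word_of (Fgrp r) (Fgens r) (6 * card (bad r f)) f"
proof -
  interpret group "Fgrp r" using group_Fgrp[OF r] .
  note S = Fgens_carrier[OF r]
  obtain ws C vs D where t: "tree r ws C" "tree r vs D" "card C \<le> card (bad r f)" "card D = card C"
    "list_all2 (maps r f) ws vs" using PLF_tree_pair[OF r f] by blast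
  define n where "n = card C"
  obtain ks where i: "sorted ks" "length ks \<le> n" "\<forall>j\<in>set ks. j \<le> (r - 1) * n"
    "list_all2 (maps r (gprod r ks)) (vine r n) ws" using tree_factor[OF r t(1)] n_def by auto
  obtain js where j: "sorted js" "length js \<le> n" "\<forall>j\<in>set js. j \<le> (r - 1) * n"
    "list_all2 (maps r (gprod r js)) (vine r n) vs" using tree_factor[OF r t(2)] n_def t(4) by auto
  obtain V where V: "tree r (vine r n) V" using vine_tree[OF r] by blast
  have eq: "f \<circ> gprod r ks = gprod r js"
  proof (rule PLF_eqI[OF r _ _ V])
    show "f \<circ> gprod r ks \<in> PLF r" using PLF_comp[OF r f gprod_PLF[OF r]] .
    show "gprod r js \<in> PLF r" using gprod_PLF[OF r] .
    have c: "list_all2 (maps r (f \<circ> gprod r ks)) (vine r n) vs"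
      using list_all2_maps_comp[OF t(5) i(4)] .
    fix w assume w: "w \<in> set (vine r n)"
    obtain a where a: "a < length (vine r n)" "w = vine r n ! a" using w by (metis in_set_conv_nth)
    show "\<exists>v. maps r (f \<circ> gprod r ks) w v \<and> maps r (gprod r js) w v"
      using c j(4) a by (intro exI[of _ "vs ! a"]) (auto simp: list_all2_conv_all_nth)
  qed
  let ?q = "inv\<^bsub>Fgrp r\<^esub> (gprod r ks)"
  have q: "gprod r ks \<circ> ?q = id" using r_inv[of "gprod r ks"] gprod_PLF[OF r] by simp
  have "f = f \<circ> (gprod r ks \<circ> ?q)" using q by simp
  also have "\<dots> = gprod r js \<circ> ?q" by (simp only: eq[symmetric] comp_assoc)
  finally have "f = gprod r js \<circ> ?q" .
  moreover have "word_of (Fgrp r) (Fgens r) (3 * n + 3 * n) (gprod r js \<circ> ?q)"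
    using word_of_mult[OF _ word_of_gprod[OF r j(1,3,2)] word_of_inv[OF _ word_of_gprod[OF r
      i(1,3,2)]]] S by simp
  ultimately show ?thesis using word_of_mono[of "Fgrp r" "Fgens r" "3 * n + 3 * n"] t(3) n_def
    by simp
qed

lemma bad_le_word_length:
  assumes r: "r \<ge> 2"
  shows "\<exists>M::nat. \<forall>f\<in>PLF r. card (bad r f) \<le> M * word_length (Fgrp r) (Fgens r) f"
proof -
  interpret group "Fgrp r" using group_Fgrp[OF r] .
  note S = Fgens_carrier[OF r]
  define A where "A = Fgens r \<union> m_inv (Fgrp r) ` Fgens r"
  have AP: "A \<subseteq> PLF r" using letters_carrier S by (simp add: A_def)
  have finA: "finite A" by (simp add: A_def Fgens_def)
  define M where "M = Max (insert 0 ((\<lambda>x. card (bad r x)) ` A))"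
  have M: "card (bad r x) \<le> M" if "x \<in> A" for x unfolding M_def using finA that
    by (intro Max_ge) auto
  have fold: "foldr (\<lambda>x y. x \<otimes>\<^bsub>Fgrp r\<^esub> y) ws \<one>\<^bsub>Fgrp r\<^esub> \<in> PLF r \<and>
      card (bad r (foldr (\<lambda>x y. x \<otimes>\<^bsub>Fgrp r\<^esub> y) ws \<one>\<^bsub>Fgrp r\<^esub>)) \<le> M * length ws" if "set ws \<subseteq>
        A" for ws
    using that
  proof (induction ws)
    case Nil
    have "bad r id = {}" unfolding bad_def using maps_id by blast
    then have c: "card (bad r id) = 0" by simp
    have e: "foldr (\<lambda>x y. x \<otimes>\<^bsub>Fgrp r\<^esub> y) [] \<one>\<^bsub>Fgrp r\<^esub> = id" by (simp add: fun_eq_iff)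
    show ?case unfolding e c using PLF_id[OF r] le0 by blast
  next
    case (Cons x ws)
    define g where "g = foldr (\<lambda>x y. x \<otimes>\<^bsub>Fgrp r\<^esub> y) ws \<one>\<^bsub>Fgrp r\<^esub>"
    have "set ws \<subseteq> A" using Cons.prems by simp
    from Cons.IH[OF this] have g: "g \<in> PLF r" "card (bad r g) \<le> M * length ws" unfolding g_def
      by blast+
    have x: "x \<in> A" "x \<in> PLF r" using Cons.prems AP by auto
    have "card (bad r (x \<circ> g)) \<le> card (bad r x) + card (bad r g)"
      using bad_comp[OF r] PLF_D[OF r g(1)] PLF_D[OF r x(2)] by blast
    then have "card (bad r (x \<circ> g)) \<le> M * length (x # ws)" using M[OF x(1)] g(2) by simp
    moreover have "foldr (\<lambda>x y. x \<otimes>\<^bsub>Fgrp r\<^esub> y) (x # ws) \<one>\<^bsub>Fgrp r\<^esub> = x \<circ> g"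
      by (simp add: g_def fun_eq_iff)
    ultimately show ?case using PLF_comp[OF r x(2) g(1)] by metis
  qed
  show ?thesis
  proof (intro exI[of _ M] ballI)
    fix f assume f: "f \<in> PLF r"
    obtain ws where ws: "length ws = word_length (Fgrp r) (Fgens r) f" "set ws \<subseteq> A"
      "foldr (\<lambda>x y. x \<otimes>\<^bsub>Fgrp r\<^esub> y) ws \<one>\<^bsub>Fgrp r\<^esub> = f"
      using word_length_attained[OF word_of_bad[OF r f]] unfolding A_def by blast
    show "card (bad r f) \<le> M * word_length (Fgrp r) (Fgens r) f" using fold[OF ws(2)] ws by simp
  qed
qed

section \<open>The embedding\<close>

text \<open>A \<open>p\<close>-ary caret is replaced by a right vine of \<open>p - 1\<close> carets of arity \<open>q\<close>; \<open>code1 p q a\<close> is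
  the leaf of that vine to which the \<open>a\<close>-th child is attached.  The remaining leaves form \<open>p - 1\<close>
  gaps, one for each interior point \<open>pt p (w @ [j]) 1\<close> of \<open>\<int>[1/p]\<close>.\<close>

definition code1 :: "nat \<Rightarrow> nat \<Rightarrow> nat \<Rightarrow> nat list" where
  "code1 p q a = replicate a (q - 1) @ (if a < p - 1 then [0] else [])"

definition code :: "nat \<Rightarrow> nat \<Rightarrow> nat list \<Rightarrow> nat list" where
  "code p q w = concat (map (code1 p q) w)"

lemma code_simps [simp]:
  "code p q [] = []" "code p q (a # w) = code1 p q a @ code p q w"
    "code p q (u @ w) = code p q u @ code p q w"
  by (auto simp: code_def)

lemma code_wds: "q \<ge> 2 \<Longrightarrow> code p q w \<in> wds q"
  by (induction w) (auto simp: code1_def in_lists_conv_set)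

lemma code_replicate: "code p q (replicate k (p - 1)) = replicate ((p - 1) * k) (q - 1)"
  by (induction k) (auto simp: code1_def replicate_add)

text \<open>Leaf \<open>l\<close> of the infinite \<open>p\<close>-ary vine goes to leaf
  \<open>(q - 1) * l\<close> of the \<open>q\<close>-ary one. This is why the image of
  \<open>x_i\<close> is built at leaf \<open>(q - 1) * i\<close>.\<close>

lemma code_vleaf:
  assumes "p \<ge> 2" "q \<ge> 2" shows "code p q (vleaf p l) = replicate l (q - 1) @ [0]"
proof -
  have "l mod (p - 1) < p - 1" using assms by simp
  then have "code p q (vleaf p l)
    = replicate ((p - 1) * (l div (p - 1)) + l mod (p - 1)) (q - 1) @ [0]"
    unfolding vleaf_def code_simps code_replicate replicate_add by (simp add: code1_def)
  then show ?thesis by simp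
qed

lemma replicate_append_cancel:
  "replicate a c @ x = replicate b c @ y \<Longrightarrow> a \<le> b \<Longrightarrow> x = replicate (b - a) c @ y"
proof (induction a arbitrary: b)
  case (Suc a)
  then show ?case by (cases b) auto
qed auto

lemma code1_prefix_free:
  assumes "q \<ge> 2" "a < p" "b < p" "code1 p q a @ x = code1 p q b @ y"
  shows "a = b"
proof -
  have no: False if ab: "a < b" "b < p" "code1 p q a @ x = code1 p q b @ y" for a b x y
  proof -
    have "a < p - 1" using ab by simp
    then have "replicate a (q - 1) @ 0 # x
      = replicate b (q - 1) @ (if b < p - 1 then [0] else []) @ y"
      using ab(3) by (simp add: code1_def)
    from replicate_append_cancel[OF this] have
      "0 # x = replicate (b - a) (q - 1) @ (if b < p - 1 then [0] else []) @ y"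
      using ab(1) by simp
    moreover obtain d where "b = Suc (a + d)" using less_imp_Suc_add[OF ab(1)] by blast
    ultimately show False using assms(1) by simp
  qed
  show ?thesis using no[of a b x y] no[of b a y x] assms by (cases a b rule: linorder_cases) auto
qed

text \<open>The codes of digits form a prefix code, and none of them begins a run of fewer than
  \<open>p - 1\<close> digits \<open>q - 1\<close>: each contains a 0 or is too long. So decoding
  stops exactly before the run, and the label of a gap can be read off its address.\<close>

lemma code_run_unique:
  assumes "p \<ge> 2" "q \<ge> 2" "w \<in> wds p" "v \<in> wds p" "j < p - 1" "k < p - 1"
    "code p q w @ replicate j (q - 1) = code p q v @ replicate k (q - 1)"
  shows "w = v \<and> j = k"
proof -
  have nil: False if "replicate j (q - 1) = code1 p q b @ y" "j < p - 1" "b < p" for j b y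
  proof (cases "b < p - 1")
    case True
    then have "0 \<in> set (replicate j (q - 1))" using that(1) by (simp add: code1_def)
    then show False using assms(2) by (auto split: if_splits)
  next
    case False
    then have "length (replicate j (q - 1)) \<ge> p - 1" using that(1,3) by (simp add: code1_def)
    then show False using that(2) by simp
  qed
  show ?thesis using assms(3,4,7)
  proof (induction w arbitrary: v)
    case Nil
    show ?case
    proof (cases v)
      case (Cons b v')
      then show ?thesis using nil[of j b] Nil assms(5) by auto
    qed (use Nil in \<open>auto simp: replicate_eq_replicate\<close>)
  next
    case (Cons a w)
    show ?case
    proof (cases v)
      case Nil
      then have "replicate k (q - 1) = code1 p q a @ (code p q w @ replicate j (q - 1))"
        using Cons.prems(2) by simp
      then show ?thesis using nil[of k a] Cons.hyps assms(6) by auto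
    next
      case (Cons b v')
      have "a = b" using code1_prefix_free[OF assms(2), of a p b] Cons.hyps Cons.prems Cons by auto
      then show ?thesis using Cons.IH[of v'] Cons.prems Cons by auto
    qed
  qed
qed

definition gap :: "nat \<Rightarrow> nat \<Rightarrow> nat list \<Rightarrow> nat \<Rightarrow> real \<Rightarrow> real" where
  "gap p q w j s = pt q (code p q w @ replicate j (q - 1)) s"

text \<open>The label \<open>(v, k)\<close> of the image point is unique, so it may be quantified
  instead of chosen; \<open>PLF_preserves_right_ends\<close> supplies its existence.\<close>

definition gap_rel :: "nat \<Rightarrow> nat \<Rightarrow> (real \<Rightarrow> real) \<Rightarrow> (real \<Rightarrow> real) \<Rightarrow> bool" where
  "gap_rel p q f g \<longleftrightarrow> (\<forall>w\<in>wds p. \<forall>v\<in>wds p. \<forall>j<p - 1. \<forall>k<p - 1.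
     f (pt p (w @ [j]) 1) = pt p (v @ [k]) 1 \<longrightarrow>
     (\<forall>s\<in>{1 / real q..(real q - 1) / real q}. g (gap p q w j s) = gap p q v k s))"

lemma gap_relD:
  assumes "gap_rel p q f g" "w \<in> wds p" "v \<in> wds p" "j < p - 1" "k < p - 1"
    "f (pt p (w @ [j]) 1) = pt p (v @ [k]) 1" "s \<in> {1 / real q..(real q - 1) / real q}"
  shows "g (gap p q w j s) = gap p q v k s"
  using assms unfolding gap_rel_def by blast

lemma good_extension:
  assumes "r \<ge> 2" "f \<in> PLF r" "x \<in> wds r" "a < r"
  shows "\<exists>n. \<exists>v\<in>wds r. maps r f (x @ replicate n a) v"
proof -
  have "inj (\<lambda>n. x @ replicate n a)" by (auto intro!: injI simp: replicate_eq_replicate)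
  then have "infinite (range (\<lambda>n. x @ replicate n a))" using finite_imageD by blast
  then have "\<not> range (\<lambda>n. x @ replicate n a) \<subseteq> bad r f" using PLF_D(7)[OF assms(1,2)] finite_subset
    by blast
  then obtain n where "x @ replicate n a \<notin> bad r f" by auto
  moreover have "x @ replicate n a \<in> wds r" using assms(3,4) by (auto simp: in_lists_conv_set)
  ultimately show ?thesis unfolding bad_def by blast
qed

lemma pt_append_last: "r \<ge> 2 \<Longrightarrow> pt r (x @ replicate n (r - 1)) 1 = pt r x 1"
  using pt_replicate_1[of r n] by (simp only: pt_append)

text \<open>Appending digits \<open>r - 1\<close> keeps the right end fixed, and as only finitely
  many words are bad, some such extension is good. Its standard image has the image point as right
  end.\<close>

lemma PLF_preserves_right_ends:
  assumes "r \<ge> 2" "f \<in> PLF r" "w \<in> wds r" "j < r - 1"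
  shows "\<exists>v\<in>wds r. \<exists>k<r - 1. f (pt r (w @ [j]) 1) = pt r (v @ [k]) 1"
proof -
  have wj: "w @ [j] \<in> wds r" "w @ [Suc j] \<in> wds r" using assms by auto
  obtain n v where v: "v \<in> wds r" "maps r f ((w @ [j]) @ replicate n (r - 1)) v"
    using good_extension[OF assms(1,2) wj(1), of "r - 1"] assms(1) by auto
  have e: "f (pt r (w @ [j]) 1) = pt r v 1"
    using mapsD[OF v(2), of 1] unfolding pt_append_last[OF assms(1)] by simp
  have "pt r (w @ [j]) 1 < 1" unfolding pt_snoc_1[OF assms(1)]
    by (rule pt_less_1[OF assms(1) wj(2)]) auto
  moreover have "pt r (w @ [j]) 1 \<in> {0..1}" using pt_in[OF assms(1) wj(1), of 1] by simp
  ultimately have "f (pt r (w @ [j]) 1) < f 1"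
    using PLF_D(4)[OF assms(1,2)] strict_mono_onD[of "{0..1}" f] by auto
  then have "pt r v 1 \<noteq> 1" using PLF_D(6)[OF assms(1,2)] e by simp
  then show ?thesis using right_end_cases[OF assms(1) v(1)] e by metis
qed

lemma gap_rel_id: "p \<ge> 2 \<Longrightarrow> gap_rel p q id id"
  unfolding gap_rel_def using pt_right_end_unique[of p] by auto

lemma gap_rel_comp:
  assumes "p \<ge> 2" "f2 \<in> PLF p" "gap_rel p q f1 g1" "gap_rel p q f2 g2"
  shows "gap_rel p q (f1 \<circ> f2) (g1 \<circ> g2)"
  unfolding gap_rel_def
proof (intro ballI allI impI)
  fix w v j k s
  assume a: "w \<in> wds p" "v \<in> wds p" "j < p - 1" "k < p - 1"
    "(f1 \<circ> f2) (pt p (w @ [j]) 1) = pt p (v @ [k]) 1" "s \<in> {1 / real q..(real q - 1) / real q}"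
  obtain u i where u: "u \<in> wds p" "i < p - 1" "f2 (pt p (w @ [j]) 1) = pt p (u @ [i]) 1"
    using PLF_preserves_right_ends[OF assms(1,2) a(1,3)] by blast
  have "g2 (gap p q w j s) = gap p q u i s" using gap_relD[OF assms(4) a(1) u(1) a(3) u(2,3) a(6)] .
  moreover have "f1 (pt p (u @ [i]) 1) = pt p (v @ [k]) 1" using a(5) u(3) by simp
  then have "g1 (gap p q u i s) = gap p q v k s"
    using gap_relD[OF assms(3) u(1) a(2) u(2) a(4) _ a(6)] by blast
  ultimately show "(g1 \<circ> g2) (gap p q w j s) = gap p q v k s" by simp
qed

lemma gap_rel_inverse:
  assumes "gap_rel p q f g" "f \<circ> f' = id" "g' \<circ> g = id"
  shows "gap_rel p q f' g'"
  unfolding gap_rel_def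
proof (intro ballI allI impI)
  fix w v j k s
  assume a: "w \<in> wds p" "v \<in> wds p" "j < p - 1" "k < p - 1"
    "f' (pt p (w @ [j]) 1) = pt p (v @ [k]) 1" "s \<in> {1 / real q..(real q - 1) / real q}"
  have "f (pt p (v @ [k]) 1) = pt p (w @ [j]) 1"
    using a(5) fun_cong[OF assms(2), of "pt p (w @ [j]) 1"] by simp
  then have "g (gap p q v k s) = gap p q w j s" using gap_relD[OF assms(1) a(2,1,4,3) _ a(6)]
    by blast
  then show "g' (gap p q w j s) = gap p q v k s" using fun_cong[OF assms(3), of "gap p q v k s"]
    by simp
qed

text \<open>Attaches a right vine of \<open>k\<close> carets at leaf \<open>b\<close>, one caret per
  letter. For \<open>b = (q - 1) * i\<close> and \<open>k = p - 1\<close> over arity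
  \<open>q\<close> it is the image of the generator \<open>x_i\<close> of F(p).\<close>

definition comb :: "nat \<Rightarrow> nat \<Rightarrow> nat \<Rightarrow> real \<Rightarrow> real" where
  "comb r b k = gprod r (map (\<lambda>m. b + (r - 1) * m) [0..<k])"

lemma comb_0 [simp]: "comb r b 0 = id"
  by (simp add: comb_def)

lemma comb_Suc: "comb r b (Suc k) = comb r b k \<circ> gen r (b + (r - 1) * k)"
  by (simp add: comb_def gprod_append)

lemma comb_PLF: "r \<ge> 2 \<Longrightarrow> comb r b k \<in> PLF r"
  unfolding comb_def by (rule gprod_PLF)

lemma comb_fix: "r \<ge> 2 \<Longrightarrow> l < b \<Longrightarrow> maps r (comb r b k) (vleaf r l) (vleaf r l)"
proof (induction k)
  case (Suc k)
  then show ?case unfolding comb_Suc by (intro maps_comp[OF Suc.IH gen_maps(1)]) auto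
qed auto

lemma comb_shift: "r \<ge> 2 \<Longrightarrow> l > b \<Longrightarrow> maps r (comb r b k) (vleaf r (l + (r - 1) * k)) (vleaf r l)"
proof (induction k)
  case (Suc k)
  have e: "l + (r - 1) * Suc k = (l + (r - 1) * k) + (r - 1)" by simp
  show ?case unfolding comb_Suc e using Suc.prems by (intro maps_comp[OF Suc.IH gen_maps(3)]) auto
qed auto

lemma comb_expand:
  assumes "r \<ge> 2"
  shows "(\<forall>a<(r - 1) * k. maps r (comb r b k) (vleaf r (b + a)) (vleaf r b @ vleaf r a))
    \<and> maps r (comb r b k) (vleaf r (b + (r - 1) * k)) (vleaf r b @ replicate k (r - 1))"
proof (induction k)
  case (Suc k)
  have old: "maps r (comb r b (Suc k)) (vleaf r (b + a)) (vleaf r b @ vleaf r a)" if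
    "a < (r - 1) * k" for a
    unfolding comb_Suc
  proof (rule maps_comp)
    show "maps r (gen r (b + (r - 1) * k)) (vleaf r (b + a)) (vleaf r (b + a))"
      using that gen_maps(1)[OF assms] by simp
    show "maps r (comb r b k) (vleaf r (b + a)) (vleaf r b @ vleaf r a)" using Suc that by blast
  qed
  have new:
    "maps r (comb r b (Suc k)) (vleaf r (b + (r - 1) * k + m)) ((vleaf r b @ replicate k (r - 1)) @ [m])" if "m < r" for m
    unfolding comb_Suc
  proof (rule maps_comp)
    show "maps r (gen r (b + (r - 1) * k)) (vleaf r (b + (r - 1) * k + m)) (vleaf r (b + (r - 1) * k) @ [m])"
      using gen_maps(2)[OF assms that] .
    show "maps r (comb r b k) (vleaf r (b + (r - 1) * k) @ [m]) ((vleaf r b @ replicate k (r - 1)) @ [m])"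
      by (rule maps_append[OF assms]) (use that Suc in auto)
  qed
  have "maps r (comb r b (Suc k)) (vleaf r (b + a)) (vleaf r b @ vleaf r a)" if a:
    "a < (r - 1) * Suc k" for a
  proof (cases "a < (r - 1) * k")
    case False
    define m where "m = a - (r - 1) * k"
    have m: "a = (r - 1) * k + m" "m < r - 1" using False a by (auto simp: m_def)
    have va: "vleaf r a = replicate k (r - 1) @ [m]" unfolding m(1) using vleaf_eq[OF m(2)] .
    have ba: "b + a = b + (r - 1) * k + m" using m(1) by simp
    have "m < r" using m(2) by simp
    then show ?thesis unfolding va ba append_assoc[symmetric] by (rule new)
  qed (use old in blast)
  moreover have
    "maps r (comb r b (Suc k)) (vleaf r (b + (r - 1) * Suc k)) (vleaf r b @ replicate (Suc k) (r - 1))"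
  proof -
    have "b + (r - 1) * Suc k = b + (r - 1) * k + (r - 1)" by simp
    then show ?thesis using new[of "r - 1"] assms
      by (simp only: append_assoc replicate_append_same) simp
  qed
  ultimately show ?case by blast
qed (auto simp: maps_def)

section \<open>Images of the generators\<close>

context
  fixes p q i :: nat
  assumes p: "p \<ge> 2" and q: "q \<ge> 2"
begin

private abbreviation "b \<equiv> (q - 1) * i"
private abbreviation "Y \<equiv> comb q b (p - 1)"

lemma vleaf_q: "vleaf q ((q - 1) * l) = replicate l (q - 1) @ [0]"
  using vleaf_eq[of 0 q l] q by simp

text \<open>On intervals that carry codes the comb imitates \<open>x_i\<close>: multiplication by
  \<open>q - 1\<close> takes the three ranges of \<open>p\<close>-ary vine leaves to those of the
  comb.\<close>

lemma gen_comb_live: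
  "\<exists>v\<in>wds p. maps p (gen p i) (vleaf p l) v \<and> maps q Y (code p q (vleaf p l)) (code p q v)"
proof -
  have c: "code p q (vleaf p l) = vleaf q ((q - 1) * l)" for l using code_vleaf[OF p q] vleaf_q
    by simp
  show ?thesis
  proof (rule leaf_cases[OF p, of l i])
    assume l: "l < i"
    then have "(q - 1) * l < b" using q by simp
    then show ?thesis using gen_maps(1)[OF p l] comb_fix[OF q] c vleaf_wds[OF p]
      by (intro bexI[of _ "vleaf p l"]) auto
  next
    fix m assume m: "l = i + m" "m < p"
    have e: "(q - 1) * l = b + (q - 1) * m" using m by (simp add: distrib_left)
    have "maps q Y (vleaf q (b + (q - 1) * m)) (vleaf q b @ code1 p q m)"
    proof (cases "m < p - 1")
      case True
      then have "(q - 1) * m < (q - 1) * (p - 1)" using q by simp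
      then have "maps q Y (vleaf q (b + (q - 1) * m)) (vleaf q b @ vleaf q ((q - 1) * m))"
        using comb_expand[OF q, of "p - 1" b] by blast
      then show ?thesis unfolding vleaf_q[of m] code1_def using True by simp
    next
      case False
      then have "m = p - 1" using m by simp
      then show ?thesis using comb_expand[OF q, of "p - 1" b] by (simp add: code1_def)
    qed
    then have "maps q Y (code p q (vleaf p l)) (code p q (vleaf p i @ [m]))"
      unfolding code_simps c e append_Nil2 .
    moreover have "maps p (gen p i) (vleaf p l) (vleaf p i @ [m])" unfolding m(1)
      using gen_maps(2)[OF p m(2)] .
    moreover have "vleaf p i @ [m] \<in> wds p" using vleaf_wds[OF p, of i] m by auto
    ultimately show ?thesis by blast
  next
    fix l' assume l': "l = l' + (p - 1)" "l' > i"
    have e: "(q - 1) * l = (q - 1) * l' + (q - 1) * (p - 1)" using l'(1)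
      by (simp only: distrib_left)
    have "(q - 1) * l' > b" using l'(2) q by simp
    then have "maps q Y (code p q (vleaf p l)) (code p q (vleaf p l'))" unfolding c e
      using comb_shift[OF q] by blast
    moreover have "maps p (gen p i) (vleaf p l) (vleaf p l')" unfolding l'(1)
      using gen_maps(3)[OF p l'(2)] .
    ultimately show ?thesis using vleaf_wds[OF p] by blast
  qed
qed

text \<open>Only the right end of child 0 is compared, because child 0 itself need not go onto child
  0. For \<open>q = 2\<close> that point is the whole segment.\<close>

lemma gap_segment:
  assumes "\<And>m. 1 \<le> m \<Longrightarrow> m < q - 1 \<Longrightarrow> maps q g (z @ [m]) (z' @ [m])"
    "g (pt q (z @ [0]) 1) = pt q (z' @ [0]) 1"
    "s \<in> {1 / real q..(real q - 1) / real q}"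
  shows "g (pt q z s) = pt q z' s"
proof -
  have qp: "real q > 0" using q by simp
  have s1: "1 \<le> s * real q" "s * real q \<le> real q - 1" using assms(3) qp by (auto simp: field_simps)
  have "s \<in> {0..1}"
  proof -
    have "0 \<le> 1 / real q" "(real q - 1) / real q \<le> 1" using qp by auto
    then show ?thesis using assms(3) by (meson atLeastAtMost_iff order_trans)
  qed
  then obtain m t where m: "m < q" "t \<in> {0..1}" "s = (real m + t) / real q"
    using leading_digit[OF q] by blast
  have mt: "1 \<le> real m + t" "real m + t \<le> real q - 1" using s1 m(3) qp by auto
  have e0: ?thesis if "s = 1 / real q" using assms(2) that by (simp add: pt_append)
  have e: ?thesis if "1 \<le> m" "m < q - 1" "t \<in> {0..1}" "s = (real m + t) / real q" for m t
    using assms(1)[OF that(1,2)] that(3,4) by (auto simp: maps_def pt_append)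
  consider "m = 0" | "1 \<le> m" "m < q - 1" | "m = q - 1" using m(1) by linarith
  then show ?thesis
  proof cases
    case 1
    then have "t = 1" using mt m(2) by simp
    then show ?thesis using e0 m(3) 1 by simp
  next
    case 2
    then show ?thesis using e m by blast
  next
    case 3
    then have "real m = real q - 1" using q by (simp add: of_nat_diff)
    then have s: "s = (real q - 1) / real q" using mt m(2,3) by simp
    show ?thesis
    proof (cases "q = 2")
      case True
      then have "s = 1 / real q" using s by simp
      then show ?thesis by (rule e0)
    next
      case False
      then have "1 \<le> q - 2" "q - 2 < q - 1" "s = (real (q - 2) + 1) / real q" using q s
        by (auto simp: of_nat_diff)
      then show ?thesis using e[of "q - 2" 1] by simp
    qed
  qed
qed

text \<open>Node \<open>l\<close> of the \<open>q\<close>-ary vine carries the gap at the right end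
  of leaf \<open>l\<close> of the \<open>p\<close>-ary vine. Compared with \<open>leaf_cases\<close>
  the last range starts one earlier: the last child of leaf \<open>i\<close> ends where leaf
  \<open>i\<close> ends, so its gap counts as shifted.\<close>

lemma gen_comb_gap:
  assumes j: "j < p - 1" and s: "s \<in> {1 / real q..(real q - 1) / real q}"
  shows "\<exists>v\<in>wds p. \<exists>m<p - 1. gen p i (pt p (replicate k (p - 1) @ [j]) 1) = pt p (v @ [m]) 1
    \<and> Y (gap p q (replicate k (p - 1)) j s) = gap p q v m s"
proof -
  define l where "l = (p - 1) * k + j"
  have vl: "replicate k (p - 1) @ [j] = vleaf p l" using vleaf_eq[OF j] by (simp add: l_def)
  have gp: "gap p q (replicate k (p - 1)) j s = pt q (replicate l (q - 1)) s"
    unfolding gap_def code_replicate l_def replicate_add ..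
  have rv: "replicate l (q - 1) @ [m] = vleaf q ((q - 1) * l + m)" if "m < q - 1" for l m
    using vleaf_eq[OF that] by simp
  consider "l < i" | "i \<le> l" "l < i + (p - 1)" | "i + (p - 1) \<le> l" by linarith
  then show ?thesis
  proof cases
    case 1
    have mm: "maps q Y (replicate l (q - 1) @ [m]) (replicate l (q - 1) @ [m])" if m:
      "m < q - 1" for m
    proof -
      have "(q - 1) * l + m < (q - 1) * Suc l" using m by simp
      also have "\<dots> \<le> b" using 1 by (intro mult_le_mono) auto
      finally show ?thesis unfolding rv[OF m] using comb_fix[OF q] by blast
    qed
    have "Y (pt q (replicate l (q - 1)) s) = pt q (replicate l (q - 1)) s"
      using mm mapsD[OF mm[of 0], of 1] q by (intro gap_segment[OF _ _ s]) auto
    moreover have "gen p i (pt p (vleaf p l) 1) = pt p (vleaf p l) 1"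
      using mapsD[OF gen_maps(1)[OF p 1], of 1] by simp
    ultimately show ?thesis using j gp vl p
      by (intro bexI[of _ "replicate k (p - 1)"] exI[of _ j]) (auto simp: in_lists_conv_set)
  next
    case 2
    define d where "d = l - i"
    have d: "l = i + d" "d < p - 1" using 2 by (auto simp: d_def)
    have mm: "maps q Y (replicate l (q - 1) @ [m]) ((vleaf q b @ replicate d (q - 1)) @ [m])" if m:
      "m < q - 1" for m
    proof -
      have "(q - 1) * d + m < (q - 1) * Suc d" using m by simp
      also have "\<dots> \<le> (q - 1) * (p - 1)" using d by (intro mult_le_mono) auto
      finally have
        "maps q Y (vleaf q (b + ((q - 1) * d + m))) (vleaf q b @ vleaf q ((q - 1) * d + m))"
        using comb_expand[OF q, of "p - 1" b] by blast
      moreover have idx: "(q - 1) * l + m = b + ((q - 1) * d + m)" by (simp add: d(1) distrib_left)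
      ultimately show ?thesis unfolding rv[OF m] append_assoc by (simp only: idx)
    qed
    have "Y (pt q (replicate l (q - 1)) s) = pt q (vleaf q b @ replicate d (q - 1)) s"
      using mm mapsD[OF mm[of 0], of 1] q by (intro gap_segment[OF _ _ s]) auto
    then have "Y (gap p q (replicate k (p - 1)) j s) = gap p q (vleaf p i) d s"
      unfolding gp gap_def[of p q "vleaf p i"] code_vleaf[OF p q] vleaf_q[of i] .
    moreover have "d < p" using d by simp
    then have "gen p i (pt p (vleaf p l) 1) = pt p (vleaf p i @ [d]) 1"
      using mapsD[OF gen_maps(2)[OF p, of d i], of 1] d(1) by simp
    ultimately show ?thesis unfolding vl using d(2) vleaf_wds[OF p] by blast
  next
    case 3
    define l' where "l' = l - (p - 1)"
    have l': "l = l' + (p - 1)" "l' \<ge> i" using 3 by (auto simp: l'_def)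
    have el: "(q - 1) * l + m = (q - 1) * l' + m + (q - 1) * (p - 1)" for m using l'(1)
      by (simp add: distrib_left)
    have mm: "maps q Y (replicate l (q - 1) @ [m]) (replicate l' (q - 1) @ [m])" if m: "m < q - 1"
      "m \<ge> 1 \<or> l' > i" for m
    proof -
      have "(q - 1) * l' + m > b"
      proof (cases "l' > i")
        case True
        then have "(q - 1) * l' > b" using q by simp
        then show ?thesis by (rule trans_less_add1)
      qed (use m l'(2) in auto)
      then show ?thesis unfolding rv[OF m(1)] el using comb_shift[OF q] by blast
    qed
    have m0: "Y (pt q (replicate l (q - 1) @ [0]) 1) = pt q (replicate l' (q - 1) @ [0]) 1"
    proof (cases "l' > i")
      case True
      then show ?thesis using mapsD[OF mm[of 0], of 1] q by simp
    next
      \<comment> \<open>On this boundary child 0 of node \<open>l\<close> goes to the last leaf of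
        the attached vine, not onto child 0 of node \<open>i\<close>; but the two targets have the
        same right end.\<close>
      case False
      then have li: "l' = i" using l'(2) by simp
      have "replicate l (q - 1) @ [0] = vleaf q (b + (q - 1) * (p - 1))"
        using el[of 0] vleaf_q[of l] li by simp
      then have "Y (pt q (replicate l (q - 1) @ [0]) 1)
        = pt q (vleaf q b @ replicate (p - 1) (q - 1)) 1"
        using mapsD[OF conjunct2[OF comb_expand[OF q, of "p - 1" b]], of 1] by simp
      then show ?thesis unfolding pt_append_last[OF q] vleaf_q[of i] li .
    qed
    define v where "v = replicate (l' div (p - 1)) (p - 1)"
    define m where "m = l' mod (p - 1)"
    have vm: "vleaf p l' = v @ [m]" by (simp add: vleaf_def v_def m_def)
    have mp: "m < p - 1" using p by (simp add: m_def)
    have "Y (pt q (replicate l (q - 1)) s) = pt q (replicate l' (q - 1)) s"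
      using mm m0 by (intro gap_segment[OF _ _ s]) auto
    moreover have "replicate l' (q - 1) = code p q v @ replicate m (q - 1)"
    proof -
      have "l' = (p - 1) * (l' div (p - 1)) + m" by (simp add: m_def)
      then show ?thesis unfolding v_def code_replicate by (metis replicate_add)
    qed
    ultimately have "Y (gap p q (replicate k (p - 1)) j s) = gap p q v m s" unfolding gp
      by (simp add: gap_def)
    moreover have "gen p i (pt p (vleaf p l) 1) = pt p (vleaf p l') 1"
    proof (cases "l' > i")
      case True
      then show ?thesis using mapsD[OF gen_maps(3)[OF p True], of 1] l'(1) by simp
    next
      case False
      then have "l = i + (p - 1)" "l' = i" using l' by auto
      then show ?thesis using mapsD[OF gen_maps(2)[OF p, of
        "p - 1" i], of 1] pt_append_last[OF p, of "vleaf p i" 1] p by simp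
    qed
    moreover have "v \<in> wds p" using p by (auto simp: v_def in_lists_conv_set)
    ultimately show ?thesis unfolding vl using mp vm by auto
  qed
qed

lemma vine_word_cases:
  assumes "w \<in> wds p"
  shows "(\<exists>k. w = replicate k (p - 1)) \<or> (\<exists>l x. x \<in> wds p \<and> w = vleaf p l @ x)"
  using assms
proof (induction w)
  case (Cons a w)
  then have a: "a < p" "w \<in> wds p" by auto
  show ?case
  proof (cases "a < p - 1")
    case True
    then show ?thesis using a vleaf_less[OF True] by (intro disjI2 exI[of _ a] exI[of _ w]) auto
  next
    case False
    then have "a = p - 1" using a by simp
    from Cons.IH show ?thesis
    proof (elim disjE exE conjE)
      fix k assume "w = replicate k (p - 1)"
      then have "a # w = replicate (Suc k) (p - 1)" using \<open>a = p - 1\<close> by simp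
      then show ?thesis by blast
    next
      fix l x assume "x \<in> wds p" "w = vleaf p l @ x"
      then have "a # w = vleaf p (l + (p - 1)) @ x" unfolding vleaf_add[OF p] using \<open>a = p - 1\<close>
        by simp
      then show ?thesis using \<open>x \<in> wds p\<close> by blast
    qed
  qed
qed (metis replicate_0)

text \<open>Gaps below a vine leaf move along with it, since the comb is affine there; only the gaps
  on the ray of the vine need \<open>gen_comb_gap\<close>.\<close>

lemma gap_rel_gen: "gap_rel p q (gen p i) Y"
  unfolding gap_rel_def
proof (intro ballI allI impI)
  fix w v j k s
  assume a: "w \<in> wds p" "v \<in> wds p" "j < p - 1" "k < p - 1"
    "gen p i (pt p (w @ [j]) 1) = pt p (v @ [k]) 1" "s \<in> {1 / real q..(real q - 1) / real q}"
  have "\<exists>u\<in>wds p. \<exists>m<p - 1. gen p i (pt p (w @ [j]) 1) = pt p (u @ [m]) 1 \<and> Y (gap p q w j s)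
    = gap p q u m s"
    using vine_word_cases[OF a(1)]
  proof (elim disjE exE conjE)
    fix n assume "w = replicate n (p - 1)"
    then show ?thesis using gen_comb_gap[OF a(3,6)] by simp
  next
    fix l x assume x: "x \<in> wds p" and w: "w = vleaf p l @ x"
    obtain u where u: "u \<in> wds p" "maps p (gen p i) (vleaf p l) u"
      "maps q Y (code p q (vleaf p l)) (code p q u)"
      using gen_comb_live by blast
    have "x @ [j] \<in> wds p" using x a(3) by auto
    from mapsD[OF maps_append[OF p this u(2)], of 1]
    have "gen p i (pt p (w @ [j]) 1) = pt p ((u @ x) @ [j]) 1" by (simp add: w)
    moreover have "code p q x @ replicate j (q - 1) \<in> wds q" using code_wds[OF q, of p x] q
      by (auto simp: in_lists_conv_set)
    from maps_append[OF q this u(3)]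
    have mp: "maps q Y (code p q w @ replicate j (q - 1)) (code p q (u @ x) @ replicate j (q - 1))"
      by (simp add: w)
    have "0 \<le> s" "s \<le> 1"
    proof -
      have "0 \<le> 1 / real q" "(real q - 1) / real q \<le> 1" using q by auto
      then show "0 \<le> s" "s \<le> 1" using a(6) unfolding atLeastAtMost_iff by linarith+
    qed
    from mapsD[OF mp this] have "Y (gap p q w j s) = gap p q (u @ x) j s" by (simp add: gap_def)
    moreover have "u @ x \<in> wds p" using u x by auto
    ultimately show ?thesis using a(3) by blast
  qed
  then obtain u m where u: "u \<in> wds p" "m < p - 1" "gen p i (pt p (w @ [j]) 1) = pt p (u @ [m]) 1"
    "Y (gap p q w j s) = gap p q u m s"
    by blast
  have "u = v \<and> m = k" by (rule pt_right_end_unique[OF p u(1) a(2) u(2) a(4) trans[OF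
    u(3)[symmetric] a(5)]])
  then show "Y (gap p q w j s) = gap p q v k s" using u(4) by simp
qed

end

section \<open>Existence and uniqueness of the image\<close>

lemma gap_rel_exists:
  assumes p: "p \<ge> 2" and q: "q \<ge> 2" and f: "f \<in> PLF p"
  shows "\<exists>g\<in>PLF q. gap_rel p q f g"
proof -
  interpret P: group "Fgrp p" using group_Fgrp[OF p] .
  interpret Q: group "Fgrp q" using group_Fgrp[OF q] .
  have gen: "\<exists>g\<in>PLF q. gap_rel p q x g" if "x \<in> Fgens p" for x
    using that gap_rel_gen[OF p q] comb_PLF[OF q] unfolding Fgens_eq[OF p] by blast
  have inv: "\<exists>g\<in>PLF q. gap_rel p q (inv\<^bsub>Fgrp p\<^esub> x) g" if x: "x \<in> Fgens p" for x
  proof -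
    obtain g where g: "g \<in> PLF q" "gap_rel p q x g" using gen[OF x] by blast
    have "x \<circ> inv\<^bsub>Fgrp p\<^esub> x = id" using P.r_inv[of x] x Fgens_carrier[OF p] by auto
    moreover have "inv\<^bsub>Fgrp q\<^esub> g \<circ> g = id" "inv\<^bsub>Fgrp q\<^esub> g \<in> PLF q"
      using Q.l_inv[of g] Q.inv_closed[of g] g(1) by auto
    ultimately show ?thesis using gap_rel_inverse[OF g(2)] by blast
  qed
  have letters: "\<exists>g\<in>PLF q. gap_rel p q x g" if "x \<in> Fgens p \<union> m_inv (Fgrp p) ` Fgens p" for x
    using that gen inv by blast
  obtain ws where ws: "set ws \<subseteq> Fgens p \<union> m_inv (Fgrp p) ` Fgens p"
    "foldr (\<lambda>x y. x \<otimes>\<^bsub>Fgrp p\<^esub> y) ws \<one>\<^bsub>Fgrp p\<^esub> = f"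
    using word_of_bad[OF p f] unfolding word_of_def by blast
  have "\<exists>h. foldr (\<lambda>x y. x \<otimes>\<^bsub>Fgrp p\<^esub> y) ws \<one>\<^bsub>Fgrp p\<^esub> = h \<and> h \<in> PLF p \<and> (\<exists>g\<in>PLF q. gap_rel p q h g)"
    using ws(1)
  proof (induction ws)
    case Nil
    have "foldr (\<lambda>x y. x \<otimes>\<^bsub>Fgrp p\<^esub> y) [] \<one>\<^bsub>Fgrp p\<^esub> = id" by (simp add: fun_eq_iff)
    then show ?case using PLF_id[OF p] PLF_id[OF q] gap_rel_id[OF p] by blast
  next
    case (Cons x ws)
    have "set ws \<subseteq> Fgens p \<union> m_inv (Fgrp p) ` Fgens p" using Cons.prems by simp
    from Cons.IH[OF this] obtain h g where h: "foldr (\<lambda>x y. x \<otimes>\<^bsub>Fgrp p\<^esub> y) ws \<one>\<^bsub>Fgrp p\<^esub> = h"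
      "h \<in> PLF p"
      and g: "g \<in> PLF q" "gap_rel p q h g" by blast
    have xS: "x \<in> Fgens p \<union> m_inv (Fgrp p) ` Fgens p" using Cons.prems by simp
    have x: "x \<in> PLF p" using subsetD[OF P.letters_carrier xS] Fgens_carrier[OF p] by simp
    obtain g' where g': "g' \<in> PLF q" "gap_rel p q x g'" using letters[OF xS] by blast
    have "foldr (\<lambda>x y. x \<otimes>\<^bsub>Fgrp p\<^esub> y) (x # ws) \<one>\<^bsub>Fgrp p\<^esub> = x \<circ> h"
      using h(1) by (simp add: fun_eq_iff)
    then show ?case using PLF_comp[OF p x h(2)] PLF_comp[OF q g'(1) g(1)] gap_rel_comp[OF p h(2)
      g'(2) g(2)] by blast
  qed
  then show ?thesis using ws(2) by blast
qed

lemma length_code1_pos: "p \<ge> 2 \<Longrightarrow> a < p \<Longrightarrow> length (code1 p q a) \<ge> 1"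
  by (auto simp: code1_def)

text \<open>Self-similarity: the vine for one \<open>p\<close>-ary caret divides the unit interval
  into gap leaves, where \<open>x\<close> is met exactly, and the intervals
  \<open>code1 p q a\<close>, where the induction hypothesis applies to a copy of scale at most
  1/q.\<close>

lemma gap_dense:
  assumes p: "p \<ge> 2" and q: "q \<ge> 2" and "x \<in> {0..1}"
  shows "\<exists>w\<in>wds p. \<exists>j<p - 1. \<exists>s\<in>{1 / real q..(real q - 1) / real q}. \<bar>x - gap p q w j s\<bar> \<le> (1 / real q) ^ n"
  using assms(3)
proof (induction n arbitrary: x)
  case 0
  have "1 / real q \<in> {1 / real q..(real q - 1) / real q}" using q by (simp add: divide_right_mono)
  moreover have "\<bar>x - gap p q [] 0 (1 / real q)\<bar> \<le> 1"
  proof -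
    have "0 \<le> 1 / real q" "1 / real q \<le> 1" using q by auto
    moreover have g: "gap p q [] 0 (1 / real q) = 1 / real q" by (simp add: gap_def)
    ultimately show ?thesis unfolding g using 0 unfolding atLeastAtMost_iff
      by (intro abs_leI) linarith+
  qed
  ultimately show ?case using p by (intro bexI[of _ "[]"] exI[of _ 0] conjI bexI[of _
    "1 / real q"]) auto
next
  case (Suc n)
  obtain C where C: "tree q (vine q (p - 1)) C" using vine_tree[OF q] by blast
  obtain u t where u: "u \<in> set (vine q (p - 1))" "t \<in> {0..1}" "x = pt q u t"
    using tree_covers_points[OF q C Suc.prems] by blast
  have live: ?case if a: "a < p" "u = code1 p q a" for a
  proof -
    obtain w j s where w: "w \<in> wds p" "j < p - 1" "s \<in> {1 / real q..(real q - 1) / real q}"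
      "\<bar>t - gap p q w j s\<bar> \<le> (1 / real q) ^ n" using Suc.IH[OF u(2)] by blast
    have g: "gap p q (a # w) j s = pt q u (gap p q w j s)" by (simp add: gap_def a(2) pt_append)
    have "\<bar>x - gap p q (a # w) j s\<bar> = \<bar>t - gap p q w j s\<bar> / real q ^ length u"
      unfolding g u(3) pt_diff by simp
    also have "\<dots> \<le> (1 / real q) ^ n / real q ^ length u" using w(4)
      by (intro divide_right_mono) auto
    also have "\<dots> \<le> (1 / real q) ^ n / real q ^ 1"
      using q length_code1_pos[OF p a(1), of q] a(2)
        by (intro divide_left_mono power_increasing) auto
    finally have "\<bar>x - gap p q (a # w) j s\<bar> \<le> (1 / real q) ^ Suc n" by (simp add: field_simps)
    moreover have "a # w \<in> wds p" using w a by auto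
    ultimately show ?thesis using w(2,3) by blast
  qed
  consider "u = replicate (p - 1) (q - 1)" | l where "l < (q - 1) * (p - 1)" "u = vleaf q l"
    using u(1) unfolding vine_def by auto
  then show ?case
  proof cases
    case 1
    then show ?thesis using live[of "p - 1"] p by (simp add: code1_def)
  next
    case (2 l)
    define k where "k = l div (q - 1)"
    define m where "m = l mod (q - 1)"
    have k: "k < p - 1" using 2(1) by (simp add: k_def less_mult_imp_div_less mult.commute)
    have m: "m < q - 1" using q by (simp add: m_def)
    have uk: "u = replicate k (q - 1) @ [m]" using 2(2) by (simp add: vleaf_def k_def m_def)
    show ?thesis
    proof (cases "m = 0")
      case True
      then show ?thesis using live[of k] k uk by (simp add: code1_def)
    next
      case False
      define s where "s = (real m + t) / real q"
      have "1 \<le> real m + t" "real m + t \<le> real q - 1" using False m u(2) by auto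
      then have "s \<in> {1 / real q..(real q - 1) / real q}" unfolding s_def
        by (auto intro: divide_right_mono)
      moreover have "x = gap p q [] k s" using u(3) uk by (simp add: gap_def s_def pt_append)
      ultimately show ?thesis using k by (intro bexI[of _ "[]"] exI[of _ k] conjI bexI[of _ s]) auto
    qed
  qed
qed

lemma gap_rel_unique:
  assumes p: "p \<ge> 2" and q: "q \<ge> 2" and f: "f \<in> PLF p" and g: "g \<in> PLF q" and h: "h \<in> PLF q"
    and "gap_rel p q f g" "gap_rel p q f h"
  shows "g = h"
proof
  fix x
  show "g x = h x"
  proof (cases "x \<in> {0..1}")
    case True
    define S where "S = {y \<in> {0..1}. g y - h y = 0}"
    have "continuous_on {0..1} (\<lambda>y. g y - h y)" using PLF_D(3)[OF q g] PLF_D(3)[OF q h]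
      by (intro continuous_intros)
    then have "closed S" unfolding S_def by (intro continuous_closed_preimage_constant) auto
    moreover have "x \<in> closure S"
      unfolding closure_approachable
    proof (intro allI impI)
      fix e :: real assume "e > 0"
      moreover have "1 / real q < 1" using q by simp
      ultimately obtain n where n: "(1 / real q) ^ n < e" using real_arch_pow_inv by blast
      obtain w j s where w: "w \<in> wds p" "j < p - 1" "s \<in> {1 / real q..(real q - 1) / real q}"
        "\<bar>x - gap p q w j s\<bar> \<le> (1 / real q) ^ n" using gap_dense[OF p q True] by blast
      obtain v k where v: "v \<in> wds p" "k < p - 1" "f (pt p (w @ [j]) 1) = pt p (v @ [k]) 1"
        using PLF_preserves_right_ends[OF p f w(1,2)] by blast
      have "g (gap p q w j s) = h (gap p q w j s)"
        using gap_relD[OF assms(6) w(1) v(1) w(2) v(2,3) w(3)] gap_relD[OF assms(7) w(1) v(1) w(2)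
          v(2,3) w(3)] by simp
      moreover have "gap p q w j s \<in> {0..1}"
      proof -
        have "0 \<le> 1 / real q" "(real q - 1) / real q \<le> 1" using q by auto
        then have "s \<in> {0..1}" using w(3) by (meson atLeastAtMost_iff order_trans)
        moreover have "code p q w @ replicate j (q - 1) \<in> wds q" using code_wds[OF q, of p w] q
          by (auto simp: in_lists_conv_set)
        ultimately show ?thesis unfolding gap_def using pt_in[OF q] by blast
      qed
      ultimately have "gap p q w j s \<in> S" by (simp add: S_def)
      moreover have "dist (gap p q w j s) x < e" using w(4) n
        by (simp add: dist_real_def abs_minus_commute)
      ultimately show "\<exists>y\<in>S. dist y x < e" by blast
    qed
    ultimately have "x \<in> S" by (simp add: closure_closed)
    then show ?thesis by (simp add: S_def)
  next
    case False
    then show ?thesis using PLF_D(1)[OF q g] PLF_D(1)[OF q h] by simp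
  qed
qed

section \<open>The lower bound on distances\<close>

lemma right_ends_dense:
  assumes r: "r \<ge> 2" and "x \<in> {0..1}"
  shows "\<exists>w\<in>wds r. \<exists>j<r - 1. \<bar>x - pt r (w @ [j]) 1\<bar> \<le> (1 / real r) ^ n"
  using assms(2)
proof (induction n arbitrary: x)
  case 0
  have "pt r [0] 1 \<in> {0..1}" using pt_in[OF r, of "[0]" 1] r by auto
  then have "\<bar>x - pt r ([] @ [0]) 1\<bar> \<le> 1" using 0 by (auto simp: abs_le_iff simp del: pt.simps)
  then show ?case using r by (intro bexI[of _ "[]"] exI[of _ 0]) auto
next
  case (Suc n)
  obtain a t where a: "a < r" "t \<in> {0..1}" "x = (real a + t) / real r"
    using leading_digit[OF r Suc.prems] by blast
  obtain w j where w: "w \<in> wds r" "j < r - 1" "\<bar>t - pt r (w @ [j]) 1\<bar> \<le> (1 / real r) ^ n"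
    using Suc.IH[OF a(2)] by blast
  have "x - pt r ((a # w) @ [j]) 1 = (t - pt r (w @ [j]) 1) / real r"
    by (simp add: a(3) diff_divide_distrib add_divide_distrib)
  then have "\<bar>x - pt r ((a # w) @ [j]) 1\<bar> = \<bar>t - pt r (w @ [j]) 1\<bar> / real r" by simp
  also have "\<dots> \<le> (1 / real r) ^ n / real r" using w(3) by (intro divide_right_mono) auto
  finally have "\<bar>x - pt r ((a # w) @ [j]) 1\<bar> \<le> (1 / real r) ^ Suc n" by (simp add: field_simps)
  then show ?case using w a(1) by (intro bexI[of _ "a # w"] exI[of _ j]) auto
qed

text \<open>The gap relation gives information on \<open>f\<close> only at right ends; these are
  dense, and continuity does the rest.\<close>

lemma maps_if_right_ends:
  assumes r: "r \<ge> 2" and f: "f \<in> PLF r" and u: "u \<in> wds r" and v: "v \<in> wds r"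
    and e: "\<And>w j. w \<in> wds r \<Longrightarrow> j < r - 1 \<Longrightarrow> f (pt r u (pt r (w @ [j]) 1)) = pt r v (pt r (w @ [j]) 1)"
  shows "maps r f u v"
  unfolding maps_def
proof
  fix x :: real assume x: "x \<in> {0..1}"
  define S where "S = {y \<in> {0..1}. f (pt r u y) - pt r v y = 0}"
  have cp: "continuous_on {0..1} (pt r w)" for w
  proof -
    have "continuous_on {0..1} (\<lambda>t. pt r w 0 + t / real r ^ length w)" using r
      by (intro continuous_intros) auto
    then show ?thesis unfolding pt_affine[symmetric] .
  qed
  have "continuous_on {0..1} (\<lambda>y. f (pt r u y))"
    by (rule continuous_on_compose2[OF PLF_D(3)[OF r f] cp]) (use pt_in[OF r u] in blast)
  then have "continuous_on {0..1} (\<lambda>y. f (pt r u y) - pt r v y)" using cp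
    by (intro continuous_intros)
  then have "closed S" unfolding S_def by (intro continuous_closed_preimage_constant) auto
  moreover have "x \<in> closure S"
    unfolding closure_approachable
  proof (intro allI impI)
    fix d :: real assume "d > 0"
    moreover have "1 / real r < 1" using r by simp
    ultimately obtain n where n: "(1 / real r) ^ n < d" using real_arch_pow_inv by blast
    obtain w j where w: "w \<in> wds r" "j < r - 1" "\<bar>x - pt r (w @ [j]) 1\<bar> \<le> (1 / real r) ^ n"
      using right_ends_dense[OF r x] by blast
    have "w @ [j] \<in> wds r" using w by auto
    then have "pt r (w @ [j]) 1 \<in> S" using pt_in[OF r, of "w @ [j]" 1] e[OF w(1,2)]
      by (simp add: S_def)
    moreover have "dist (pt r (w @ [j]) 1) x < d" using w(3) n
      by (simp add: dist_real_def abs_minus_commute)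
    ultimately show "\<exists>y\<in>S. dist y x < d" by blast
  qed
  ultimately have "x \<in> S" by (simp add: closure_closed)
  then show "f (pt r u x) = pt r v x" by (simp add: S_def)
qed

text \<open>If \<open>g\<close> maps the interval of \<open>code w\<close> affinely onto that of \<open>u\<close>, then \<open>u = code v @ (q-1)\<^sup>i\<close>.
  Since \<open>f\<close> is affine near the right end of the interval of \<open>w\<close>, the run \<open>(q-1)\<^sup>i\<close> is empty.\<close>

lemma bad_code:
  assumes p: "p \<ge> 2" and q: "q \<ge> 2" and f: "f \<in> PLF p" and R: "gap_rel p q f g" and w: "w \<in> bad p f"
  shows "code p q w \<in> bad q g"
proof (rule ccontr)
  assume "code p q w \<notin> bad q g"
  then obtain u where u: "u \<in> wds q" "maps q g (code p q w) u" using code_wds[OF q]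
    by (auto simp: bad_def)
  have ww: "w \<in> wds p" using w by (simp add: bad_def)
  have sq: "1 / real q \<in> {1 / real q..(real q - 1) / real q}" using q
    by (simp add: divide_right_mono)
  \<comment> \<open>The parameter 1/q lies in every gap, also for \<open>q = 2\<close>, and is the
    right end of child 0, where addresses are unique. So equality of two points becomes equality of
    two words.\<close>
  have img: "u @ code p q x @ replicate j (q - 1) = code p q v @ replicate k (q - 1)"
    if x: "x \<in> wds p" "j < p - 1" and v: "v \<in> wds p" "k < p - 1"
      "f (pt p ((w @ x) @ [j]) 1) = pt p (v @ [k]) 1" for x j v k
  proof -
    define z where "z = code p q x @ replicate j (q - 1)"
    define z' where "z' = code p q v @ replicate k (q - 1)"
    have zw: "z \<in> wds q" "z' \<in> wds q" using code_wds[OF q] q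
      by (auto simp: z_def z'_def in_lists_conv_set)
    have "w @ x \<in> wds p" using ww x by auto
    from gap_relD[OF R this v(1) x(2) v(2,3) sq]
    have "g (pt q (code p q w @ z) (1 / real q)) = pt q z' (1 / real q)"
      by (simp add: gap_def z_def z'_def)
    moreover have "g (pt q (code p q w @ z) (1 / real q)) = pt q (u @ z) (1 / real q)"
      using mapsD[OF maps_append[OF q zw(1) u(2)], of "1 / real q"] q by simp
    ultimately have "pt q ((u @ z) @ [0]) 1 = pt q (z' @ [0]) 1" by (simp add: pt_append)
    then have "u @ z = z'" using pt_right_end_unique[OF q, of "u @ z" z' 0 0] u(1) zw q by auto
    then show ?thesis by (simp add: z_def z'_def)
  qed
  have p0: "0 < p - 1" using p by simp
  obtain v0 i where v0: "v0 \<in> wds p" "i < p - 1" "f (pt p (w @ [0]) 1) = pt p (v0 @ [i]) 1"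
    using PLF_preserves_right_ends[OF p f ww p0] by blast
  have u0: "u = code p q v0 @ replicate i (q - 1)" using img[of "[]" 0 v0 i] v0 p0 by simp
  \<comment> \<open>Below a good extension of \<open>w\<close> the first gap has a label with empty
    run. The \<open>n\<close> appended digits \<open>p - 1\<close> encode as
    \<open>(p - 1) * n\<close> digits \<open>q - 1\<close>, so the run of length \<open>i\<close> is
    left over and can be compared with the empty one.\<close>
  obtain n v where v: "v \<in> wds p" "maps p f (w @ replicate n (p - 1)) v"
    using good_extension[OF p f ww, of "p - 1"] p by auto
  have "f (pt p ((w @ replicate n (p - 1)) @ [0]) 1) = pt p (v @ [0]) 1"
    using mapsD[OF maps_append[OF p _ v(2), of "[0]"], of 1] p by simp
  then have "u @ replicate ((p - 1) * n) (q - 1) = code p q v"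
    using img[of "replicate n (p - 1)" 0 v 0] v(1) p0 p code_replicate[of p q n]
      by (simp add: in_lists_conv_set)
  then have "code p q (v0 @ replicate n (p - 1)) @ replicate i (q - 1)
    = code p q v @ replicate 0 (q - 1)"
    unfolding u0 code_simps code_replicate by (simp flip: replicate_add add: add.commute)
  moreover have "v0 @ replicate n (p - 1) \<in> wds p" using v0(1) p by (auto simp: in_lists_conv_set)
  ultimately have "i = 0" using code_run_unique[OF p q _ v(1) v0(2) p0] by blast
  then have u1: "u = code p q v0" using u0 by simp
  \<comment> \<open>Now \<open>u\<close> is itself a code, so each gap address below it decodes to a
    label that starts with \<open>v0\<close>, which gives the value of \<open>f\<close> at every
    right end below \<open>w\<close>.\<close>
  have "maps p f w v0"
  proof (rule maps_if_right_ends[OF p f ww v0(1)])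
    fix x j assume x: "x \<in> wds p" "j < p - 1"
    have wx: "w @ x \<in> wds p" "v0 @ x \<in> wds p" using ww v0(1) x by auto
    obtain v k where v: "v \<in> wds p" "k < p - 1" "f (pt p ((w @ x) @ [j]) 1) = pt p (v @ [k]) 1"
      using PLF_preserves_right_ends[OF p f wx(1) x(2)] by blast
    have "code p q (v0 @ x) @ replicate j (q - 1) = code p q v @ replicate k (q - 1)"
      using img[OF x v] u1 by simp
    then have "v = v0 @ x \<and> k = j" using code_run_unique[OF p q wx(2) v(1) x(2) v(2)] by blast
    then show "f (pt p w (pt p (x @ [j]) 1)) = pt p v0 (pt p (x @ [j]) 1)" using v(3)
      by (simp add: pt_append)
  qed
  then show False using w v0(1) by (auto simp: bad_def)
qed

lemma inj_code:
  assumes "p \<ge> 2" "q \<ge> 2" shows "inj_on (code p q) (wds p)"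
  using code_run_unique[OF assms, of _ _ 0 0] assms by (auto intro!: inj_onI)

lemma bad_gap_rel_le:
  assumes p: "p \<ge> 2" and q: "q \<ge> 2" and "f \<in> PLF p" "g \<in> PLF q" "gap_rel p q f g"
  shows "card (bad p f) \<le> card (bad q g)"
proof (rule card_inj_on_le[of "code p q"])
  show "inj_on (code p q) (bad p f)"
    by (rule inj_on_subset[OF inj_code[OF p q]]) (auto simp: bad_def)
  show "code p q ` bad p f \<subseteq> bad q g" using bad_code[OF p q assms(3,5)] by blast
  show "finite (bad q g)" using PLF_D(7)[OF q assms(4)] .
qed

section \<open>The upper bound and the conclusion\<close>

lemma word_length_hom_le:
  assumes G: "group G" and H: "group H" and h: "h \<in> hom G H" and S: "S \<subseteq> carrier G" "finite S"
    and T: "T \<subseteq> carrier H" and gen: "\<And>g. g \<in> carrier G \<Longrightarrow> \<exists>n. word_of G S n g"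
    and gen': "\<And>g. g \<in> carrier H \<Longrightarrow> \<exists>n. word_of H T n g"
  shows "\<exists>M. \<forall>g\<in>carrier G. word_length H T (h g) \<le> M * word_length G S g"
proof -
  interpret G: group G using G .
  interpret H: group H using H .
  define A where "A = S \<union> m_inv G ` S"
  have AG: "A \<subseteq> carrier G" using G.letters_carrier[OF S(1)] by (simp add: A_def)
  define M where "M = Max (insert 0 ((\<lambda>x. word_length H T (h x)) ` A))"
  have M: "word_length H T (h x) \<le> M" if "x \<in> A" for x unfolding M_def using S(2) that
    by (intro Max_ge) (auto simp: A_def)
  have hA: "word_of H T M (h x)" if x: "x \<in> A" for x
  proof -
    have "h x \<in> carrier H" using x AG h by (auto simp: hom_def)
    then obtain n where "word_of H T n (h x)" using gen' by blast
    from word_length_attained[OF this] have "word_of H T (word_length H T (h x)) (h x)"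
      unfolding word_of_def by (metis order_refl)
    then show ?thesis using M[OF x] by (rule word_of_mono)
  qed
  have h1: "h \<one>\<^bsub>G\<^esub> = \<one>\<^bsub>H\<^esub>" using group_hom.hom_one[of G H h] G H h
    by (simp add: group_hom_def group_hom_axioms_def)
  have fold: "word_of H T (M * length ws) (h (foldr (\<lambda>x y. x \<otimes>\<^bsub>G\<^esub> y) ws \<one>\<^bsub>G\<^esub>))" if
    "set ws \<subseteq> A" for ws
    using that
  proof (induction ws)
    case Nil
    show ?case using word_of_one[of H T] h1 by simp
  next
    case (Cons x ws)
    have x: "x \<in> A" "x \<in> carrier G" "set ws \<subseteq> carrier G" using Cons.prems AG by auto
    have "h (foldr (\<lambda>x y. x \<otimes>\<^bsub>G\<^esub> y) (x # ws) \<one>\<^bsub>G\<^esub>) = h x \<otimes>\<^bsub>H\<^esub> h (foldr (\<lambda>x y. x \<otimes>\<^bsub>G\<^esub> y) ws \<one>\<^bsub>G\<^esub>)"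
      using hom_mult[OF h x(2) G.foldr_closed[OF x(3)]] by simp
    then show ?case using H.word_of_mult[OF T hA[OF x(1)] Cons.IH] Cons.prems by simp
  qed
  show ?thesis
  proof (intro exI[of _ M] ballI)
    fix g assume g: "g \<in> carrier G"
    obtain n where "word_of G S n g" using gen[OF g] by blast
    from word_length_attained[OF this] obtain ws where ws: "length ws = word_length G S g"
      "set ws \<subseteq> A"
      "foldr (\<lambda>x y. x \<otimes>\<^bsub>G\<^esub> y) ws \<one>\<^bsub>G\<^esub> = g" unfolding A_def by blast
    show "word_length H T (h g) \<le> M * word_length G S g"
      using word_length_le[OF fold[OF ws(2)]] ws by simp
  qed
qed

theorem theorem10:
  fixes p q :: nat
  assumes "p \<ge> 2" and "q \<ge> 2"
  shows "\<exists>\<phi>. \<phi> \<in> hom (Fgrp p) (Fgrp q) \<and> inj_on \<phi> (carrier (Fgrp p))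
          \<and> qi_embedding (carrier (Fgrp p))
               (word_dist (Fgrp p) (Fgens p)) (word_dist (Fgrp q) (Fgens q)) \<phi>"
proof -
  note p = assms(1) and q = assms(2)
  interpret P: group "Fgrp p" using group_Fgrp[OF p] .
  interpret Q: group "Fgrp q" using group_Fgrp[OF q] .
  \<comment> \<open>Outside \<open>PLF p\<close> the choice is arbitrary; on \<open>PLF p\<close>
    the gap relation determines the value, whence multiplicativity.\<close>
  obtain \<phi> where \<phi>: "\<And>f. f \<in> PLF p \<Longrightarrow> \<phi> f \<in> PLF q \<and> gap_rel p q f (\<phi> f)"
    using gap_rel_exists[OF p q] by metis
  have mult: "\<phi> (f \<circ> g) = \<phi> f \<circ> \<phi> g" if "f \<in> PLF p" "g \<in> PLF p" for f g
    using gap_rel_unique[OF p q PLF_comp[OF p that]] \<phi>[OF PLF_comp[OF p that]] PLF_comp[OF q]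
      gap_rel_comp[OF p that(2)]
      \<phi>[OF that(1)] \<phi>[OF that(2)] by blast
  have hom: "\<phi> \<in> hom (Fgrp p) (Fgrp q)" unfolding hom_def using \<phi> mult by auto
  interpret h: group_hom "Fgrp p" "Fgrp q" \<phi> by unfold_locales (rule hom)
  obtain M where M: "\<And>f. f \<in> PLF q \<Longrightarrow> card (bad q f) \<le> M * word_length (Fgrp q) (Fgens q) f"
    using bad_le_word_length[OF q] by blast
  have low: "word_length (Fgrp p) (Fgens p) f \<le> 6 * M * word_length (Fgrp q) (Fgens q) (\<phi> f)" if f:
    "f \<in> PLF p" for f
  proof -
    have "word_length (Fgrp p) (Fgens p) f \<le> 6 * card (bad p f)"
      using word_length_le[OF word_of_bad[OF p f]] .
    also have "\<dots> \<le> 6 * card (bad q (\<phi> f))" using bad_gap_rel_le[OF p q f] \<phi>[OF f] by simp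
    also have "\<dots> \<le> 6 * (M * word_length (Fgrp q) (Fgens q) (\<phi> f))" using M \<phi>[OF f] by simp
    finally show ?thesis by simp
  qed
  obtain N where N: "\<And>f. f \<in> PLF p
    \<Longrightarrow> word_length (Fgrp q) (Fgens q) (\<phi> f) \<le> N * word_length (Fgrp p) (Fgens p) f"
  proof -
    have "\<exists>N. \<forall>f\<in>carrier (Fgrp p). word_length (Fgrp q) (Fgens q) (\<phi> f) \<le> N * word_length (Fgrp p) (Fgens p) f"
    proof (rule word_length_hom_le[OF P.is_group Q.is_group hom])
      show "finite (Fgens p)" by (simp add: Fgens_def)
    qed (use Fgens_carrier[OF p] Fgens_carrier[OF q] word_of_bad[OF p] word_of_bad[OF q] in \<open>simp_all, blast+\<close>)
    then show ?thesis using that by auto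
  qed
  have inj: "inj_on \<phi> (carrier (Fgrp p))"
  proof (rule inj_onI)
    fix a c assume ac: "a \<in> carrier (Fgrp p)" "c \<in> carrier (Fgrp p)" "\<phi> a = \<phi> c"
    define f where "f = inv\<^bsub>Fgrp p\<^esub> a \<otimes>\<^bsub>Fgrp p\<^esub> c"
    have f: "f \<in> carrier (Fgrp p)" unfolding f_def by (intro P.m_closed P.inv_closed ac)
    have e: "\<phi> f = \<one>\<^bsub>Fgrp q\<^esub>"
      unfolding f_def using ac by (simp only: h.hom_mult h.hom_inv P.inv_closed Q.l_inv
        h.hom_closed)
    have "word_length (Fgrp q) (Fgens q) (\<phi> f) = 0"
      using word_length_le[OF word_of_one[of "Fgrp q" "Fgens q" 0]] e by simp
    then have "word_length (Fgrp p) (Fgens p) f = 0" using low[of f] f by simp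
    moreover have "f \<in> PLF p" using f by simp
    ultimately obtain ws where "length ws = 0" "foldr (\<lambda>x y. x \<otimes>\<^bsub>Fgrp p\<^esub> y) ws \<one>\<^bsub>Fgrp p\<^esub> = f"
      using word_length_attained[OF word_of_bad[OF p]] by metis
    then have "inv\<^bsub>Fgrp p\<^esub> a \<otimes>\<^bsub>Fgrp p\<^esub> c = \<one>\<^bsub>Fgrp p\<^esub>" unfolding f_def by (simp del: Fgrp_simps)
    then show "a = c" using P.inv_equality[of
      "inv\<^bsub>Fgrp p\<^esub> a" c] ac P.inv_inv P.inv_closed P.inv_solve_left' by (metis P.inv_comm)
  qed
  \<comment> \<open>One constant for both inequalities: \<open>6 * M\<close> serves the lower one,
    \<open>N\<close> the upper one, and the summand 1 ensures \<open>C \<ge> 1\<close>.\<close>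
  define C where "C = 1 + 6 * real M + real N"
  have "qi_embedding (carrier (Fgrp p)) (word_dist (Fgrp p) (Fgens p)) (word_dist (Fgrp q) (Fgens q)) \<phi>"
    unfolding qi_embedding_def
  proof (rule exI[of _ C], rule exI[of _ 0], intro conjI ballI)
    fix a c assume a: "a \<in> carrier (Fgrp p)" "c \<in> carrier (Fgrp p)"
    define d where "d = inv\<^bsub>Fgrp p\<^esub> a \<otimes>\<^bsub>Fgrp p\<^esub> c"
    have d: "d \<in> carrier (Fgrp p)" unfolding d_def by (intro P.m_closed P.inv_closed a)
    have e: "inv\<^bsub>Fgrp q\<^esub> (\<phi> a) \<otimes>\<^bsub>Fgrp q\<^esub> \<phi> c = \<phi> d"
      unfolding d_def using a by (simp only: h.hom_mult h.hom_inv P.inv_closed)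
    let ?x = "real (word_length (Fgrp p) (Fgens p) d)" and ?y =
      "real (word_length (Fgrp q) (Fgens q) (\<phi> d))"
    have dp: "d \<in> PLF p" using d by simp
    have "?x \<le> real (6 * M * word_length (Fgrp q) (Fgens q) (\<phi> d))" using low[OF dp]
      by (simp only: of_nat_le_iff)
    also have "\<dots> \<le> C * ?y" by (simp add: C_def distrib_right)
    finally have 1: "?x \<le> C * ?y" .
    have "?y \<le> real (N * word_length (Fgrp p) (Fgens p) d)" using N[OF dp]
      by (simp only: of_nat_le_iff)
    also have "\<dots> \<le> C * ?x" by (simp add: C_def distrib_right)
    finally have 2: "?y \<le> C * ?x" .
    have Cpos: "C > 0" by (simp add: C_def add_pos_nonneg)
    show "word_dist (Fgrp p) (Fgens p) a c / C - 0 \<le> word_dist (Fgrp q) (Fgens q) (\<phi> a) (\<phi> c)"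
      unfolding word_dist_def e d_def[symmetric] using 1 Cpos
        by (simp add: divide_le_eq mult.commute)
    show "word_dist (Fgrp q) (Fgens q) (\<phi> a) (\<phi> c) \<le> C * word_dist (Fgrp p) (Fgens p) a c + 0"
      unfolding word_dist_def e d_def[symmetric] using 2 by simp
  qed (auto simp: C_def)
  then show ?thesis using hom inj by blast
qed

end
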